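(* Let $N\in\mathbb{N}$, $1<p<N$, $p^*=\frac{Np}{N-p}$. Let $a_\infty\in L^\infty(\mathbb{R}^N)$ be of the form $a_\infty(x)=\Theta\left(\frac{x}{|x|}\right)$ for all $x\neq 0$, where $\Theta\in C^1(S^{N-1})$ and $\min_{S^{N-1}}\Theta>0$. If $u\in W^{1,p}(\mathbb{R}^N)$ is a weak solution to $$-\Delta_p u+a_\infty(x)|u|^{p-2}u=|u|^{p^*-2}u\qquad\text{in }\mathbb{R}^N,$$ then $u\equiv 0$.
   Context: $\Delta_p u=\operatorname{div}(|\nabla u|^{p-2}\nabla u)$. A weak solution $u\in W^{1,p}(\mathbb{R}^N)$ satisfies $\int_{\mathbb{R}^N}\big(|\nabla u|^{p-2}\nabla u\cdot\nabla\varphi+a_\infty|u|^{p-2}u\varphi\big)dx=\int_{\mathbb{R}^N}|u|^{p^*-2}u\varphi\,dx$ for all $\varphi\in C_c^\infty(\mathbb{R}^N)$. Functions are real-valued and may change sign. *)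

theory Defs
  imports "HOL-Analysis.Analysis"
begin

(* Meant for open S. *)
primrec Ck_on :: "nat \<Rightarrow> 'a::euclidean_space set \<Rightarrow> ('a \<Rightarrow> real) \<Rightarrow> bool" where
  "Ck_on 0 S f \<longleftrightarrow> continuous_on S f"
| "Ck_on (Suc k) S f \<longleftrightarrow>
     (\<forall>x\<in>S. f differentiable (at x)) \<and>
     (\<forall>v. Ck_on k S (\<lambda>x. frechet_derivative f (at x) v))"

(* C^1 functions on an embedded submanifold: f is locally the restriction of
   a C^1 function of the ambient space. *)
definition C1_on_submanifold :: "'a::euclidean_space set \<Rightarrow> ('a \<Rightarrow> real) \<Rightarrow> bool" where
  "C1_on_submanifold M f \<longleftrightarrow>
     (\<forall>x\<in>M. \<exists>U F. open U \<and> x \<in> U \<and> Ck_on 1 U F \<and> (\<forall>y\<in>M \<inter> U. f y = F y))"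

definition test_function :: "('a::euclidean_space \<Rightarrow> real) \<Rightarrow> bool" where
  "test_function \<phi> \<longleftrightarrow> (\<forall>k. Ck_on k UNIV \<phi>) \<and> compact (closure {x. \<phi> x \<noteq> 0})"

definition grad :: "(real ^ 'n \<Rightarrow> real) \<Rightarrow> real ^ 'n \<Rightarrow> real ^ 'n" where
  "grad \<phi> x = (\<chi> i. frechet_derivative \<phi> (at x) (axis i 1))"

(* The elements of the following function spaces are functions, not classes
   modulo equality almost everywhere. *)

definition Lp :: "real \<Rightarrow> (real ^ 'n \<Rightarrow> 'b::euclidean_space) set" where
  "Lp p = {f. f \<in> borel_measurable lebesgue \<and> integrable lebesgue (\<lambda>x. norm (f x) powr p)}"

definition Linf :: "(real ^ 'n \<Rightarrow> real) set" where
  "Linf = {f. f \<in> borel_measurable lebesgue \<and> (\<exists>C. AE x in lebesgue. \<bar>f x\<bar> \<le> C)}"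

definition L1_loc :: "(real ^ 'n \<Rightarrow> 'b::euclidean_space) set" where
  "L1_loc = {f. \<forall>K. compact K \<longrightarrow> set_integrable lebesgue K f}"

definition has_weak_gradient ::
    "(real ^ 'n \<Rightarrow> real) \<Rightarrow> (real ^ 'n \<Rightarrow> real ^ 'n) \<Rightarrow> bool" where
  "has_weak_gradient u g \<longleftrightarrow> u \<in> L1_loc \<and> g \<in> L1_loc \<and>
     (\<forall>\<phi> i. test_function \<phi> \<longrightarrow>
        (LINT x|lebesgue. u x * grad \<phi> x $ i) = - (LINT x|lebesgue. g x $ i * \<phi> x))"

definition W1p :: "real \<Rightarrow> (real ^ 'n \<Rightarrow> real) set" where
  "W1p p = {u. u \<in> Lp p \<and> (\<exists>g. has_weak_gradient u g \<and> g \<in> Lp p)}"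

definition critical_exponent :: "nat \<Rightarrow> real \<Rightarrow> real" where
  "critical_exponent N p = real N * p / (real N - p)"

(* The weak gradient g is unique up to null sets, so its choice is immaterial.
   Where g or u vanishes, the factors with negative exponent are harmless,
   since 0 powr s = 0. For u in W1p p with 1 < p < N all integrands are
   integrable, by the Sobolev embedding into L^q with q = critical_exponent N p. *)
definition weak_solution ::
    "real \<Rightarrow> (real ^ 'n \<Rightarrow> real) \<Rightarrow> (real ^ 'n \<Rightarrow> real) \<Rightarrow> bool" where
  "weak_solution p a u \<longleftrightarrow> u \<in> W1p p \<and>
     (\<exists>g. has_weak_gradient u g \<and>
       (\<forall>\<phi>. test_function \<phi> \<longrightarrow>
          (LINT x|lebesgue. norm (g x) powr (p - 2) * (g x \<bullet> grad \<phi> x)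
                            + a x * \<bar>u x\<bar> powr (p - 2) * u x * \<phi> x)
          = (LINT x|lebesgue.
               \<bar>u x\<bar> powr (critical_exponent CARD('n) p - 2) * u x * \<phi> x)))"

end

theory Submission
  imports Defs "HOL-Probability.Probability" "HOL-Real_Asymp.Real_Asymp"
begin

text \<open>The theorem is a Pohozaev type nonexistence result. Write \<open>q = N p / (N - p)\<close> for the critical exponent
and \<open>A\<close>, \<open>B\<close>, \<open>C\<close> for the integrals of \<open>\<bar>\<nabla>u\<bar> powr p\<close>, \<open>a \<bar>u\<bar> powr p\<close> and \<open>\<bar>u\<bar> powr q\<close>. Testing the
equation with \<open>u\<close> gives \<open>A + B = C\<close>. The weight \<open>a\<close> is homogeneous of degree zero, so along the dilations
\<open>u(\<mu> x)\<close> the three integrals scale with the powers \<open>p - N\<close>, \<open>- N\<close> and \<open>- N\<close> of \<open>\<mu>\<close>; if the energy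
\<open>A / p + B / p - C / q\<close> is stationary along dilations, then \<open>(p - N) / p A - N / p B + N / q C = 0\<close>. As
\<open>N / q = (N - p) / p\<close>, the two identities leave \<open>- B = 0\<close>, and \<open>u = 0\<close> since \<open>a\<close> is bounded below by a
positive constant.

A weak solution need not be regular enough for \<open>x \<bullet> \<nabla>u\<close> to be a test function. The dilation itself is
used instead: the equation is tested with \<open>\<eta> (u(\<mu> x) - u x)\<close>, where \<open>\<mu> > 1\<close> and \<open>\<eta>\<close> is a cutoff.
Convexity of \<open>\<bar>_\<bar> powr p\<close> bounds the left-hand side from above by a difference of energies, convexity of
\<open>\<bar>_\<bar> powr q\<close> bounds the right-hand side from below, and dividing by \<open>\<mu> - 1\<close> leads to
\<open>0 \<le> (p - N) / p A - N / p B + N / q C\<close> (\<open>dilation_inequality\<close>, \<open>pohozaev_inequality\<close>). Combined with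
\<open>A + B = C\<close> this inequality gives \<open>B \<le> 0\<close>. The error made on the right is the integral of
\<open>\<eta> \<bar>F(u(\<mu> x)) - F(u x)\<bar> \<bar>u(\<mu> x) - u x\<bar>\<close> with \<open>F s = \<bar>s\<bar> powr (q - 2) * s\<close>. The second factor is of order
\<open>\<mu> - 1\<close> in \<open>L^p\<close> on bounded sets (\<open>dilation_displacement\<close>), so the error is \<open>o(\<mu> - 1)\<close> as soon as \<open>F(u)\<close>
lies in the dual space \<open>L^(p / (p - 1))\<close>, because dilations act continuously there.

This integrability of \<open>F(u)\<close> exceeds what the Sobolev embedding gives, and both come from one device, a
slicing of the range of \<open>u\<close>. Let \<open>m j\<close> be the measure of \<open>{\<bar>u\<bar> > 2 ^ j}\<close> and let \<open>u_j\<close> be a smooth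
truncation of \<open>u\<close> that moves only while \<open>2 ^ j < \<bar>u\<bar> < 2 ^ (j + 1)\<close>. Comparing \<open>u_j(x + h)\<close> with \<open>u_j x\<close>
for all \<open>h\<close> in a ball of volume \<open>2 m j\<close> (\<open>level_set_estimate\<close>) bounds \<open>2 powr (j p) * m (j + 1)\<close> by a
constant times \<open>m j powr (p / N)\<close> times the energy of \<open>u_j\<close>. For the weights \<open>e j = 2 powr (j q) m j\<close>
(\<open>level_weight\<close>) this reads \<open>e (j + 1) \<le> c (e j) powr (p / N) G j\<close> with the energies \<open>G j\<close> of the slices
(\<open>level_step\<close>). The \<open>G j\<close> have a finite sum, since the slices move at disjoint places; hence \<open>e\<close> is
summable, which is the Sobolev embedding. For a solution, testing with \<open>u_j\<close> bounds \<open>G j\<close> by a multiple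
of \<open>sup {e i | i \<ge> j}\<close>; since \<open>e j\<close> tends to zero, the sequence then decays faster than every geometric
sequence, so \<open>u\<close> lies in \<open>L^s\<close> for all \<open>s \<ge> q\<close> (\<open>high_integrability\<close>).

Passages from test functions to Sobolev functions rest on \<open>dominated_test_functions\<close>: a Sobolev function and its weak gradient are
almost everywhere limits of test functions and their gradients, under one common majorant in \<open>L^p\<close>.\<close>

section \<open>Smooth functions, gradients and bump functions\<close>

definition smooth :: "('a::euclidean_space \<Rightarrow> real) \<Rightarrow> bool" where
  "smooth f \<longleftrightarrow> (\<forall>k. Ck_on k UNIV f)"

lemma Ck_on_SucI:
  assumes "\<And>x. (f has_derivative f' x) (at x)" and "\<And>v. Ck_on k UNIV (\<lambda>x. f' x v)"
  shows "Ck_on (Suc k) UNIV f"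
proof -
  have "frechet_derivative f (at x) = f' x" for x
    using assms(1) frechet_derivative_at by metis
  thus ?thesis using assms by (auto simp: differentiable_def)
qed

lemma Ck_on_SucD:
  assumes "Ck_on (Suc k) UNIV f"
  shows "(f has_derivative frechet_derivative f (at x)) (at x)"
    and "Ck_on k UNIV (\<lambda>x. frechet_derivative f (at x) v)"
  using assms by (auto simp: frechet_derivative_works)

lemma Ck_on_down: "Ck_on (Suc k) UNIV f \<Longrightarrow> Ck_on k UNIV f"
proof (induction k arbitrary: f)
  case 0
  then show ?case
    by (auto intro!: differentiable_imp_continuous_on simp: differentiable_on_def
        intro: differentiable_at_withinI)
next
  case (Suc k)
  show ?case
    by (rule Ck_on_SucI[OF Ck_on_SucD(1)[OF Suc.prems]]) (rule Suc.IH, rule Ck_on_SucD(2)[OF Suc.prems])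
qed

lemma Ck_on_const: "Ck_on k UNIV (\<lambda>x. c)"
proof (induction k arbitrary: c)
  case (Suc k)
  show ?case by (rule Ck_on_SucI[where f' = "\<lambda>_ _. 0"]) (auto intro: Suc)
qed simp

lemma Ck_on_inner: "Ck_on k UNIV (\<lambda>x::'a::euclidean_space. x \<bullet> w)"
proof (cases k)
  case (Suc k)
  show ?thesis unfolding Suc
    by (rule Ck_on_SucI[where f' = "\<lambda>_ v. v \<bullet> w"])
       (auto intro: Ck_on_const intro!: bounded_linear_imp_has_derivative bounded_linear_inner_left)
qed (auto intro!: continuous_intros)

lemma Ck_on_add:
  "Ck_on k UNIV f \<Longrightarrow> Ck_on k UNIV g \<Longrightarrow> Ck_on k UNIV (\<lambda>x. f x + g x)"
proof (induction k arbitrary: f g)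
  case (Suc k)
  show ?case
    by (rule Ck_on_SucI, rule has_derivative_add[OF Ck_on_SucD(1)[OF Suc.prems(1)] Ck_on_SucD(1)[OF Suc.prems(2)]])
       (intro Suc.IH Ck_on_SucD(2) Suc.prems)
qed (auto intro: continuous_intros)

lemma Ck_on_mult:
  "Ck_on k UNIV f \<Longrightarrow> Ck_on k UNIV g \<Longrightarrow> Ck_on k UNIV (\<lambda>x. f x * g x)"
proof (induction k arbitrary: f g)
  case (Suc k)
  show ?case
    by (rule Ck_on_SucI, rule has_derivative_mult[OF Ck_on_SucD(1)[OF Suc.prems(1)] Ck_on_SucD(1)[OF Suc.prems(2)]])
       (intro Ck_on_add Suc.IH Ck_on_SucD(2) Suc.prems Ck_on_down[OF Suc.prems(1)] Ck_on_down[OF Suc.prems(2)])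
qed (auto intro: continuous_intros)

text \<open>Only outer functions on the reals occur, where the chain rule turns the derivative of a composition into
a product of functions that are again covered by the induction hypothesis and \<open>Ck_on_mult\<close>.\<close>

lemma Ck_on_compose:
  fixes T :: "real \<Rightarrow> real"
  shows "Ck_on k UNIV T \<Longrightarrow> Ck_on k UNIV f \<Longrightarrow> Ck_on k UNIV (\<lambda>x. T (f x))"
proof (induction k arbitrary: T f)
  case (Suc k)
  let ?T' = "\<lambda>s. frechet_derivative T (at s)"
  have lin: "?T' s v = v * ?T' s 1" for s v
  proof -
    have "linear (?T' s)" using Ck_on_SucD(1)[OF Suc.prems(1)] has_derivative_linear by blast
    thus ?thesis using linear_scale[of "?T' s" v 1] by simp
  qed
  have D: "((\<lambda>x. T (f x)) has_derivative (\<lambda>v. frechet_derivative f (at x) v * ?T' (f x) 1)) (at x)" for x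
    using has_derivative_compose[OF Ck_on_SucD(1)[OF Suc.prems(2)] Ck_on_SucD(1)[OF Suc.prems(1)], of x]
    by (subst (asm) lin)
  show ?case
    by (rule Ck_on_SucI, rule D, rule Ck_on_mult, rule Ck_on_SucD(2)[OF Suc.prems(2)])
       (rule Suc.IH[OF Ck_on_SucD(2)[OF Suc.prems(1)] Ck_on_down[OF Suc.prems(2)]])
next
  case 0
  then show ?case by (auto intro: continuous_on_compose2)
qed

lemma Ck_on_affine:
  "Ck_on k UNIV f \<Longrightarrow> Ck_on k UNIV (\<lambda>x. f (c *\<^sub>R x + h))"
proof (induction k arbitrary: f)
  case (Suc k)
  have D: "((\<lambda>x. f (c *\<^sub>R x + h)) has_derivative (\<lambda>v. frechet_derivative f (at (c *\<^sub>R x + h)) (c *\<^sub>R v))) (at x)" for x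
    by (rule has_derivative_compose[OF _ Ck_on_SucD(1)[OF Suc.prems]]) (auto intro!: derivative_eq_intros)
  show ?case
    by (rule Ck_on_SucI, rule D) (rule Suc.IH, rule Ck_on_SucD(2)[OF Suc.prems])
next
  case 0
  then show ?case by (auto intro!: continuous_on_compose2[of UNIV f] continuous_intros)
qed

lemma smooth_const: "smooth (\<lambda>x. c)"
  by (simp add: smooth_def Ck_on_const)

lemma smooth_inner: "smooth (\<lambda>x. x \<bullet> w)"
  by (simp add: smooth_def Ck_on_inner)

lemma smooth_add: "smooth f \<Longrightarrow> smooth g \<Longrightarrow> smooth (\<lambda>x. f x + g x)"
  by (simp add: smooth_def Ck_on_add)

lemma smooth_mult: "smooth f \<Longrightarrow> smooth g \<Longrightarrow> smooth (\<lambda>x. f x * g x)"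
  by (simp add: smooth_def Ck_on_mult)

lemma smooth_compose: "smooth T \<Longrightarrow> smooth f \<Longrightarrow> smooth (\<lambda>x. T (f x))" for T :: "real \<Rightarrow> real"
  by (simp add: smooth_def Ck_on_compose)

lemma smooth_affine: "smooth f \<Longrightarrow> smooth (\<lambda>x. f (c *\<^sub>R x + h))"
  by (simp add: smooth_def Ck_on_affine)

lemma smooth_diff: "smooth f \<Longrightarrow> smooth g \<Longrightarrow> smooth (\<lambda>x. f x - g x)"
  using smooth_add[of f "\<lambda>x. (-1) * g x"] smooth_mult[OF smooth_const[of "-1"], of g] by simp

lemma smooth_affine_real: "smooth f \<Longrightarrow> smooth (\<lambda>x::real. f (d * x + h))"
  using smooth_affine[of f d h] by simp

lemma smooth_sum: "(\<And>i. i \<in> I \<Longrightarrow> smooth (f i)) \<Longrightarrow> smooth (\<lambda>x. \<Sum>i\<in>I. f i x)"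
  by (induction I rule: infinite_finite_induct) (simp_all add: smooth_const smooth_add)

lemma smooth_norm_square: "smooth (\<lambda>x::'a::euclidean_space. (norm x)\<^sup>2)"
proof -
  have "(norm x)\<^sup>2 = (\<Sum>b\<in>Basis. (x \<bullet> b) * (x \<bullet> b))" for x :: 'a
    by (simp add: power2_norm_eq_inner euclidean_inner[of x x])
  thus ?thesis by (simp add: smooth_sum smooth_mult smooth_inner)
qed

lemma smooth_has_derivative: "smooth f \<Longrightarrow> (f has_derivative frechet_derivative f (at x)) (at x)"
  by (rule Ck_on_SucD(1)[of 0]) (simp only: smooth_def)

lemma smooth_frechet: "smooth f \<Longrightarrow> smooth (\<lambda>x. frechet_derivative f (at x) v)"
  using Ck_on_SucD(2) unfolding smooth_def by blast

lemma smooth_continuous: "smooth f \<Longrightarrow> continuous_on UNIV f"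
  unfolding smooth_def by (metis Ck_on.simps(1))

lemma smooth_from_antiderivative:
  fixes f :: "real \<Rightarrow> real"
  assumes "\<And>x. (f has_real_derivative f' x) (at x)" "smooth f'"
  shows "smooth f"
  unfolding smooth_def
proof
  fix k
  have "Ck_on (Suc k) UNIV f"
    by (rule Ck_on_SucI, rule assms(1)[THEN has_field_derivative_imp_has_derivative])
       (use assms(2) in \<open>simp add: smooth_def Ck_on_mult Ck_on_const\<close>)
  thus "Ck_on k UNIV f" by (rule Ck_on_down)
qed



lemma grad_unique:
  assumes "(f has_derivative (\<lambda>v. G \<bullet> v)) (at x)" shows "grad f x = G"
  unfolding grad_def frechet_derivative_at[OF assms, symmetric]
  by (simp add: vec_eq_iff inner_axis)

text \<open>The gradient is built from the partial derivatives; expanding a direction in the standard basis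
identifies the inner product with it as the full derivative.\<close>

lemma smooth_has_grad:
  assumes "smooth f" shows "(f has_derivative (\<lambda>v. grad f x \<bullet> v)) (at x)"
proof -
  let ?D = "frechet_derivative f (at x)"
  have lin: "linear ?D" using smooth_has_derivative[OF assms] has_derivative_linear by blast
  have "?D v = grad f x \<bullet> v" for v
  proof -
    have "?D v = ?D (\<Sum>i\<in>UNIV. v $ i *\<^sub>R axis i 1)"
      by (simp add: basis_expansion flip: scalar_mult_eq_scaleR)
    also have "\<dots> = (\<Sum>i\<in>UNIV. v $ i * ?D (axis i 1))"
      by (simp add: linear_sum[OF lin] linear_scale[OF lin] o_def)
    finally show ?thesis by (simp add: inner_vec_def grad_def mult.commute)
  qed
  thus ?thesis using smooth_has_derivative[OF assms, of x] by presburger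
qed

lemma smooth_grad_component: "smooth f \<Longrightarrow> smooth (\<lambda>x. grad f x $ i)"
  unfolding grad_def using smooth_frechet by simp

lemma smooth_grad_continuous: "smooth f \<Longrightarrow> continuous_on UNIV (grad f)"
  using smooth_continuous[OF smooth_grad_component]
  by (intro continuous_on_vec_lambda[of UNIV "\<lambda>i x. grad f x $ i", simplified])

lemma grad_mult:
  assumes "smooth f" "smooth g"
  shows "grad (\<lambda>x. f x * g x) x = f x *\<^sub>R grad g x + g x *\<^sub>R grad f x"
  by (rule grad_unique, rule has_derivative_eq_rhs,
      rule has_derivative_mult[OF smooth_has_grad[OF assms(1)] smooth_has_grad[OF assms(2)]])
     (auto simp: inner_add_left)

lemma grad_diff:
  assumes "smooth f" "smooth g"
  shows "grad (\<lambda>x. f x - g x) x = grad f x - grad g x"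
  by (rule grad_unique, rule has_derivative_eq_rhs,
      rule has_derivative_diff[OF smooth_has_grad[OF assms(1)] smooth_has_grad[OF assms(2)]])
     (auto simp: inner_diff_left)

lemma grad_compose:
  assumes "(T has_real_derivative T') (at (f x))" "smooth f"
  shows "grad (\<lambda>x. T (f x)) x = T' *\<^sub>R grad f x"
  by (rule grad_unique, rule has_derivative_eq_rhs,
      rule has_derivative_compose[OF smooth_has_grad[OF assms(2)] assms(1)[THEN has_field_derivative_imp_has_derivative]])
     auto

lemma grad_affine:
  assumes "smooth f"
  shows "grad (\<lambda>x. f (c *\<^sub>R x + h)) x = c *\<^sub>R grad f (c *\<^sub>R x + h)"
proof -
  have "((\<lambda>x. f (c *\<^sub>R x + h)) has_derivative (\<lambda>v. grad f (c *\<^sub>R x + h) \<bullet> (c *\<^sub>R v))) (at x)"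
    by (rule has_derivative_compose[OF _ smooth_has_grad[OF assms]]) (auto intro!: derivative_eq_intros)
  thus ?thesis by (intro grad_unique) simp
qed


lemma test_functionI:
  assumes "smooth f" "\<And>x. norm x > R \<Longrightarrow> f x = 0"
  shows "test_function f"
proof -
  have "{x. f x \<noteq> 0} \<subseteq> cball 0 R" using assms(2) by (force simp: not_le)
  hence "bounded {x. f x \<noteq> 0}" using bounded_cball bounded_subset by blast
  thus ?thesis using assms(1) by (auto simp: test_function_def smooth_def compact_closure)
qed

lemma test_function_smooth: "test_function f \<Longrightarrow> smooth f"
  by (simp add: test_function_def smooth_def)

lemma test_function_support:
  assumes "test_function f" obtains R where "R > 0" "\<And>x. norm x > R \<Longrightarrow> f x = 0"
proof -
  have "bounded {x. f x \<noteq> 0}" using assms by (simp add: test_function_def compact_closure)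
  then obtain R where R: "\<And>x. f x \<noteq> 0 \<Longrightarrow> norm x \<le> R" by (auto simp: bounded_iff)
  show ?thesis by (rule that[of "\<bar>R\<bar> + 1"]) (use R in force)+
qed

lemma frechet_zero_outside:
  fixes f :: "'a::euclidean_space \<Rightarrow> real"
  assumes "\<And>x. norm x > R \<Longrightarrow> f x = 0" "norm x > R"
  shows "frechet_derivative f (at x) = (\<lambda>v. 0)"
proof -
  have "open (- cball 0 R :: 'a set)" by (simp add: open_Compl)
  hence "(f has_derivative (\<lambda>v. 0)) (at x)"
    by (rule has_derivative_transform_within_open[OF has_derivative_const[of 0]])
       (use assms in \<open>auto\<close>)
  thus ?thesis using frechet_derivative_at by metis
qed

lemma grad_zero_outside:
  assumes "\<And>x. norm x > R \<Longrightarrow> f x = (0::real)" "norm x > R"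
  shows "grad f x = 0"
  using frechet_zero_outside[OF assms] by (simp add: grad_def vec_eq_iff)

lemma test_function_frechet: 
  assumes "test_function f" shows "test_function (\<lambda>x. frechet_derivative f (at x) v)"
proof -
  obtain R where R: "\<And>x. norm x > R \<Longrightarrow> f x = 0" using test_function_support[OF assms] by metis
  show ?thesis
    by (rule test_functionI[of _ R], rule smooth_frechet[OF test_function_smooth[OF assms]])
       (simp add: frechet_zero_outside[of R f, OF R])
qed

lemma bounded_continuous_support:
  fixes f :: "'a::euclidean_space \<Rightarrow> 'b::real_normed_vector"
  assumes "continuous_on UNIV f" "\<And>x. norm x > R \<Longrightarrow> f x = 0"
  obtains B where "B > 0" "\<And>x. norm (f x) \<le> B"
proof -
  have "compact (f ` cball 0 R)" by (intro compact_continuous_image continuous_on_subset[OF assms(1)]) auto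
  then obtain B where B: "\<And>x. x \<in> cball 0 R \<Longrightarrow> norm (f x) \<le> B"
    using compact_imp_bounded by (fastforce simp: bounded_iff)
  show ?thesis
  proof (rule that[of "\<bar>B\<bar> + 1"])
    fix x show "norm (f x) \<le> \<bar>B\<bar> + 1"
      using B[of x] assms(2)[of x] by (cases "norm x \<le> R") force+
  qed auto
qed


text \<open>For \<open>k = 0\<close> this is the classical smooth function that is flat at the origin. The additional factor makes
the family closed under differentiation up to linear combinations, which turns smoothness into an
induction over the order for all \<open>k\<close> at once.\<close>

definition flat_exp :: "nat \<Rightarrow> real \<Rightarrow> real" where
  "flat_exp k t = (if t \<le> 0 then 0 else exp (- inverse t) * inverse t ^ k)"

lemma flat_exp_deriv: "(flat_exp k has_real_derivative flat_exp (k + 2) t - real k * flat_exp (k + 1) t) (at t)"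
proof -
  consider "t < 0" | "t > 0" | "t = 0" by linarith
  then show ?thesis
  proof cases
    case 1
    have "((\<lambda>_. 0) has_real_derivative 0) (at t)" by simp
    hence "(flat_exp k has_real_derivative 0) (at t)"
      by (rule has_field_derivative_transform_within_open[where S = "{..<0}"]) (use 1 in \<open>auto simp: flat_exp_def\<close>)
    thus ?thesis using 1 by (simp add: flat_exp_def)
  next
    case 2
    have "((\<lambda>t. exp (- inverse t) * inverse t ^ k) has_real_derivative flat_exp (k + 2) t - real k * flat_exp (k + 1) t) (at t)"
    proof (rule DERIV_cong)
      show "((\<lambda>t. exp (- inverse t) * inverse t ^ k) has_real_derivative
          exp (- inverse t) * (inverse t * inverse t) * inverse t ^ k
          + exp (- inverse t) * (real k * inverse t ^ (k - 1) * (- (inverse t * inverse t)))) (at t)"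
        using 2 by (auto intro!: derivative_eq_intros)
      show "exp (- inverse t) * (inverse t * inverse t) * inverse t ^ k
          + exp (- inverse t) * (real k * inverse t ^ (k - 1) * (- (inverse t * inverse t)))
          = flat_exp (k + 2) t - real k * flat_exp (k + 1) t"
        using 2 by (cases k) (simp_all add: flat_exp_def algebra_simps)
    qed
    thus ?thesis
      by (rule has_field_derivative_transform_within_open[where S = "{0<..}"]) (use 2 in \<open>auto simp: flat_exp_def\<close>)
  next
    case 3
    have "((\<lambda>y. flat_exp k y / y) \<longlongrightarrow> 0) (at_right 0)"
    proof (rule Lim_transform_eventually)
      show "((\<lambda>y. exp (- inverse y) * inverse y ^ k * inverse y) \<longlongrightarrow> 0) (at_right (0::real))" by real_asymp
      show "\<forall>\<^sub>F y in at_right 0. exp (- inverse y) * inverse y ^ k * inverse y = flat_exp k y / y"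
        using eventually_at_right_less[of 0] by eventually_elim (auto simp: flat_exp_def field_simps)
    qed
    moreover have "((\<lambda>y. flat_exp k y / y) \<longlongrightarrow> 0) (at_left 0)"
    proof (rule Lim_transform_eventually[OF tendsto_const])
      have "\<forall>\<^sub>F y in at_left 0. y < (0::real)" by (simp add: eventually_at_filter)
      thus "\<forall>\<^sub>F y in at_left 0. 0 = flat_exp k y / y" by eventually_elim (auto simp: flat_exp_def)
    qed
    ultimately have "((\<lambda>y. flat_exp k y / y) \<longlongrightarrow> 0) (at 0)" using filterlim_split_at by blast
    thus ?thesis using 3 by (simp add: has_field_derivative_iff flat_exp_def)
  qed
qed

lemma smooth_flat_exp: "smooth (flat_exp k)"
proof -
  have "Ck_on m UNIV (flat_exp k)" for m
  proof (induction m arbitrary: k)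
    case 0
    show ?case using flat_exp_deriv[THEN DERIV_isCont] by (simp add: continuous_at_imp_continuous_on)
  next
    case (Suc m)
    have "Ck_on m UNIV (\<lambda>t. flat_exp (k + 2) t + (- real k) * flat_exp (k + 1) t)"
      by (intro Ck_on_add Ck_on_mult Suc Ck_on_const)
    thus ?case
      by (intro Ck_on_SucI[where f' = "\<lambda>t v. (flat_exp (k + 2) t - real k * flat_exp (k + 1) t) * v"]
          has_field_derivative_imp_has_derivative flat_exp_deriv Ck_on_mult Ck_on_const) simp
  qed
  thus ?thesis by (simp add: smooth_def)
qed



text \<open>The normalised antiderivative of a bump supported in \<open>[1, 2]\<close>. It is monotone and its derivative is again
smooth and bounded; slices of the range and spatial cutoffs are made from it.\<close>

lemma smooth_step_exists:
  "\<exists>B B' :: real \<Rightarrow> real. \<exists>C>0. smooth B \<and> smooth B' \<and> (\<forall>s. (B has_real_derivative B' s) (at s)) \<and>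
     (\<forall>s\<le>1. B s = 0 \<and> B' s = 0) \<and> (\<forall>s\<ge>2. B s = 1 \<and> B' s = 0) \<and>
     (\<forall>s. 0 \<le> B' s \<and> B' s \<le> C)"
proof -
  define \<eta> where "\<eta> = (\<lambda>t. flat_exp 0 (t - 1) * flat_exp 0 (2 - t))"
  define A where "A = (\<lambda>s. integral {0..s} \<eta>)"
  have sm: "smooth \<eta>"
    using smooth_mult[OF smooth_affine_real[OF smooth_flat_exp, of 0 1 "-1"] smooth_affine_real[OF smooth_flat_exp, of 0 "-1" 2]]
    by (simp add: \<eta>_def)
  have cont: "continuous_on S \<eta>" for S using smooth_continuous[OF sm] continuous_on_subset by blast
  have nonneg: "\<eta> t \<ge> 0" for t by (simp add: \<eta>_def flat_exp_def)
  have zero: "\<eta> t = 0" if "t \<le> 1 \<or> t \<ge> 2" for t using that by (auto simp: \<eta>_def flat_exp_def)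
  have bound: "\<eta> t \<le> 1" for t by (auto simp: \<eta>_def flat_exp_def intro!: mult_le_one)
  have A0: "A s = 0" if "s \<le> 1" for s
    unfolding A_def using that
    by (subst Henstock_Kurzweil_Integration.integral_cong[of _ \<eta> "\<lambda>_. 0"]) (auto simp: zero)
  \<comment> \<open>The integral over the empty interval is zero, so the antiderivative also serves negative arguments.\<close>
  have dA: "(A has_real_derivative \<eta> s) (at s)" for s
  proof (cases "s < 1")
    case True
    have "((\<lambda>_. 0) has_real_derivative 0) (at s)" by simp
    hence "(A has_real_derivative 0) (at s)"
      by (rule has_field_derivative_transform_within_open[where S = "{..<1}"]) (use True A0 in auto)
    thus ?thesis using True zero by simp
  next
    case False
    have "(A has_real_derivative \<eta> s) (at s within {0..s+1})"
      unfolding A_def by (rule integral_has_real_derivative[OF cont]) (use False in auto)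
    thus ?thesis using False at_within_Icc_at[of 0 s "s+1"] by auto
  qed
  have contA: "continuous_on S A" for S
    by (intro continuous_at_imp_continuous_on ballI DERIV_isCont[OF dA])
  have const: "A s = A 2" if "s \<ge> 2" for s
  proof -
    have "A s = integral {0..2} \<eta> + integral {2..s} \<eta>"
      unfolding A_def using that by (intro Henstock_Kurzweil_Integration.integral_combine[symmetric] integrable_continuous_interval cont) auto
    moreover have "integral {2..s} \<eta> = 0"
      by (subst Henstock_Kurzweil_Integration.integral_cong[of _ \<eta> "\<lambda>_. 0"]) (auto simp: zero)
    ultimately show ?thesis by (simp add: A_def)
  qed
  have pos: "A 2 > 0"
  proof -
    have "A 1 < A 2"
    proof (rule DERIV_pos_imp_increasing_open[of 1 2 A])
      fix x :: real assume "1 < x" "x < 2"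
      thus "\<exists>y. (A has_real_derivative y) (at x) \<and> 0 < y"
        using dA[of x] by (intro exI[of _ "\<eta> x"] conjI) (simp_all add: \<eta>_def flat_exp_def)
    qed (simp_all add: contA)
    thus ?thesis using A0[of 1] by simp
  qed
  show ?thesis
  proof (rule exI[of _ "\<lambda>s. inverse (A 2) * A s"], rule exI[of _ "\<lambda>s. inverse (A 2) * \<eta> s"], rule exI[of _ "inverse (A 2)"], intro conjI allI impI)
    show "smooth (\<lambda>s. inverse (A 2) * A s)"
      by (intro smooth_mult smooth_const smooth_from_antiderivative[OF dA] sm)
    show "smooth (\<lambda>s. inverse (A 2) * \<eta> s)" by (intro smooth_mult smooth_const sm)
    show "((\<lambda>s. inverse (A 2) * A s) has_real_derivative inverse (A 2) * \<eta> s) (at s)" for s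
      by (intro DERIV_cmult dA)
    show "inverse (A 2) * \<eta> s \<le> inverse (A 2)" for s
      using bound[of s] pos mult_left_mono[of "\<eta> s" 1 "inverse (A 2)"] by simp
    show "inverse (A 2) * A s = 1" if "2 \<le> s" for s using const[OF that] pos by simp
  qed (simp_all add: pos A0 zero nonneg less_imp_le[OF pos])
qed

text \<open>The odd extension of the smooth step. It cuts the slice \<open>1 \<le> \<bar>s\<bar> \<le> 2\<close> out of the range: it vanishes
below, is constant above, and moves only inside. Oddness gives \<open>0 \<le> s * T s\<close>, the sign that lets the zero
order term of the equation be dropped.\<close>

lemma smooth_slice_exists:
  "\<exists>T T' :: real \<Rightarrow> real. \<exists>C>0. smooth T \<and> continuous_on UNIV T' \<and> (\<forall>s. (T has_real_derivative T' s) (at s)) \<and>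
     (\<forall>s. \<bar>s\<bar> \<le> 1 \<longrightarrow> T s = 0 \<and> T' s = 0) \<and> (\<forall>s. \<bar>s\<bar> \<ge> 2 \<longrightarrow> \<bar>T s\<bar> = 1 \<and> T' s = 0) \<and>
     (\<forall>s. 0 \<le> T' s \<and> T' s \<le> C \<and> \<bar>T s\<bar> \<le> 1 \<and> 0 \<le> s * T s)"
proof -
  obtain B B' :: "real \<Rightarrow> real" and C where C: "C > 0" and sB: "smooth B" and sB': "smooth B'"
    and dB: "\<And>s. (B has_real_derivative B' s) (at s)"
    and B0: "\<And>s. s \<le> 1 \<Longrightarrow> B s = 0 \<and> B' s = 0" and B1: "\<And>s. s \<ge> 2 \<Longrightarrow> B s = 1 \<and> B' s = 0"
    and bd: "\<And>s. 0 \<le> B' s \<and> B' s \<le> C"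
    using smooth_step_exists by blast
  have mono: "B s \<le> B t" if "s \<le> t" for s t
    using that DERIV_nonneg_imp_nondecreasing[of s t B] dB bd by blast
  have r: "0 \<le> B s \<and> B s \<le> 1" for s
    using mono[of "min s 1" s] mono[of s "max s 2"] B0[of "min s 1"] B1[of "max s 2"] by auto
  show ?thesis
  proof (rule exI[of _ "\<lambda>s. B s - B (- s)"], rule exI[of _ "\<lambda>s. B' s + B' (- s)"], rule exI[of _ "2 * C"], intro conjI allI impI)
    show "smooth (\<lambda>s. B s - B (- s))"
      using smooth_diff[OF sB smooth_affine_real[OF sB, of "-1" 0]] by simp
    show "continuous_on UNIV (\<lambda>s. B' s + B' (- s))"
      by (intro continuous_intros continuous_on_compose2[OF smooth_continuous[OF sB']]) auto
    fix s
    have "((\<lambda>s. B (- s)) has_real_derivative B' (- s) * (- 1)) (at s)"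
      by (rule DERIV_chain2[OF dB]) (auto intro!: derivative_eq_intros)
    from DERIV_diff[OF dB this] show "((\<lambda>s. B s - B (- s)) has_real_derivative B' s + B' (- s)) (at s)" by simp
    show "B' s + B' (- s) \<le> 2 * C" "0 \<le> B' s + B' (- s)" using bd[of s] bd[of "-s"] by auto
    show "\<bar>B s - B (- s)\<bar> \<le> 1" using r[of s] r[of "-s"] by auto
    show "0 \<le> s * (B s - B (- s))"
      using B0[of s] B0[of "-s"] r[of s] r[of "-s"] 
      by (cases "s \<ge> 0") (auto simp: mult_nonneg_nonneg mult_nonpos_nonneg)
  next
    fix s :: real assume s: "\<bar>s\<bar> \<le> 1"
    hence "s \<le> 1" "- s \<le> 1" by auto
    thus "B s - B (- s) = 0" "B' s + B' (- s) = 0" using B0[of s] B0[of "-s"] by auto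
  next
    fix s :: real assume s: "2 \<le> \<bar>s\<bar>"
    hence "(s \<ge> 2 \<and> - s \<le> 1) \<or> (- s \<ge> 2 \<and> s \<le> 1)" by auto
    thus "\<bar>B s - B (- s)\<bar> = 1" "B' s + B' (- s) = 0"
      using B0[of s] B0[of "-s"] B1[of s] B1[of "-s"] by auto
  qed (use C in auto)
qed

text \<open>Composing the step with \<open>(norm x)\<^sup>2\<close> gives a radially decreasing cutoff. Monotonicity in \<open>norm x\<close> gives
dilated integrals a sign.\<close>

lemma cutoff_exists:
  "\<exists>\<psi> :: real ^ 'n \<Rightarrow> real. \<exists>L>0. test_function \<psi> \<and> (\<forall>x. norm x \<le> 1 \<longrightarrow> \<psi> x = 1) \<and> (\<forall>x. norm x \<ge> 2 \<longrightarrow> \<psi> x = 0) \<and>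
    (\<forall>x. 0 \<le> \<psi> x \<and> \<psi> x \<le> 1) \<and> (\<forall>x. norm (grad \<psi> x) \<le> L) \<and> (\<forall>x y. \<bar>\<psi> x - \<psi> y\<bar> \<le> L * norm (x - y)) \<and>
    (\<forall>x y. norm x \<le> norm y \<longrightarrow> \<psi> y \<le> \<psi> x)"
proof -
  obtain B B' :: "real \<Rightarrow> real" and C where C: "C > 0" and sB: "smooth B" 
    and dB: "\<And>s. (B has_real_derivative B' s) (at s)"
    and B0: "\<And>s. s \<le> 1 \<Longrightarrow> B s = 0 \<and> B' s = 0" and B1: "\<And>s. s \<ge> 2 \<Longrightarrow> B s = 1 \<and> B' s = 0"
    and bd: "\<And>s. 0 \<le> B' s \<and> B' s \<le> C"
    using smooth_step_exists by blast
  have mono: "B s \<le> B t" if "s \<le> t" for s t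
    using that DERIV_nonneg_imp_nondecreasing[of s t B] dB bd by blast
  have r: "0 \<le> B s \<and> B s \<le> 1" for s
    using mono[of "min s 1" s] mono[of s "max s 2"] B0[of "min s 1"] B1[of "max s 2"] by auto
  define \<psi> where "\<psi> = (\<lambda>x::real^'n. 1 - B ((norm x)\<^sup>2))"
  have sm: "smooth \<psi>" unfolding \<psi>_def
    by (intro smooth_diff smooth_const smooth_compose[OF sB] smooth_norm_square)
  have one: "\<psi> x = 1" if "norm x \<le> 1" for x
    using B0[of "(norm x)\<^sup>2"] that by (simp add: \<psi>_def power_le_one)
  have zero: "\<psi> x = 0" if "norm x \<ge> 2" for x
  proof -
    have "2 * 2 \<le> norm x * norm x" using that by (intro mult_mono) auto
    thus ?thesis using B1[of "(norm x)\<^sup>2"] by (simp add: \<psi>_def power2_eq_square)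
  qed
  have test: "test_function \<psi>" by (rule test_functionI[OF sm, of 2]) (use zero in auto)
  obtain L where L: "L > 0" "\<And>x. norm (grad \<psi> x) \<le> L"
    using bounded_continuous_support[OF smooth_grad_continuous[OF sm], of 2] grad_zero_outside[of 2 \<psi>] zero
    by (metis less_imp_le)
  have lip: "\<bar>\<psi> x - \<psi> y\<bar> \<le> L * norm (x - y)" for x y
  proof -
    have "norm (\<psi> x - \<psi> y) \<le> L * norm (x - y)"
    proof (rule differentiable_bound[of UNIV \<psi> "\<lambda>z v. grad \<psi> z \<bullet> v"])
      show "onorm (\<lambda>v. grad \<psi> z \<bullet> v) \<le> L" for z
      proof (rule onorm_le)
        fix v
        have "\<bar>grad \<psi> z \<bullet> v\<bar> \<le> norm (grad \<psi> z) * norm v" by (rule Cauchy_Schwarz_ineq2)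
        also have "\<dots> \<le> L * norm v" by (rule mult_right_mono[OF L(2)]) simp
        finally show "norm (grad \<psi> z \<bullet> v) \<le> L * norm v" by simp
      qed
    qed (auto intro: smooth_has_grad[OF sm])
    thus ?thesis by simp
  qed
  show ?thesis
    using L test one zero r lip mono by (intro exI[of _ \<psi>] exI[of _ L]) (auto simp: \<psi>_def)
qed

section \<open>Integrals of powers and affine substitutions\<close>

lemma cball_borel [measurable]: "cball x r \<in> sets borel" by simp

lemma ball_borel [measurable]: "ball x r \<in> sets borel" by simp

text \<open>The \<open>p\<close>-th power of the \<open>L^p\<close> norm. As an extended nonnegative integral it is defined for every function,
so that Tonelli's theorem and monotone estimates apply freely.\<close>

definition pow_integral :: "real \<Rightarrow> ('a::euclidean_space \<Rightarrow> 'b::real_normed_vector) \<Rightarrow> ennreal" where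
  "pow_integral p f = (\<integral>\<^sup>+x. ennreal (norm (f x) powr p) \<partial>lborel)"

lemma nn_integral_affine:
  fixes t :: "'a::euclidean_space"
  assumes [measurable]: "f \<in> borel_measurable borel" and c: "c \<noteq> 0"
  shows "(\<integral>\<^sup>+x. f (c *\<^sub>R x + t) \<partial>lborel) = ennreal (1 / \<bar>c\<bar> ^ DIM('a)) * (\<integral>\<^sup>+x. f x \<partial>lborel)"
proof -
  have "(\<integral>\<^sup>+x. f x \<partial>lborel) = ennreal (\<bar>c\<bar> ^ DIM('a)) * (\<integral>\<^sup>+x. f (c *\<^sub>R x + t) \<partial>lborel)"
    by (subst lborel_affine[OF c, of t])
       (simp add: nn_integral_density nn_integral_distr nn_integral_cmult add.commute)
  moreover have "ennreal (1 / \<bar>c\<bar> ^ DIM('a)) * ennreal (\<bar>c\<bar> ^ DIM('a)) = 1"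
    using c by (simp flip: ennreal_mult')
  ultimately show ?thesis by (simp add: mult.assoc[symmetric])
qed

lemma integrable_affine:
  fixes t :: "'a::euclidean_space" and f :: "'a \<Rightarrow> real"
  assumes "integrable lborel f" and c: "c \<noteq> 0"
  shows "integrable lborel (\<lambda>x. f (c *\<^sub>R x + t))"
proof (rule integrableI_bounded)
  have [measurable]: "f \<in> borel_measurable borel" using assms(1) by auto
  show "(\<lambda>x. f (c *\<^sub>R x + t)) \<in> borel_measurable lborel" by measurable
  have "(\<integral>\<^sup>+x. ennreal (norm (f (c *\<^sub>R x + t))) \<partial>lborel) = ennreal (1 / \<bar>c\<bar> ^ DIM('a)) * (\<integral>\<^sup>+x. ennreal (norm (f x)) \<partial>lborel)"
    by (rule nn_integral_affine[OF _ c]) simp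
  also have "\<dots> < \<infinity>" using assms(1) by (simp add: integrable_iff_bounded ennreal_mult_less_top)
  finally show "(\<integral>\<^sup>+x. ennreal (norm (f (c *\<^sub>R x + t))) \<partial>lborel) < \<infinity>" .
qed

lemma integral_affine:
  fixes t :: "'a::euclidean_space" and f :: "'a \<Rightarrow> real"
  assumes [measurable]: "f \<in> borel_measurable borel" and c: "c \<noteq> 0"
  shows "(LINT x|lborel. f (c *\<^sub>R x + t)) = (LINT x|lborel. f x) / \<bar>c\<bar> ^ DIM('a)"
proof -
  have "(LINT x|lborel. f x) = (LINT x|lborel. \<bar>c\<bar> ^ DIM('a) * f (c *\<^sub>R x + t))"
    by (subst lborel_affine[OF c, of t]) (simp add: integral_density integral_distr add.commute)
  thus ?thesis using c by (simp add: field_simps)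
qed

lemma AE_affine:
  fixes t :: "'a::euclidean_space"
  assumes "AE x in lborel. P x" and c: "c \<noteq> 0"
  shows "AE x in lborel. P (c *\<^sub>R x + t)"
proof -
  obtain N where N: "{x. \<not> P x} \<subseteq> N" "emeasure lborel N = 0" and [measurable]: "N \<in> sets borel"
    using AE_E[OF assms(1)] by auto
  have "(\<integral>\<^sup>+x. indicator N (c *\<^sub>R x + t) \<partial>lborel) = 0"
    by (subst nn_integral_affine[OF _ c]) (use N in auto)
  hence "AE x in lborel. indicator N (c *\<^sub>R x + t) = (0::ennreal)"
    by (subst (asm) nn_integral_0_iff_AE) auto
  thus ?thesis using N(1) by (auto simp: indicator_def elim!: eventually_mono split: if_splits)
qed

lemma powr_add_le:
  fixes x y :: "'a::real_normed_vector"
  assumes "p \<ge> 0"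
  shows "norm (x + y) powr p \<le> 2 powr p * (norm x powr p + norm y powr p)"
proof -
  have "norm (x + y) powr p \<le> (2 * max (norm x) (norm y)) powr p"
    using assms by (intro powr_mono2) (auto intro: order_trans[OF norm_triangle_ineq])
  also have "\<dots> = 2 powr p * max (norm x) (norm y) powr p" by (simp add: powr_mult)
  also have "\<dots> \<le> 2 powr p * (norm x powr p + norm y powr p)" by (intro mult_left_mono) (auto simp: max_def)
  finally show ?thesis .
qed

lemma pow_integral_add_le:
  assumes "p \<ge> 0" and [measurable]: "f \<in> borel_measurable borel" "g \<in> borel_measurable borel"
  shows "pow_integral p (\<lambda>x. f x + g x) \<le> ennreal (2 powr p) * (pow_integral p f + pow_integral p g)"
proof -
  have "pow_integral p (\<lambda>x. f x + g x) \<le> (\<integral>\<^sup>+x. ennreal (2 powr p) * (ennreal (norm (f x) powr p) + ennreal (norm (g x) powr p)) \<partial>lborel)"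
    unfolding pow_integral_def
    by (intro nn_integral_mono) (use powr_add_le[OF assms(1)] in \<open>auto simp flip: ennreal_plus ennreal_mult intro!: ennreal_leI\<close>)
  also have "\<dots> = ennreal (2 powr p) * (pow_integral p f + pow_integral p g)"
    unfolding pow_integral_def by (simp add: nn_integral_cmult nn_integral_add)
  finally show ?thesis .
qed

lemma pow_integral_finite_iff:
  fixes f :: "'a::euclidean_space \<Rightarrow> 'b::euclidean_space"
  assumes [measurable]: "f \<in> borel_measurable borel"
  shows "integrable lborel (\<lambda>x. norm (f x) powr p) \<longleftrightarrow> pow_integral p f < \<infinity>"
  by (simp add: integrable_iff_bounded pow_integral_def)

lemma pow_integral_mono:
  assumes "p \<ge> 0" "\<And>x. norm (f x) \<le> norm (g x)" shows "pow_integral p f \<le> pow_integral p g"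
  unfolding pow_integral_def using assms by (intro nn_integral_mono ennreal_leI powr_mono2) auto

lemma pow_integral_minus: "pow_integral p (\<lambda>x. f x - g x) = pow_integral p (\<lambda>x. g x - f x)"
  by (simp add: pow_integral_def norm_minus_commute)


lemma ennreal_tendsto_0D:
  assumes "(F \<longlongrightarrow> (0::ennreal)) A" "e > 0"
  shows "eventually (\<lambda>n. F n < e) A"
  using order_tendstoD(2)[OF assms] .

lemma pow_integral_dominated:
  fixes F :: "nat \<Rightarrow> 'a::euclidean_space \<Rightarrow> 'b::{real_normed_vector, second_countable_topology}"
  assumes p: "p > 0" and [measurable]: "\<And>n. F n \<in> borel_measurable borel" "W \<in> borel_measurable borel"
    and lim: "AE x in lborel. (\<lambda>n. F n x) \<longlonglongrightarrow> 0"
    and dom: "\<And>n. AE x in lborel. norm (F n x) powr p \<le> W x" and W: "(\<integral>\<^sup>+x. ennreal (W x) \<partial>lborel) < \<infinity>"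
  shows "(\<lambda>n. pow_integral p (F n)) \<longlonglongrightarrow> 0"
proof -
  have "(\<lambda>n. \<integral>\<^sup>+x. ennreal (norm (F n x) powr p) \<partial>lborel) \<longlonglongrightarrow> (\<integral>\<^sup>+x. 0 \<partial>(lborel :: 'a measure))"
  proof (rule nn_integral_dominated_convergence[where w = "\<lambda>x. ennreal (W x)"])
    show "AE x in lborel. ennreal (norm (F n x) powr p) \<le> ennreal (W x)" for n
      using dom[of n] by eventually_elim (rule ennreal_leI)
    show "AE x in lborel. (\<lambda>n. ennreal (norm (F n x) powr p)) \<longlonglongrightarrow> 0"
      using lim
    proof eventually_elim
      fix x assume "(\<lambda>n. F n x) \<longlonglongrightarrow> 0"
      hence "(\<lambda>n. norm (F n x) powr p) \<longlonglongrightarrow> 0 powr p"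
        using p tendsto_norm_zero[of "\<lambda>n. F n x"] by (intro tendsto_powr2) auto
      thus "(\<lambda>n. ennreal (norm (F n x) powr p)) \<longlonglongrightarrow> 0"
        using p tendsto_ennrealI by fastforce
    qed
  qed (use W in auto)
  thus ?thesis by (simp add: pow_integral_def)
qed


text \<open>A power-integrable function is truncated in height and in space; the truncation is an almost everywhere
limit of continuous functions, which are clamped to the same height and cut off, so that dominated
convergence applies twice.\<close>

lemma Cc_dense:
  fixes f :: "'a::euclidean_space \<Rightarrow> real"
  assumes p: "p > 0" and [measurable]: "f \<in> borel_measurable borel" and fin: "pow_integral p f < \<infinity>" and e: "e > 0"
  shows "\<exists>\<phi> R. continuous_on UNIV \<phi> \<and> R > 0 \<and> (\<forall>x. norm x > R \<longrightarrow> \<phi> x = 0) \<and> pow_integral p (\<lambda>x. f x - \<phi> x) < e"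
proof -
  define tr where "tr n = (\<lambda>x. indicator (cball 0 (real n)) x * max (- real n) (min (real n) (f x)))" for n :: nat
  define C where "C = ennreal (2 powr p)"
  have Cpos: "0 < C" "C < \<infinity>" by (auto simp: C_def)
  define e' where "e' = e / (C * 2)"
  have e': "e' > 0" using e Cpos unfolding e'_def
    by (simp add: ennreal_zero_less_divide ennreal_mult_less_top)
  have [measurable]: "tr n \<in> borel_measurable borel" for n unfolding tr_def
    by (intro borel_measurable_times borel_measurable_indicator borel_measurable_max borel_measurable_min
        borel_measurable_const assms) auto
  have trb: "\<bar>tr n x\<bar> \<le> real n" "\<bar>f x - tr n x\<bar> \<le> \<bar>f x\<bar>" for n x by (auto simp: tr_def indicator_def)
  have "(\<lambda>n. pow_integral p (\<lambda>x. f x - tr n x)) \<longlonglongrightarrow> 0"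
  proof (rule pow_integral_dominated[OF p, where W = "\<lambda>x. \<bar>f x\<bar> powr p"])
    show "AE x in lborel. (\<lambda>n. f x - tr n x) \<longlonglongrightarrow> 0"
    proof (rule AE_I2, rule tendsto_eventually)
      fix x
      obtain N where N: "real N \<ge> norm x" "real N \<ge> \<bar>f x\<bar>"
        using real_arch_simple[of "max (norm x) \<bar>f x\<bar>"] by auto
      show "\<forall>\<^sub>F n in sequentially. f x - tr n x = 0"
        using eventually_ge_at_top[of N]
        by eventually_elim (use N in \<open>auto simp: tr_def indicator_def\<close>)
    qed
    show "(\<integral>\<^sup>+x. ennreal (\<bar>f x\<bar> powr p) \<partial>lborel) < \<infinity>" using fin by (simp add: pow_integral_def)
  qed (use trb p in \<open>auto intro!: powr_mono2\<close>)
  from ennreal_tendsto_0D[OF this e'] obtain n where n: "pow_integral p (\<lambda>x. f x - tr n x) < e'"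
    using eventually_sequentially by auto
  obtain N g where N: "negligible N" and g: "\<And>k. continuous_on UNIV (g k)" "\<And>x. x \<notin> N \<Longrightarrow> (\<lambda>k. g k x) \<longlonglongrightarrow> tr n x"
  proof -
    have "tr n \<in> borel_measurable lebesgue" by (rule measurable_completion) simp
    hence "tr n measurable_on UNIV" by (rule lebesgue_measurable_imp_measurable_on_real) simp
    thus ?thesis using that unfolding measurable_on_def by auto
  qed
  define cut where "cut = (\<lambda>x::'a. max 0 (min 1 (real n + 1 - norm x)))"
  define \<phi> where "\<phi> k = (\<lambda>x. cut x * max (- real n) (min (real n) (g k x)))" for k
  have cont: "continuous_on UNIV (\<phi> k)" for k unfolding \<phi>_def cut_def by (intro continuous_intros g)
  have [measurable]: "\<phi> k \<in> borel_measurable borel" for k using cont borel_measurable_continuous_onI by blast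
  have supp: "\<phi> k x = 0" if "norm x > real n + 1" for k x using that by (auto simp: \<phi>_def cut_def)
  have phib: "\<bar>\<phi> k x\<bar> \<le> real n" for k x
  proof -
    have "\<bar>\<phi> k x\<bar> = \<bar>cut x\<bar> * \<bar>max (- real n) (min (real n) (g k x))\<bar>" by (simp add: \<phi>_def abs_mult)
    also have "\<dots> \<le> 1 * real n" by (intro mult_mono) (auto simp: cut_def)
    finally show ?thesis by simp
  qed
  have "(\<lambda>k. pow_integral p (\<lambda>x. tr n x - \<phi> k x)) \<longlonglongrightarrow> 0"
  proof (rule pow_integral_dominated[OF p, where W = "\<lambda>x. (2 * real n) powr p * indicator (cball 0 (real n + 1)) x"])
    have "AE x in lebesgue. x \<notin> N" using N by (simp add: negligible_iff_null_sets AE_not_in)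
    hence ae: "AE x in lborel. x \<notin> N" by (simp add: AE_completion_iff)
    show "AE x in lborel. (\<lambda>k. tr n x - \<phi> k x) \<longlonglongrightarrow> 0"
      using ae
    proof eventually_elim
      fix x assume x: "x \<notin> N"
      have "(\<lambda>k. \<phi> k x) \<longlonglongrightarrow> cut x * max (- real n) (min (real n) (tr n x))"
        unfolding \<phi>_def by (intro tendsto_intros g(2) x)
      also have "cut x * max (- real n) (min (real n) (tr n x)) = tr n x"
        using trb(1)[of n x] by (auto simp: tr_def cut_def indicator_def)
      finally show "(\<lambda>k. tr n x - \<phi> k x) \<longlonglongrightarrow> 0" using tendsto_diff[OF tendsto_const[of "tr n x"]] by fastforce
    qed
    show "AE x in lborel. norm (tr n x - \<phi> k x) powr p \<le> (2 * real n) powr p * indicator (cball 0 (real n + 1)) x" for k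
    proof (rule AE_I2)
      fix x
      have "tr n x = 0" if "norm x > real n + 1" using that by (auto simp: tr_def)
      moreover have "\<bar>tr n x - \<phi> k x\<bar> \<le> 2 * real n" using trb(1)[of n x] phib[of k x] by linarith
      ultimately show "norm (tr n x - \<phi> k x) powr p \<le> (2 * real n) powr p * indicator (cball 0 (real n + 1)) x"
        using supp[of x k] p by (cases "norm x > real n + 1") (auto intro!: powr_mono2)
    qed
    show "(\<integral>\<^sup>+ x. ennreal ((2 * real n) powr p * indicator (cball 0 (real n + 1)) (x::'a)) \<partial>lborel) < \<infinity>"
      using emeasure_lborel_cball_finite[of "0::'a" "real n + 1"]
      by (simp add: ennreal_mult' nn_integral_cmult_indicator ennreal_indicator ennreal_mult_less_top)
  qed measurable
  from ennreal_tendsto_0D[OF this e'] obtain k where k: "pow_integral p (\<lambda>x. tr n x - \<phi> k x) < e'"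
    using eventually_sequentially by auto
  have "pow_integral p (\<lambda>x. f x - \<phi> k x) = pow_integral p (\<lambda>x. (f x - tr n x) + (tr n x - \<phi> k x))" by simp
  also have "\<dots> \<le> C * (pow_integral p (\<lambda>x. f x - tr n x) + pow_integral p (\<lambda>x. tr n x - \<phi> k x))"
    unfolding C_def using p by (intro pow_integral_add_le) auto
  also have "\<dots> < C * (e' + e')"
    using n k Cpos by (intro ennreal_mult_strict_left_mono add_strict_mono) auto
  also have "\<dots> = e"
  proof -
    have "C * 2 \<noteq> 0" "C * 2 \<noteq> \<top>" using Cpos by (auto simp: ennreal_mult_eq_top_iff)
    hence "e * (C * 2) / (C * 2) = e" by (rule ennreal_mult_divide_eq)
    thus ?thesis by (simp add: e'_def mult_2[symmetric] mult.assoc[symmetric] ennreal_times_divide mult.commute)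
  qed
  finally show ?thesis using cont supp by (intro exI[of _ "\<phi> k"] exI[of _ "real n + 1"]) auto
qed


text \<open>Outside a slightly larger ball both values vanish, so uniform continuity on that compact ball suffices.\<close>

lemma uniform_continuity_of_compact_support:
  fixes f :: "'a::euclidean_space \<Rightarrow> 'b::real_normed_vector"
  assumes "continuous_on UNIV f" "\<And>x. norm x > R \<Longrightarrow> f x = 0" "e > 0"
  shows "\<exists>d>0. \<forall>x y. norm (x - y) < d \<longrightarrow> norm (f x - f y) < e"
proof -
  have "uniformly_continuous_on (cball 0 (R + 1)) f"
    by (intro compact_uniformly_continuous continuous_on_subset[OF assms(1)]) auto
  then obtain d where d: "d > 0" "\<And>x y. x \<in> cball 0 (R + 1) \<Longrightarrow> y \<in> cball 0 (R + 1) \<Longrightarrow> dist y x < d \<Longrightarrow> dist (f y) (f x) < e"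
    using assms(3) unfolding uniformly_continuous_on_def by metis
  show ?thesis
  proof (intro exI[of _ "min d 1"] conjI allI impI)
    fix x y :: 'a assume xy: "norm (x - y) < min d 1"
    show "norm (f x - f y) < e"
    proof (cases "norm x \<le> R + 1 \<and> norm y \<le> R + 1")
      case True
      thus ?thesis using d(2)[of y x] xy by (simp add: dist_norm)
    next
      case False
      have "norm x \<le> norm y + norm (x - y)" "norm y \<le> norm x + norm (x - y)"
        using norm_triangle_sub[of x y] norm_triangle_sub[of y x] by (auto simp: norm_minus_commute)
      hence "norm x > R" "norm y > R" using False xy by auto
      thus ?thesis using assms by simp
    qed
  qed (use d in auto)
qed

text \<open>Dilations and translations act continuously on \<open>L^p\<close>: true for continuous functions with compact support
by uniform continuity, and inherited by limits since the substitutions \<open>x \<mapsto> c x + h\<close> with \<open>c\<close> near 1 have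
bounded norm. Translations serve mollification, dilations serve the final argument.\<close>

lemma pow_integral_affine_continuity:
  fixes f :: "'a::euclidean_space \<Rightarrow> real"
  assumes p: "p > 0" and [measurable]: "f \<in> borel_measurable borel" and fin: "pow_integral p f < \<infinity>" and e: "(e::real) > 0"
  shows "\<exists>\<delta>>0. \<forall>c h. \<bar>c - 1\<bar> \<le> \<delta> \<and> norm h \<le> \<delta> \<longrightarrow> pow_integral p (\<lambda>x. f (c *\<^sub>R x + h) - f x) \<le> ennreal e"
proof -
  define C where "C = 2 powr p"
  define D where "D = (2::real) ^ DIM('a)"
  have CD: "C > 0" "D > 0" by (auto simp: C_def D_def)
  define e' where "e' = e / (C * (D + C * 2))"
  have e': "e' > 0" using e CD by (simp add: e'_def)
  obtain \<phi> R where \<phi>: "continuous_on UNIV \<phi>" and R: "R > 0" and supp: "\<And>x. norm x > R \<Longrightarrow> \<phi> x = 0"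
    and ap: "pow_integral p (\<lambda>x. f x - \<phi> x) < ennreal e'"
    using Cc_dense[OF p _ fin, of "ennreal e'"] e' by auto
  have [measurable]: "\<phi> \<in> borel_measurable borel" using \<phi> by (rule borel_measurable_continuous_onI)
  define V where "V = measure lborel (cball (0::'a) (2 * R + 2))"
  have V: "V \<ge> 0" "emeasure lborel (cball (0::'a) (2 * R + 2)) = ennreal V"
    using emeasure_lborel_cball_finite[of "0::'a" "2 * R + 2"]
    by (auto simp: V_def emeasure_eq_ennreal_measure top.not_eq_extremum)
  define \<eta> where "\<eta> = (e' / (V + 1)) powr (1 / p)"
  have \<eta>: "\<eta> > 0" "\<eta> powr p * V \<le> e'"
    using e' V p by (auto simp: \<eta>_def powr_powr field_simps)
  obtain d where d: "d > 0" "\<And>x y. norm (x - y) < d \<Longrightarrow> norm (\<phi> x - \<phi> y) < \<eta>"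
    using uniform_continuity_of_compact_support[OF \<phi> supp \<eta>(1)] by blast
  define \<delta> where "\<delta> = min (1/2) (d / (2 * R + 4))"
  have \<delta>: "\<delta> > 0" "\<delta> \<le> 1/2" using d(1) R unfolding \<delta>_def by (simp_all only: min_less_iff_conj) auto
  have "\<delta> * (2 * R + 4) \<le> d / (2 * R + 4) * (2 * R + 4)" using R by (intro mult_right_mono) (auto simp: \<delta>_def)
  hence "\<delta> * (2 * R + 4) \<le> d" using R by simp
  note \<delta> = \<delta> this
  show ?thesis
  proof (intro exI[of _ \<delta>] conjI allI impI; (elim conjE)?)
    fix c :: real and h :: 'a assume c: "\<bar>c - 1\<bar> \<le> \<delta>" and h: "norm h \<le> \<delta>"
    have c2: "c \<ge> 1/2" using c \<delta> by linarith
    have 1: "pow_integral p (\<lambda>x. f (c *\<^sub>R x + h) - \<phi> (c *\<^sub>R x + h)) \<le> ennreal D * ennreal e'"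
    proof -
      have "pow_integral p (\<lambda>x. f (c *\<^sub>R x + h) - \<phi> (c *\<^sub>R x + h)) = ennreal (1 / \<bar>c\<bar> ^ DIM('a)) * pow_integral p (\<lambda>x. f x - \<phi> x)"
        unfolding pow_integral_def using c2 by (subst nn_integral_affine[symmetric]) auto
      also have "\<dots> \<le> ennreal D * ennreal e'"
      proof (intro mult_mono ennreal_leI less_imp_le[OF ap])
        have "1 / \<bar>c\<bar> ^ DIM('a) = (1 / \<bar>c\<bar>) ^ DIM('a)" by (simp add: power_one_over)
        also have "\<dots> \<le> D" unfolding D_def using c2 by (intro power_mono) (auto simp: field_simps)
        finally show "1 / \<bar>c\<bar> ^ DIM('a) \<le> D" .
      qed auto
      finally show ?thesis .
    qed
    have 2: "pow_integral p (\<lambda>x. \<phi> (c *\<^sub>R x + h) - \<phi> x) \<le> ennreal e'"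
    proof -
      have "norm (\<phi> (c *\<^sub>R x + h) - \<phi> x) powr p \<le> \<eta> powr p * indicator (cball 0 (2 * R + 2)) x" for x
      proof (cases "norm x \<le> 2 * R + 2")
        case True
        have "norm (c *\<^sub>R x + h - x) = norm ((c - 1) *\<^sub>R x + h)" by (simp add: algebra_simps)
        also have "\<dots> \<le> \<bar>c - 1\<bar> * norm x + norm h" by (metis norm_scaleR norm_triangle_ineq)
        also have "\<dots> \<le> \<delta> * (2 * R + 2) + \<delta>" using c h True \<delta>(1) by (intro add_mono mult_mono) auto
        also have "\<dots> < \<delta> * (2 * R + 4)" using \<delta>(1) by (simp add: algebra_simps)
        finally have "norm (\<phi> (c *\<^sub>R x + h) - \<phi> x) < \<eta>" using d(2) \<delta>(3) by fastforce
        thus ?thesis using True p by (auto intro!: powr_mono2)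
      next
        case False
        have "\<bar>c\<bar> * norm x \<ge> 1/2 * norm x" using c2 by (intro mult_right_mono) auto
        moreover have "norm (c *\<^sub>R x) \<le> norm (c *\<^sub>R x + h) + norm h"
          using norm_triangle_ineq4[of "c *\<^sub>R x + h" h] by simp
        ultimately have "norm (c *\<^sub>R x + h) > R" using False h \<delta>(2) by simp
        thus ?thesis using False supp R p by simp
      qed
      hence "pow_integral p (\<lambda>x. \<phi> (c *\<^sub>R x + h) - \<phi> x) \<le> (\<integral>\<^sup>+x. ennreal (\<eta> powr p) * indicator (cball 0 (2 * R + 2)) (x::'a) \<partial>lborel)"
        unfolding pow_integral_def by (intro nn_integral_mono) (auto simp: ennreal_mult'[symmetric] ennreal_indicator[symmetric] intro!: ennreal_leI)
      also have "\<dots> = ennreal (\<eta> powr p * V)" using V by (simp add: nn_integral_cmult_indicator ennreal_mult')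
      also have "\<dots> \<le> ennreal e'" using \<eta> by (rule_tac ennreal_leI) auto
      finally show ?thesis .
    qed
    have 3: "pow_integral p (\<lambda>x. (\<phi> (c *\<^sub>R x + h) - \<phi> x) + (\<phi> x - f x)) \<le> ennreal C * (pow_integral p (\<lambda>x. \<phi> (c *\<^sub>R x + h) - \<phi> x) + pow_integral p (\<lambda>x. \<phi> x - f x))"
      unfolding C_def using p by (intro pow_integral_add_le) auto
    have "pow_integral p (\<lambda>x. f (c *\<^sub>R x + h) - f x)
      = pow_integral p (\<lambda>x. (f (c *\<^sub>R x + h) - \<phi> (c *\<^sub>R x + h)) + ((\<phi> (c *\<^sub>R x + h) - \<phi> x) + (\<phi> x - f x)))"
      by simp
    also have "\<dots> \<le> ennreal C * (pow_integral p (\<lambda>x. f (c *\<^sub>R x + h) - \<phi> (c *\<^sub>R x + h)) + pow_integral p (\<lambda>x. (\<phi> (c *\<^sub>R x + h) - \<phi> x) + (\<phi> x - f x)))"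
      unfolding C_def using p by (intro pow_integral_add_le) auto
    also have "\<dots> \<le> ennreal C * (ennreal D * ennreal e' + ennreal C * (pow_integral p (\<lambda>x. \<phi> (c *\<^sub>R x + h) - \<phi> x) + pow_integral p (\<lambda>x. \<phi> x - f x)))"
      using 1 3 by (intro mult_left_mono add_mono) auto
    also have "\<dots> \<le> ennreal C * (ennreal D * ennreal e' + ennreal C * (ennreal e' + ennreal e'))"
      using 2 ap by (intro mult_left_mono add_mono order_refl) (auto simp: pow_integral_minus[of p \<phi>])
    also have "\<dots> = ennreal (C * (D * e' + C * (e' + e')))"
      using CD e' by (simp only: ennreal_mult ennreal_plus mult_nonneg_nonneg add_nonneg_nonneg less_imp_le)
    also have "C * (D * e' + C * (e' + e')) = e"
    proof -
      have "C * (D * e' + C * (e' + e')) = (C * (D + C * 2)) * e'" by (simp add: algebra_simps)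
      also have "\<dots> = e" using CD by (simp add: e'_def add_pos_pos)
      finally show ?thesis .
    qed
    finally show "pow_integral p (\<lambda>x. f (c *\<^sub>R x + h) - f x) \<le> ennreal e" .
  qed (use \<delta> in auto)
qed

lemma mollifier_exists:
  assumes "\<epsilon> > 0"
  shows "\<exists>\<rho> :: 'a::euclidean_space \<Rightarrow> real. test_function \<rho> \<and> (\<forall>x. \<rho> x \<ge> 0) \<and> (\<forall>x. norm x \<ge> \<epsilon> \<longrightarrow> \<rho> x = 0) \<and> (LINT x|lborel. \<rho> x) = 1"
proof -
  define r where "r = (\<lambda>x::'a. flat_exp 0 (\<epsilon>\<^sup>2 - (norm x)\<^sup>2))"
  have sm: "smooth r" unfolding r_def by (intro smooth_compose[OF smooth_flat_exp] smooth_diff smooth_const smooth_norm_square)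
  have zero: "r x = 0" if "norm x \<ge> \<epsilon>" for x using that assms power_mono[of \<epsilon> "norm x" 2] by (auto simp: r_def flat_exp_def)
  have nn: "r x \<ge> 0" for x by (simp add: r_def flat_exp_def)
  have pos: "r x > 0" if "norm x < \<epsilon>" for x
  proof -
    have "(norm x)\<^sup>2 < \<epsilon>\<^sup>2" using that assms by (intro power_strict_mono) auto
    thus ?thesis by (simp add: r_def flat_exp_def)
  qed
  have cont: "continuous_on UNIV r" using sm by (rule smooth_continuous)
  have int: "integrable lborel r"
  proof -
    have "integrable lborel (\<lambda>x. indicator (cball 0 \<epsilon>) x *\<^sub>R r x)"
      using borel_integrable_compact[of "cball 0 \<epsilon>" r] continuous_on_subset[OF cont] by auto
    also have "(\<lambda>x. indicator (cball 0 \<epsilon>) x *\<^sub>R r x) = r" using zero by (auto simp: indicator_def fun_eq_iff)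
    finally show ?thesis .
  qed
  define Z where "Z = (LINT x|lborel. r x)"
  have "Z \<noteq> 0"
  proof
    assume "Z = 0"
    hence "AE x in lborel. r x = 0" using integral_nonneg_eq_0_iff_AE[OF int] nn by (simp add: Z_def)
    hence "AE x in lborel. x \<notin> ball (0::'a) \<epsilon>" by (rule eventually_mono) (use pos in force)
    hence "emeasure lborel (ball (0::'a) \<epsilon>) = 0" by (subst (asm) AE_iff_measurable[of "ball 0 \<epsilon>"]) auto
    thus False using assms unit_ball_vol_pos[of "real DIM('a)"] by (simp add: emeasure_ball)
  qed
  hence Z: "Z > 0" using nn by (simp add: Z_def order_less_le)
  show ?thesis
  proof (intro exI[of _ "\<lambda>x. inverse Z * r x"] conjI allI impI)
    show "test_function (\<lambda>x. inverse Z * r x)"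
      by (rule test_functionI[of _ \<epsilon>], intro smooth_mult smooth_const sm) (use zero in auto)
    show "(LINT x|lborel. inverse Z * r x) = 1" using Z by (simp add: Z_def[symmetric])
  qed (use nn zero Z in auto)
qed

section \<open>Mollification\<close>

text \<open>Multiplication with the indicators of balls keeps all integrals on the whole space.\<close>

definition locally_integrable :: "('a::euclidean_space \<Rightarrow> real) \<Rightarrow> bool" where
  "locally_integrable f \<longleftrightarrow> f \<in> borel_measurable borel \<and> (\<forall>R. integrable lborel (\<lambda>x. indicator (cball 0 R) x * f x))"

definition mollify :: "('a::euclidean_space \<Rightarrow> real) \<Rightarrow> ('a \<Rightarrow> real) \<Rightarrow> 'a \<Rightarrow> real" where
  "mollify \<rho> f x = (LINT y|lborel. \<rho> (x - y) * f y)"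

text \<open>Weak gradients are taken over the Borel measure, in which Tonelli's theorem and affine substitutions are
available.\<close>

definition weak_gradient :: "(real ^ 'n \<Rightarrow> real) \<Rightarrow> (real ^ 'n \<Rightarrow> real ^ 'n) \<Rightarrow> bool" where
  "weak_gradient u g \<longleftrightarrow> locally_integrable u \<and> (\<forall>i. locally_integrable (\<lambda>x. g x $ i)) \<and>
     (\<forall>\<phi> i. test_function \<phi> \<longrightarrow> (LINT x|lborel. u x * grad \<phi> x $ i) = - (LINT x|lborel. g x $ i * \<phi> x))"

lemma locally_integrable_mult:
  assumes f: "locally_integrable f" and \<phi>: "continuous_on UNIV \<phi>" and supp: "\<And>x. norm x > R \<Longrightarrow> \<phi> x = 0"
  shows "integrable lborel (\<lambda>y. \<phi> y * f y)"
proof -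
  have [measurable]: "f \<in> borel_measurable borel" "\<phi> \<in> borel_measurable borel"
    using f borel_measurable_continuous_onI[OF \<phi>] by (auto simp: locally_integrable_def)
  obtain B where B: "B > 0" "\<And>x. norm (\<phi> x) \<le> B" using bounded_continuous_support[OF \<phi> supp] by blast
  show ?thesis
  proof (rule Bochner_Integration.integrable_bound)
    show "integrable lborel (\<lambda>x. B * (indicator (cball 0 R) x * f x))" using f by (simp add: locally_integrable_def)
    show "AE x in lborel. norm (\<phi> x * f x) \<le> norm (B * (indicator (cball 0 R) x * f x))"
    proof (rule AE_I2)
      fix x show "norm (\<phi> x * f x) \<le> norm (B * (indicator (cball 0 R) x * f x))"
        using B(2)[of x] B(1) supp[of x] by (cases "norm x > R") (auto simp: abs_mult intro!: mult_right_mono)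
    qed
  qed auto
qed

lemma mollify_integrable:
  fixes f :: "'a::euclidean_space \<Rightarrow> real"
  assumes f: "locally_integrable f" and \<phi>: "continuous_on UNIV \<rho>" and supp: "\<And>x. norm x > R \<Longrightarrow> \<rho> x = 0"
  shows "integrable lborel (\<lambda>y. \<rho> (x - y) * f y)"
proof (rule locally_integrable_mult[OF f, of _ "norm x + R"])
  show "continuous_on UNIV (\<lambda>y. \<rho> (x - y))" by (rule continuous_on_compose2[OF \<phi>]) (auto intro: continuous_intros)
  fix y :: 'a assume "norm y > norm x + R"
  moreover have "norm y \<le> norm x + norm (x - y)" using norm_triangle_sub[of y x] by (simp add: norm_minus_commute)
  ultimately show "\<rho> (x - y) = 0" by (intro supp) auto
qed

lemma test_function_grad_component:
  assumes "test_function f" shows "test_function (\<lambda>x. grad f x $ i)"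
  using test_function_frechet[OF assms, of "axis i 1"] by (simp add: grad_def)

lemma test_function_continuous: "test_function f \<Longrightarrow> continuous_on UNIV f"
  using test_function_smooth smooth_continuous by blast

text \<open>The mean value inequality applied to \<open>w \<mapsto> \<rho> (z + w) - grad \<rho> z \<bullet> w\<close>, whose gradient is small near the
origin by uniform continuity.\<close>

lemma first_order_remainder:
  assumes "smooth \<rho>" and d: "\<And>x y. norm (x - y) < d \<Longrightarrow> norm (grad \<rho> x - grad \<rho> y) < e" and v: "norm v < d"
  shows "\<bar>\<rho> (z + v) - \<rho> z - grad \<rho> z \<bullet> v\<bar> \<le> e * norm v"
proof -
  let ?h = "\<lambda>w. \<rho> (z + w) - grad \<rho> z \<bullet> w"
  have d0: "d > 0" using v norm_ge_zero[of v] by linarith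
  have "norm (?h v - ?h 0) \<le> e * norm (v - 0)"
  proof (rule differentiable_bound[of "ball 0 d" ?h "\<lambda>w v. (grad \<rho> (z + w) - grad \<rho> z) \<bullet> v"])
    fix w :: "real^'a" assume w: "w \<in> ball 0 d"
    have "((\<lambda>w. \<rho> (z + w)) has_derivative (\<lambda>v. grad \<rho> (z + w) \<bullet> v)) (at w)"
      by (rule has_derivative_compose[OF _ smooth_has_grad[OF assms(1)]]) (auto intro!: derivative_eq_intros)
    hence "(?h has_derivative (\<lambda>v. grad \<rho> (z + w) \<bullet> v - grad \<rho> z \<bullet> v)) (at w)"
      by (intro has_derivative_diff bounded_linear_imp_has_derivative bounded_linear_inner_right)
    thus "(?h has_derivative (\<lambda>v. (grad \<rho> (z + w) - grad \<rho> z) \<bullet> v)) (at w within ball 0 d)"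
      by (simp add: inner_diff_left has_derivative_at_withinI)
    show "onorm (\<lambda>v. (grad \<rho> (z + w) - grad \<rho> z) \<bullet> v) \<le> e"
    proof (rule onorm_le)
      fix v
      have "\<bar>(grad \<rho> (z + w) - grad \<rho> z) \<bullet> v\<bar> \<le> norm (grad \<rho> (z + w) - grad \<rho> z) * norm v" by (rule Cauchy_Schwarz_ineq2)
      also have "\<dots> \<le> e * norm v" using d[of "z + w" z] w by (intro mult_right_mono) auto
      finally show "norm ((grad \<rho> (z + w) - grad \<rho> z) \<bullet> v) \<le> e * norm v" by simp
    qed
  qed (use v d0 in auto)
  thus ?thesis by (simp add: algebra_simps)
qed

text \<open>Differentiation under the integral: the first order remainder of the kernel is bounded uniformly by a
small multiple of \<open>norm v\<close> and lives on one fixed ball.\<close>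

lemma mollify_has_grad:
  fixes f :: "real ^ 'n \<Rightarrow> real"
  assumes \<rho>: "test_function \<rho>" and f: "locally_integrable f"
  shows "(mollify \<rho> f has_derivative (\<lambda>v. (\<chi> i. mollify (\<lambda>z. grad \<rho> z $ i) f x) \<bullet> v)) (at x)"
proof -
  have sm: "smooth \<rho>" using \<rho> by (rule test_function_smooth)
  obtain R where R: "R > 0" "\<And>x. norm x > R \<Longrightarrow> \<rho> x = 0" using test_function_support[OF \<rho>] by blast
  have gz: "\<And>x. norm x > R \<Longrightarrow> grad \<rho> x = 0" by (rule grad_zero_outside[of R \<rho>]) (simp_all add: R)
  let ?G = "\<chi> i. mollify (\<lambda>z. grad \<rho> z $ i) f x"
  have cgi: "continuous_on UNIV (\<lambda>z. grad \<rho> z $ i)" for i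
    using smooth_continuous[OF smooth_grad_component[OF sm]] .
  have igi: "integrable lborel (\<lambda>y. grad \<rho> (x - y) $ i * f y)" for i
    by (rule mollify_integrable[OF f cgi, of R]) (simp add: gz)
  have Gv: "?G \<bullet> v = (LINT y|lborel. (grad \<rho> (x - y) \<bullet> v) * f y)" for v
  proof -
    have "(LINT y|lborel. (grad \<rho> (x - y) \<bullet> v) * f y) = (LINT y|lborel. (\<Sum>i\<in>UNIV. v $ i * (grad \<rho> (x - y) $ i * f y)))"
      by (simp add: inner_vec_def sum_distrib_left mult_ac)
    also have "\<dots> = (\<Sum>i\<in>UNIV. v $ i * mollify (\<lambda>z. grad \<rho> z $ i) f x)"
      by (subst Bochner_Integration.integral_sum) (auto simp: mollify_def igi)
    finally show ?thesis by (simp add: inner_vec_def mult_ac)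
  qed
  have igv: "integrable lborel (\<lambda>y. (grad \<rho> (x - y) \<bullet> v) * f y)" for v
  proof -
    have "integrable lborel (\<lambda>y. \<Sum>i\<in>UNIV. v $ i * (grad \<rho> (x - y) $ i * f y))" by (auto simp: igi)
    thus ?thesis by (simp add: inner_vec_def sum_distrib_left mult_ac)
  qed
  have ir: "integrable lborel (\<lambda>y. \<rho> (x - y) * f y)" for x
    by (rule mollify_integrable[OF f test_function_continuous[OF \<rho>] R(2)])
  define Q where "Q = norm x + R + 1"
  define M where "M = (LINT y|lborel. \<bar>indicator (cball 0 Q) y * f y\<bar>)"
  have iM: "integrable lborel (\<lambda>y. \<bar>indicator (cball 0 Q) y * f y\<bar>)" using f by (simp add: locally_integrable_def)
  have M: "M \<ge> 0" by (simp add: M_def)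
  show ?thesis
    unfolding has_derivative_at_alt
  proof (intro conjI allI impI)
    show "bounded_linear (\<lambda>v. ?G \<bullet> v)" by (rule bounded_linear_inner_right)
    fix e :: real assume e: "e > 0"
    define e1 where "e1 = e / (M + 1)"
    have e1: "e1 > 0" "e1 * M \<le> e" using e M by (auto simp: e1_def field_simps)
    obtain d where d: "d > 0" "\<And>x y. norm (x - y) < d \<Longrightarrow> norm (grad \<rho> x - grad \<rho> y) < e1"
      using uniform_continuity_of_compact_support[OF smooth_grad_continuous[OF sm] gz e1(1)] by blast
    show "\<exists>d>0. \<forall>y. norm (y - x) < d \<longrightarrow> norm (mollify \<rho> f y - mollify \<rho> f x - ?G \<bullet> (y - x)) \<le> e * norm (y - x)"
    proof (intro exI[of _ "min d 1"] conjI allI impI)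
      fix z assume z: "norm (z - x) < min d 1"
      define v where "v = z - x"
      have "mollify \<rho> f z - mollify \<rho> f x - ?G \<bullet> v
          = (LINT y|lborel. (\<rho> (z - y) - \<rho> (x - y) - grad \<rho> (x - y) \<bullet> v) * f y)"
        unfolding Gv left_diff_distrib
        unfolding mollify_def by (simp add: ir igv)
      also have "norm \<dots> \<le> (LINT y|lborel. norm ((\<rho> (z - y) - \<rho> (x - y) - grad \<rho> (x - y) \<bullet> v) * f y))"
        by (rule integral_norm_bound)
      also have "\<dots> \<le> (LINT y|lborel. e1 * norm v * \<bar>indicator (cball 0 Q) y * f y\<bar>)"
      proof (rule integral_mono)
        fix y
        have zy: "z - y = (x - y) + v" by (simp add: v_def)
        have rem: "\<bar>\<rho> (z - y) - \<rho> (x - y) - grad \<rho> (x - y) \<bullet> v\<bar> \<le> e1 * norm v"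
          unfolding zy by (rule first_order_remainder[OF sm d(2)]) (use z in \<open>auto simp: v_def\<close>)
        have "\<rho> (z - y) - \<rho> (x - y) - grad \<rho> (x - y) \<bullet> v = 0" if "y \<notin> cball 0 Q"
        proof -
          have "norm y \<le> norm x + norm (x - y)" "norm (x - y) \<le> norm (z - y) + norm (z - x)"
            using norm_triangle_sub[of y x] norm_triangle_ineq4[of "z - y" "z - x"] by (auto simp: norm_minus_commute)
          hence "norm (x - y) > R" "norm (z - y) > R" using that z by (auto simp: Q_def)
          thus ?thesis using R gz by auto
        qed
        thus "norm ((\<rho> (z - y) - \<rho> (x - y) - grad \<rho> (x - y) \<bullet> v) * f y) \<le> e1 * norm v * \<bar>indicator (cball 0 Q) y * f y\<bar>"
          using rem by (cases "y \<in> cball 0 Q") (auto simp: abs_mult mult_right_mono)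
        show "integrable lborel (\<lambda>y. norm ((\<rho> (z - y) - \<rho> (x - y) - grad \<rho> (x - y) \<bullet> v) * f y))"
          unfolding left_diff_distrib by (intro integrable_norm Bochner_Integration.integrable_diff ir igv)
      qed (use iM in simp)
      also have "\<dots> = e1 * M * norm v" by (simp add: M_def mult_ac)
      also have "\<dots> \<le> e * norm v" using e1 by (intro mult_right_mono) auto
      finally show "norm (mollify \<rho> f z - mollify \<rho> f x - ?G \<bullet> (z - x)) \<le> e * norm (z - x)" by (simp add: v_def)
    qed (use d in auto)
  qed
qed

lemma Ck_on_sum: "(\<And>i. i \<in> I \<Longrightarrow> Ck_on k UNIV (f i)) \<Longrightarrow> Ck_on k UNIV (\<lambda>x. \<Sum>i\<in>I. f i x)"
  by (induction I rule: infinite_finite_induct) (simp_all add: Ck_on_const Ck_on_add)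

text \<open>A derivative of a convolution is a convolution with a derivative of the kernel, again a test function, so
the induction over the order runs over all kernels at once.\<close>

lemma mollify_smooth:
  fixes f :: "real ^ 'n \<Rightarrow> real"
  assumes \<rho>: "test_function \<rho>" and f: "locally_integrable f"
  shows "smooth (mollify \<rho> f)"
proof -
  have "Ck_on k UNIV (mollify \<rho> f)" if "test_function \<rho>" for k \<rho>
    using that
  proof (induction k arbitrary: \<rho>)
    case 0
    show ?case using has_derivative_continuous[OF mollify_has_grad[OF 0 f]]
      by (simp add: continuous_at_imp_continuous_on)
  next
    case (Suc k)
    show ?case
    proof (rule Ck_on_SucI[OF mollify_has_grad[OF Suc.prems f]])
      fix v :: "real^'n"
      have "Ck_on k UNIV (\<lambda>x. \<Sum>i\<in>UNIV. mollify (\<lambda>z. grad \<rho> z $ i) f x * v $ i)"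
        by (rule Ck_on_sum, rule Ck_on_mult[OF Suc.IH[OF test_function_grad_component[OF Suc.prems]] Ck_on_const])
      thus "Ck_on k UNIV (\<lambda>x. (\<chi> i. mollify (\<lambda>z. grad \<rho> z $ i) f x) \<bullet> v)" by (simp add: inner_vec_def)
    qed
  qed
  thus ?thesis using \<rho> by (simp add: smooth_def)
qed

lemma grad_mollify:
  fixes f :: "real ^ 'n \<Rightarrow> real"
  assumes "test_function \<rho>" "locally_integrable f"
  shows "grad (mollify \<rho> f) x = (\<chi> i. mollify (\<lambda>z. grad \<rho> z $ i) f x)"
  by (rule grad_unique[OF mollify_has_grad[OF assms]])

text \<open>The reflected and translated kernel is a test function, so the definition of the weak gradient moves the
derivative from the kernel to the function.\<close>

lemma grad_mollify_weak_gradient: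
  fixes u :: "real ^ 'n \<Rightarrow> real"
  assumes \<rho>: "test_function \<rho>" and w: "weak_gradient u g"
  shows "grad (mollify \<rho> u) x $ i = mollify \<rho> (\<lambda>y. g y $ i) x"
proof -
  have sm: "smooth \<rho>" using \<rho> by (rule test_function_smooth)
  obtain R where R: "R > 0" "\<And>x. norm x > R \<Longrightarrow> \<rho> x = 0" using test_function_support[OF \<rho>] by blast
  define \<phi> where "\<phi> = (\<lambda>y. \<rho> ((-1) *\<^sub>R y + x))"
  have t: "test_function \<phi>"
  proof (rule test_functionI[of _ "norm x + R"])
    show "smooth \<phi>" unfolding \<phi>_def by (rule smooth_affine[OF sm])
    fix y :: "real^'n" assume "norm y > norm x + R"
    moreover have "norm y \<le> norm x + norm (x - y)" using norm_triangle_sub[of y x] by (simp add: norm_minus_commute)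
    ultimately show "\<phi> y = 0" using R(2)[of "x - y"] by (simp add: \<phi>_def)
  qed
  have gr: "grad \<phi> y = - grad \<rho> (x - y)" for y unfolding \<phi>_def by (subst grad_affine[OF sm]) simp
  have "grad (mollify \<rho> u) x $ i = mollify (\<lambda>z. grad \<rho> z $ i) u x"
    using w by (simp add: grad_mollify[OF \<rho>] weak_gradient_def)
  also have "\<dots> = - (LINT y|lborel. u y * grad \<phi> y $ i)" by (simp add: mollify_def gr mult.commute)
  also have "\<dots> = (LINT y|lborel. g y $ i * \<phi> y)" using w t by (simp add: weak_gradient_def)
  also have "\<dots> = mollify \<rho> (\<lambda>y. g y $ i) x" by (simp add: mollify_def \<phi>_def mult.commute)
  finally show ?thesis .
qed

text \<open>Young's inequality in the form of the tangent inequality for the convex function \<open>t powr p\<close>.\<close>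

lemma Young_powr:
  fixes a b p :: real
  assumes p: "p > 1" and "a \<ge> 0" "b \<ge> 0"
  shows "a powr (p - 1) * b \<le> (p - 1) / p * a powr p + b powr p / p"
proof -
  have "a powr (p - 1) * b \<le> (a powr (p - 1)) powr (p / (p - 1)) / (p / (p - 1)) + b powr p / p"
    by (rule Youngs_inequality) (use assms in \<open>auto simp: field_simps\<close>)
  also have "(a powr (p - 1)) powr (p / (p - 1)) = a powr p" using p by (simp add: powr_powr)
  finally show ?thesis using p by (simp add: field_simps)
qed

lemma (in prob_space) jensen_powr:
  assumes p: "p \<ge> 1" and k: "integrable M k"
  shows "ennreal (\<bar>expectation k\<bar> powr p) \<le> (\<integral>\<^sup>+x. ennreal (\<bar>k x\<bar> powr p) \<partial>M)"
proof (cases "(\<integral>\<^sup>+x. ennreal (\<bar>k x\<bar> powr p) \<partial>M) = \<infinity>")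
  case False
  have [measurable]: "k \<in> borel_measurable M" using k by auto
  have int: "integrable M (\<lambda>x. \<bar>k x\<bar> powr p)"
    using False by (simp add: integrable_iff_bounded less_top)
  define m where "m = expectation (\<lambda>x. \<bar>k x\<bar>)"
  have m: "m \<ge> 0" by (simp add: m_def)
  have "m powr p \<le> expectation (\<lambda>x. \<bar>k x\<bar> powr p)"
  proof (cases "p = 1")
    case True
    thus ?thesis using m by (simp add: m_def)
  next
    case False
    hence p1: "p > 1" using p by simp
    have "expectation (\<lambda>x. m powr (p - 1) * \<bar>k x\<bar>) \<le> expectation (\<lambda>x. (p - 1) / p * m powr p + \<bar>k x\<bar> powr p / p)"
      by (rule integral_mono) (use k int Young_powr[OF p1 m] in auto)
    also have "\<dots> = (p - 1) / p * m powr p + expectation (\<lambda>x. \<bar>k x\<bar> powr p) / p"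
      using int by (simp add: prob_space)
    also have "expectation (\<lambda>x. m powr (p - 1) * \<bar>k x\<bar>) = m powr (p - 1) * m" by (simp add: m_def)
    also have "m powr (p - 1) * m = m powr p"
      using m by (cases "m = 0") (simp_all add: powr_mult_base mult.commute)
    finally show ?thesis using p1 by (simp add: field_simps)
  qed
  moreover have "\<bar>expectation k\<bar> powr p \<le> m powr p"
    unfolding m_def using p by (intro powr_mono2) auto
  ultimately have "ennreal (\<bar>expectation k\<bar> powr p) \<le> ennreal (expectation (\<lambda>x. \<bar>k x\<bar> powr p))"
    by (intro ennreal_leI) linarith
  also have "\<dots> = (\<integral>\<^sup>+x. ennreal (\<bar>k x\<bar> powr p) \<partial>M)" by (rule nn_integral_eq_integral[symmetric]) (use int in auto)
  finally show ?thesis .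
qed simp

text \<open>By Jensen's inequality for the probability density \<open>\<rho>\<close> and Tonelli, the distance to the mollified
function is an average of translation differences.\<close>

lemma pow_integral_mollify_diff:
  fixes f :: "'a::euclidean_space \<Rightarrow> real"
  assumes p: "p \<ge> 1" and f: "locally_integrable f" and \<rho>: "test_function \<rho>" and nn: "\<And>x. \<rho> x \<ge> 0" and one: "(LINT x|lborel. \<rho> x) = 1"
    and supp: "\<And>x. norm x \<ge> \<epsilon> \<Longrightarrow> \<rho> x = 0"
    and E: "\<And>h. norm h \<le> \<epsilon> \<Longrightarrow> pow_integral p (\<lambda>x. f (x - h) - f x) \<le> E"
  shows "pow_integral p (\<lambda>x. mollify \<rho> f x - f x) \<le> E"
proof -
  have [measurable]: "f \<in> borel_measurable borel" using f by (simp add: locally_integrable_def)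
  have cont: "continuous_on UNIV \<rho>" using \<rho> by (rule test_function_continuous)
  have [measurable]: "\<rho> \<in> borel_measurable borel" using cont by (rule borel_measurable_continuous_onI)
  have i\<rho>: "integrable lborel \<rho>" using one not_integrable_integral_eq by fastforce
  define M where "M = density lborel (\<lambda>h. ennreal (\<rho> h))"
  have nnone: "(\<integral>\<^sup>+h. ennreal (\<rho> h) \<partial>lborel) = 1"
    using nn_integral_eq_integral[OF i\<rho>] nn one by simp
  interpret M: prob_space M
    by (rule prob_spaceI) (simp add: M_def emeasure_density nnone)
  have pt: "ennreal (\<bar>mollify \<rho> f x - f x\<bar> powr p) \<le> (\<integral>\<^sup>+h. ennreal (\<rho> h) * ennreal (\<bar>f (x - h) - f x\<bar> powr p) \<partial>lborel)" for x
  proof -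
    let ?F = "\<lambda>y. \<rho> (x - y) * f y"
    have iF: "integrable lborel ?F" by (rule mollify_integrable[OF f cont, of \<epsilon>]) (simp add: supp)
    have eqF: "?F ((-1) *\<^sub>R h + x) = \<rho> h * f (x - h)" for h by simp
    have i1: "integrable lborel (\<lambda>h. \<rho> h * f (x - h))"
      using integrable_affine[OF iF, of "-1" x] by simp
    have "mollify \<rho> f x = (LINT h|lborel. \<rho> h * f (x - h))"
      using integral_affine[of ?F "-1" x] by (simp add: mollify_def)
    hence "mollify \<rho> f x - f x = (LINT h|lborel. \<rho> h * (f (x - h) - f x))"
      using i1 i\<rho> one by (simp add: right_diff_distrib)
    also have "\<dots> = M.expectation (\<lambda>h. f (x - h) - f x)"
      unfolding M_def using nn by (subst integral_density) auto
    finally have eq: "mollify \<rho> f x - f x = M.expectation (\<lambda>h. f (x - h) - f x)" .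
    have "integrable lborel (\<lambda>h. \<rho> h * (f (x - h) - f x))" using i1 i\<rho> by (simp add: right_diff_distrib)
    hence "integrable M (\<lambda>h. f (x - h) - f x)" unfolding M_def using nn by (subst integrable_density) auto
    from M.jensen_powr[OF p this] show ?thesis unfolding eq
      by (subst (asm) M_def, subst (asm) nn_integral_density) (auto simp: M_def)
  qed
  have "pow_integral p (\<lambda>x. mollify \<rho> f x - f x) \<le> (\<integral>\<^sup>+x. \<integral>\<^sup>+h. ennreal (\<rho> h) * ennreal (\<bar>f (x - h) - f x\<bar> powr p) \<partial>lborel \<partial>lborel)"
    unfolding pow_integral_def using pt by (intro nn_integral_mono) auto
  also have "\<dots> = (\<integral>\<^sup>+h. \<integral>\<^sup>+x. ennreal (\<rho> h) * ennreal (\<bar>f (x - h) - f x\<bar> powr p) \<partial>lborel \<partial>lborel)"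
    by (rule lborel_pair.Fubini') measurable
  also have "\<dots> = (\<integral>\<^sup>+h. ennreal (\<rho> h) * pow_integral p (\<lambda>x. f (x - h) - f x) \<partial>lborel)"
    by (simp add: nn_integral_cmult pow_integral_def)
  also have "\<dots> \<le> (\<integral>\<^sup>+h. ennreal (\<rho> h) * E \<partial>lborel)"
  proof (intro nn_integral_mono)
    fix h show "ennreal (\<rho> h) * pow_integral p (\<lambda>x. f (x - h) - f x) \<le> ennreal (\<rho> h) * E"
      using E[of h] supp[of h] by (cases "norm h \<le> \<epsilon>") (auto intro: mult_left_mono)
  qed
  also have "\<dots> = E" by (simp add: nn_integral_multc nnone)
  finally show ?thesis .
qed

lemma locally_integrable_Lp:
  fixes f :: "'a::euclidean_space \<Rightarrow> real"
  assumes p: "p \<ge> 1" and [measurable]: "f \<in> borel_measurable borel" and fin: "pow_integral p f < \<infinity>"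
  shows "locally_integrable f"
  unfolding locally_integrable_def
proof (intro conjI allI)
  fix R
  have 1: "integrable lborel (\<lambda>x. \<bar>f x\<bar> powr p)" using pow_integral_finite_iff[of f p] fin by simp
  have 2: "integrable lborel (indicator (cball 0 R) :: 'a \<Rightarrow> real)"
    using emeasure_lborel_cball_finite by (subst integrable_indicator_iff) auto
  show "integrable lborel (\<lambda>x. indicator (cball 0 R) x * f x)"
  proof (rule Bochner_Integration.integrable_bound[OF Bochner_Integration.integrable_add[OF 2 1]])
    show "AE x in lborel. norm (indicator (cball 0 R) x * f x) \<le> norm (indicator (cball 0 R) x + \<bar>f x\<bar> powr p)"
    proof (rule AE_I2)
      fix x
      have "\<bar>f x\<bar> \<le> 1 + \<bar>f x\<bar> powr p"
      proof (cases "\<bar>f x\<bar> \<le> 1")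
        case False
        hence "\<bar>f x\<bar> powr 1 \<le> \<bar>f x\<bar> powr p" using p by (intro powr_mono) auto
        thus ?thesis using False by simp
      qed (simp add: add_increasing2)
      thus "norm (indicator (cball 0 R) x * f x) \<le> norm (indicator (cball 0 R) x + \<bar>f x\<bar> powr p)"
        by (auto simp: indicator_def)
    qed
  qed measurable
qed auto

lemma mollify_approximates:
  fixes f :: "'a::euclidean_space \<Rightarrow> real"
  assumes p: "p \<ge> 1" and [measurable]: "f \<in> borel_measurable borel" and fin: "pow_integral p f < \<infinity>" and e: "(e::real) > 0"
  shows "\<exists>\<delta>>0. \<forall>\<rho>. test_function \<rho> \<and> (\<forall>x. \<rho> x \<ge> 0) \<and> (\<forall>x. norm x \<ge> \<delta> \<longrightarrow> \<rho> x = 0) \<and> (LINT x|lborel. \<rho> x) = 1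
     \<longrightarrow> pow_integral p (\<lambda>x. mollify \<rho> f x - f x) \<le> ennreal e"
proof -
  have f: "locally_integrable f" by (rule locally_integrable_Lp[OF p _ fin]) simp
  obtain \<delta> where \<delta>: "\<delta> > 0" "\<And>c h. \<bar>c - 1\<bar> \<le> \<delta> \<and> norm h \<le> \<delta> \<Longrightarrow> pow_integral p (\<lambda>x. f (c *\<^sub>R x + h) - f x) \<le> ennreal e"
    using pow_integral_affine_continuity[of p f e] p fin e by auto
  show ?thesis
  proof (intro exI[of _ \<delta>] conjI allI impI \<delta>(1))
    fix \<rho> :: "'a \<Rightarrow> real"
    assume *: "test_function \<rho> \<and> (\<forall>x. \<rho> x \<ge> 0) \<and> (\<forall>x. norm x \<ge> \<delta> \<longrightarrow> \<rho> x = 0) \<and> (LINT x|lborel. \<rho> x) = 1"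
    show "pow_integral p (\<lambda>x. mollify \<rho> f x - f x) \<le> ennreal e"
      by (rule pow_integral_mollify_diff[OF p f, of \<rho> \<delta>]) (use * \<delta>(1) \<delta>(2)[of 1 "- _"] in auto)
  qed
qed

section \<open>Test functions are dense in Sobolev space\<close>

lemma pow_integral_vec_le:
  fixes G :: "'a::euclidean_space \<Rightarrow> real ^ 'n"
  assumes p: "p \<ge> 0" and [measurable]: "\<And>i. (\<lambda>x. G x $ i) \<in> borel_measurable borel"
  shows "pow_integral p G \<le> ennreal (real CARD('n) powr p) * (\<Sum>i\<in>UNIV. pow_integral p (\<lambda>x. G x $ i))"
proof -
  have pt: "norm v powr p \<le> real CARD('n) powr p * (\<Sum>i\<in>UNIV. norm (v $ i) powr p)" for v :: "real ^ 'n"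
  proof -
    have "\<exists>i. norm v \<le> real CARD('n) * \<bar>v $ i\<bar>"
    proof (rule ccontr)
      assume "\<not> ?thesis"
      hence "\<bar>v $ i\<bar> < norm v / real CARD('n)" for i by (auto simp: field_simps not_le)
      hence "(\<Sum>i\<in>UNIV. \<bar>v $ i\<bar>) < (\<Sum>i\<in>(UNIV::'n set). norm v / real CARD('n))"
        by (intro sum_strict_mono) auto
      thus False using norm_le_l1_cart[of v] by simp
    qed
    then obtain i where "norm v \<le> real CARD('n) * \<bar>v $ i\<bar>" by blast
    hence "norm v powr p \<le> (real CARD('n) * \<bar>v $ i\<bar>) powr p" using p by (intro powr_mono2) auto
    also have "\<dots> = real CARD('n) powr p * norm (v $ i) powr p" by (simp add: powr_mult)
    also have "\<dots> \<le> real CARD('n) powr p * (\<Sum>i\<in>UNIV. norm (v $ i) powr p)"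
      by (intro mult_left_mono member_le_sum) auto
    finally show ?thesis .
  qed
  have "pow_integral p G \<le> (\<integral>\<^sup>+x. ennreal (real CARD('n) powr p) * (\<Sum>i\<in>UNIV. ennreal (norm (G x $ i) powr p)) \<partial>lborel)"
    unfolding pow_integral_def
  proof (intro nn_integral_mono)
    fix x
    have "ennreal (norm (G x) powr p) \<le> ennreal (real CARD('n) powr p * (\<Sum>i\<in>UNIV. norm (G x $ i) powr p))"
      by (rule ennreal_leI[OF pt])
    also have "\<dots> = ennreal (real CARD('n) powr p) * (\<Sum>i\<in>UNIV. ennreal (norm (G x $ i) powr p))"
      by (subst sum_ennreal) (auto simp: ennreal_mult sum_nonneg)
    finally show "ennreal (norm (G x) powr p) \<le> ennreal (real CARD('n) powr p) * (\<Sum>i\<in>UNIV. ennreal (norm (G x $ i) powr p))" .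
  qed
  also have "\<dots> = ennreal (real CARD('n) powr p) * (\<Sum>i\<in>UNIV. pow_integral p (\<lambda>x. G x $ i))"
    unfolding pow_integral_def by (subst nn_integral_cmult, measurable, subst nn_integral_sum, measurable)
  finally show ?thesis .
qed

lemma pow_integral_component_le:
  fixes G :: "'a::euclidean_space \<Rightarrow> real ^ 'n"
  assumes "p \<ge> 0" shows "pow_integral p (\<lambda>x. G x $ i) \<le> pow_integral p G"
  by (rule pow_integral_mono[OF assms]) (simp add: component_le_norm_cart)

lemma weak_gradient_measurable:
  fixes u :: "real ^ 'n \<Rightarrow> real"
  assumes "weak_gradient u g"
  shows "u \<in> borel_measurable borel" "g \<in> borel_measurable borel" "(\<lambda>x. g x $ i) \<in> borel_measurable borel"
proof -
  show *: "(\<lambda>x. g x $ i) \<in> borel_measurable borel" for i using assms by (simp add: weak_gradient_def locally_integrable_def)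
  have "(\<lambda>x. g x \<bullet> b) \<in> borel_measurable borel" if b: "b \<in> Basis" for b
  proof -
    obtain i where "b = axis i (1::real)" using b unfolding Basis_vec_def by auto
    thus ?thesis using *[of i] by (simp add: cart_eq_inner_axis)
  qed
  thus "g \<in> borel_measurable borel" by (rule borel_measurable_euclidean_space[THEN iffD2, rule_format])
qed (use assms in \<open>simp add: weak_gradient_def locally_integrable_def\<close>)

lemma smooth_measurable: "smooth f \<Longrightarrow> f \<in> borel_measurable borel"
  by (intro borel_measurable_continuous_onI smooth_continuous)

lemma smooth_grad_measurable: "smooth f \<Longrightarrow> grad f \<in> borel_measurable borel"
  by (intro borel_measurable_continuous_onI smooth_grad_continuous)

lemma pow_integral_cmult:
  fixes f :: "'a::euclidean_space \<Rightarrow> 'b::{real_normed_vector, second_countable_topology}"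
  assumes [measurable]: "f \<in> borel_measurable borel"
  shows "pow_integral p (\<lambda>x. c *\<^sub>R f x) = ennreal (\<bar>c\<bar> powr p) * pow_integral p f"
  unfolding pow_integral_def by (simp add: powr_mult ennreal_mult nn_integral_cmult)

text \<open>The gradient is handled componentwise, so the kernel has to be fine enough for all components
simultaneously.\<close>

lemma smooth_approximation:
  fixes u :: "real ^ 'n \<Rightarrow> real"
  assumes p: "p \<ge> 1" and w: "weak_gradient u g" and fu: "pow_integral p u < \<infinity>" and fg: "pow_integral p g < \<infinity>" and e: "(e::real) > 0"
  shows "\<exists>v. smooth v \<and> pow_integral p (\<lambda>x. v x - u x) \<le> ennreal e \<and> pow_integral p (\<lambda>x. grad v x - g x) \<le> ennreal e"
proof -
  note [measurable] = weak_gradient_measurable[OF w]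
  define N where "N = real CARD('n)"
  have N: "N \<ge> 1" by (simp add: N_def Suc_leI)
  define e' where "e' = e / (N powr p * N)"
  have e': "e' > 0" using e N by (simp add: e'_def)
  have fgi: "pow_integral p (\<lambda>x. g x $ i) < \<infinity>" for i
    using pow_integral_component_le[of p g i] fg p by (auto intro: le_less_trans)
  define P where "P i \<delta> \<longleftrightarrow> \<delta> > 0 \<and> (\<forall>\<rho>. test_function \<rho> \<and> (\<forall>x. \<rho> x \<ge> 0) \<and> (\<forall>x. norm x \<ge> \<delta> \<longrightarrow> \<rho> x = 0) \<and> (LINT x|lborel. \<rho> x) = 1
     \<longrightarrow> pow_integral p (\<lambda>x. mollify \<rho> (\<lambda>y. g y $ i) x - g x $ i) \<le> ennreal e')" for i \<delta>
  have "\<forall>i. \<exists>\<delta>. P i \<delta>"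
    unfolding P_def using mollify_approximates[OF p _ fgi e'] by simp
  from choice[OF this] obtain \<delta> where "\<forall>i. P i (\<delta> i)" ..
  hence \<delta>: "\<delta> i > 0" "test_function \<rho> \<and> (\<forall>x. \<rho> x \<ge> 0) \<and> (\<forall>x. norm x \<ge> \<delta> i \<longrightarrow> \<rho> x = 0) \<and> (LINT x|lborel. \<rho> x) = 1
     \<Longrightarrow> pow_integral p (\<lambda>x. mollify \<rho> (\<lambda>y. g y $ i) x - g x $ i) \<le> ennreal e'" for i \<rho> unfolding P_def by blast+
  obtain \<delta>0 where \<delta>0: "\<delta>0 > 0" "\<And>\<rho>. test_function \<rho> \<and> (\<forall>x. \<rho> x \<ge> 0) \<and> (\<forall>x. norm x \<ge> \<delta>0 \<longrightarrow> \<rho> x = 0) \<and> (LINT x|lborel. \<rho> x) = 1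
     \<Longrightarrow> pow_integral p (\<lambda>x. mollify \<rho> u x - u x) \<le> ennreal e"
    using mollify_approximates[OF p _ fu e] by auto
  define d where "d = Min (insert \<delta>0 (range \<delta>))"
  have d: "d > 0" "d \<le> \<delta>0" "d \<le> \<delta> i" for i
    unfolding d_def using \<delta>(1) \<delta>0(1) by (auto intro!: Min_le simp del: Min_insert)
  obtain \<rho> :: "real^'n \<Rightarrow> real" where \<rho>: "test_function \<rho>" "\<And>x. \<rho> x \<ge> 0" "\<And>x. norm x \<ge> d \<Longrightarrow> \<rho> x = 0" "(LINT x|lborel. \<rho> x) = 1"
    using mollifier_exists[OF d(1)] by blast
  have u: "locally_integrable u" using w by (simp add: weak_gradient_def)
  have sm: "smooth (mollify \<rho> u)" by (rule mollify_smooth[OF \<rho>(1) u])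
  note [measurable] = smooth_measurable[OF sm] smooth_grad_measurable[OF sm]
  show ?thesis
  proof (intro exI[of _ "mollify \<rho> u"] conjI sm)
    show "pow_integral p (\<lambda>x. mollify \<rho> u x - u x) \<le> ennreal e" using \<delta>0(2)[of \<rho>] \<rho> d(2) by auto
    have i: "pow_integral p (\<lambda>x. (grad (mollify \<rho> u) x - g x) $ i) \<le> ennreal e'" for i
      using \<delta>(2)[of \<rho> i] \<rho> d(3)[of i] by (auto simp: grad_mollify_weak_gradient[OF \<rho>(1) w])
    have m: "(\<lambda>x. (grad (mollify \<rho> u) x - g x) $ i) \<in> borel_measurable borel" for i
      using smooth_measurable[OF smooth_grad_component[OF sm, of i]] by simp
    have "pow_integral p (\<lambda>x. grad (mollify \<rho> u) x - g x) \<le> ennreal (N powr p) * (\<Sum>i\<in>UNIV. pow_integral p (\<lambda>x. (grad (mollify \<rho> u) x - g x) $ i))"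
      unfolding N_def using p by (intro pow_integral_vec_le m) auto
    also have "\<dots> \<le> ennreal (N powr p) * (\<Sum>i\<in>(UNIV::'n set). ennreal e')"
      by (intro mult_left_mono sum_mono i) auto
    also have "\<dots> = ennreal (N powr p * (N * e'))" using N e' by (simp add: N_def ennreal_mult ennreal_of_nat_eq_real_of_nat)
    also have "N powr p * (N * e') = e" using N by (simp add: e'_def)
    finally show "pow_integral p (\<lambda>x. grad (mollify \<rho> u) x - g x) \<le> ennreal e" .
  qed
qed

text \<open>The smooth approximation is multiplied by wide cutoffs. In the gradient the extra term \<open>v * grad \<psi>\<close>
carries the factor \<open>1 / n\<close> of the cutoff at scale \<open>n\<close> and disappears.\<close>

lemma test_function_approximation:
  fixes u :: "real ^ 'n \<Rightarrow> real"
  assumes p: "p \<ge> 1" and w: "weak_gradient u g" and fu: "pow_integral p u < \<infinity>" and fg: "pow_integral p g < \<infinity>" and e: "(e::real) > 0"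
  shows "\<exists>\<phi>. test_function \<phi> \<and> pow_integral p (\<lambda>x. \<phi> x - u x) \<le> ennreal e \<and> pow_integral p (\<lambda>x. grad \<phi> x - g x) \<le> ennreal e"
proof -
  note [measurable] = weak_gradient_measurable[OF w]
  have p0: "p \<ge> 0" using p by simp
  define C where "C = 2 powr p"
  have C: "C > 0" by (simp add: C_def)
  define e' where "e' = e / (C * (C * 2 + 1))"
  have e': "e' > 0" using e C by (simp add: e'_def add_pos_pos)
  obtain v where v: "smooth v" "pow_integral p (\<lambda>x. v x - u x) \<le> ennreal e'" "pow_integral p (\<lambda>x. grad v x - g x) \<le> ennreal e'"
    using smooth_approximation[OF p w fu fg e'] by blast
  note [measurable] = smooth_measurable[OF v(1)] smooth_grad_measurable[OF v(1)]
  obtain \<psi> :: "real^'n \<Rightarrow> real" and L where L: "L > 0" and t\<psi>: "test_function \<psi>"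
    and one: "\<And>x. norm x \<le> 1 \<Longrightarrow> \<psi> x = 1" and zero: "\<And>x. norm x \<ge> 2 \<Longrightarrow> \<psi> x = 0"
    and r: "\<And>x. 0 \<le> \<psi> x \<and> \<psi> x \<le> 1" and gL: "\<And>x. norm (grad \<psi> x) \<le> L"
    using cutoff_exists[where 'n='n] by blast
  define \<psi>n where "\<psi>n n = (\<lambda>x. \<psi> (inverse (real (Suc n)) *\<^sub>R x + 0))" for n
  have s\<psi>: "smooth \<psi>" using t\<psi> by (rule test_function_smooth)
  have s\<psi>n: "smooth (\<psi>n n)" for n unfolding \<psi>n_def by (rule smooth_affine[OF s\<psi>])
  note [measurable] = smooth_measurable[OF s\<psi>n] smooth_grad_measurable[OF s\<psi>n]
  have g\<psi>n: "grad (\<psi>n n) x = inverse (real (Suc n)) *\<^sub>R grad \<psi> (inverse (real (Suc n)) *\<^sub>R x + 0)" for n x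
    unfolding \<psi>n_def by (rule grad_affine[OF s\<psi>])
  have one_n: "\<psi>n n x = 1" if "norm x \<le> real n" for n x
    unfolding \<psi>n_def using that by (intro one) (simp add: field_simps)
  have rn: "0 \<le> \<psi>n n x \<and> \<psi>n n x \<le> 1" for n x unfolding \<psi>n_def by (rule r)
  have t: "test_function (\<lambda>x. \<psi>n n x * v x)" for n
  proof (rule test_functionI[OF smooth_mult[OF s\<psi>n v(1)], of "2 * real (Suc n)"])
    fix x :: "real^'n" assume "2 * real (Suc n) < norm x"
    hence "\<psi>n n x = 0" unfolding \<psi>n_def by (intro zero) (simp add: field_simps)
    thus "\<psi>n n x * v x = 0" by simp
  qed
  have cut: "(\<lambda>n. pow_integral p (\<lambda>x. (\<psi>n n x - 1) *\<^sub>R f x)) \<longlonglongrightarrow> 0"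
    if [measurable]: "f \<in> borel_measurable borel" and fin: "pow_integral p f < \<infinity>"
    for f :: "real^'n \<Rightarrow> 'b::{real_normed_vector, second_countable_topology}"
  proof (rule pow_integral_dominated[where W = "\<lambda>x. norm (f x) powr p"])
    show "AE x in lborel. (\<lambda>n. (\<psi>n n x - 1) *\<^sub>R f x) \<longlonglongrightarrow> 0"
    proof (rule AE_I2, rule tendsto_eventually)
      fix x :: "real^'n"
      obtain M where M: "real M \<ge> norm x" using real_arch_simple by blast
      show "\<forall>\<^sub>F n in sequentially. (\<psi>n n x - 1) *\<^sub>R f x = 0"
        using eventually_ge_at_top[of M] by eventually_elim (use M one_n in force)
    qed
    show "AE x in lborel. norm ((\<psi>n n x - 1) *\<^sub>R f x) powr p \<le> norm (f x) powr p" for n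
    proof (rule AE_I2)
      fix x
      have "\<bar>\<psi>n n x - 1\<bar> * norm (f x) \<le> 1 * norm (f x)" using rn[of n x] by (intro mult_right_mono) auto
      thus "norm ((\<psi>n n x - 1) *\<^sub>R f x) powr p \<le> norm (f x) powr p" using p0 by (intro powr_mono2) auto
    qed
  qed (use p fin in \<open>auto simp: pow_integral_def\<close>)
  have fv: "pow_integral p v < \<infinity>"
  proof -
    have "pow_integral p (\<lambda>x. (v x - u x) + u x) \<le> ennreal (2 powr p) * (pow_integral p (\<lambda>x. v x - u x) + pow_integral p u)"
      by (rule pow_integral_add_le[OF p0]) auto
    also have "\<dots> < \<infinity>" using le_less_trans[OF v(2)] fu by (simp add: ennreal_mult_less_top)
    finally show ?thesis by simp
  qed
  have third: "(\<lambda>n. pow_integral p (\<lambda>x. v x *\<^sub>R grad (\<psi>n n) x)) \<longlonglongrightarrow> 0"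
  proof (rule pow_integral_dominated[where W = "\<lambda>x. L powr p * norm (v x) powr p"])
    have b: "norm (v x *\<^sub>R grad (\<psi>n n) x) \<le> inverse (real (Suc n)) * (L * \<bar>v x\<bar>)" for n x
    proof -
      have "norm (v x *\<^sub>R grad (\<psi>n n) x) = inverse (real (Suc n)) * (norm (grad \<psi> (inverse (real (Suc n)) *\<^sub>R x + 0)) * \<bar>v x\<bar>)"
        by (simp add: g\<psi>n abs_mult)
      also have "\<dots> \<le> inverse (real (Suc n)) * (L * \<bar>v x\<bar>)"
        by (intro mult_left_mono mult_right_mono gL) auto
      finally show ?thesis .
    qed
    show "AE x in lborel. (\<lambda>n. v x *\<^sub>R grad (\<psi>n n) x) \<longlonglongrightarrow> 0"
    proof (rule AE_I2, rule Lim_null_comparison[OF always_eventually, rule_format, OF b])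
      fix x show "(\<lambda>n. inverse (real (Suc n)) * (L * \<bar>v x\<bar>)) \<longlonglongrightarrow> 0"
        by (rule tendsto_mult_left_zero[OF LIMSEQ_inverse_real_of_nat])
    qed
    show "AE x in lborel. norm (v x *\<^sub>R grad (\<psi>n n) x) powr p \<le> L powr p * norm (v x) powr p" for n
    proof (rule AE_I2)
      fix x
      have "inverse (real (Suc n)) * (L * \<bar>v x\<bar>) \<le> 1 * (L * \<bar>v x\<bar>)"
        using L by (intro mult_right_mono) (auto simp: field_simps)
      hence "norm (v x *\<^sub>R grad (\<psi>n n) x) powr p \<le> (L * \<bar>v x\<bar>) powr p"
        using b[of x n] p0 by (intro powr_mono2) auto
      thus "norm (v x *\<^sub>R grad (\<psi>n n) x) powr p \<le> L powr p * norm (v x) powr p" by (simp add: powr_mult)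
    qed
    show "(\<integral>\<^sup>+ x. ennreal (L powr p * norm (v x) powr p) \<partial>lborel) < \<infinity>"
      using fv by (simp add: pow_integral_def ennreal_mult nn_integral_cmult ennreal_mult_less_top)
    show "p > 0" using p by simp
  qed measurable
  have ee: "ennreal e' > 0" using e' by simp
  have "\<forall>\<^sub>F n in sequentially. pow_integral p (\<lambda>x. (\<psi>n n x - 1) *\<^sub>R u x) < ennreal e' \<and>
      pow_integral p (\<lambda>x. (\<psi>n n x - 1) *\<^sub>R g x) < ennreal e' \<and> pow_integral p (\<lambda>x. v x *\<^sub>R grad (\<psi>n n) x) < ennreal e'"
    by (intro eventually_conj ennreal_tendsto_0D[OF cut ee] ennreal_tendsto_0D[OF third ee]) (use fu fg in auto)
  then obtain n where n: "pow_integral p (\<lambda>x. (\<psi>n n x - 1) *\<^sub>R u x) < ennreal e'"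
      "pow_integral p (\<lambda>x. (\<psi>n n x - 1) *\<^sub>R g x) < ennreal e'" "pow_integral p (\<lambda>x. v x *\<^sub>R grad (\<psi>n n) x) < ennreal e'"
    by (auto simp: eventually_sequentially)
  have mul: "pow_integral p (\<lambda>x. \<psi>n n x *\<^sub>R f x) \<le> pow_integral p f" for f :: "real^'n \<Rightarrow> 'b::real_normed_vector"
    using rn[of n] by (intro pow_integral_mono p0) (auto intro: mult_left_le_one_le)
  have C2: "C * (C * e' + C * e' + e') = e"
  proof -
    have "C * (C * e' + C * e' + e') = (C * (C * 2 + 1)) * e'" by (simp add: algebra_simps)
    thus ?thesis using C by (simp add: e'_def add_pos_pos)
  qed
  show ?thesis
  proof (intro exI[of _ "\<lambda>x. \<psi>n n x * v x"] conjI t)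
    have "pow_integral p (\<lambda>x. \<psi>n n x * v x - u x) = pow_integral p (\<lambda>x. \<psi>n n x *\<^sub>R (v x - u x) + (\<psi>n n x - 1) *\<^sub>R u x)"
      by (simp add: algebra_simps)
    also have "\<dots> \<le> ennreal C * (pow_integral p (\<lambda>x. \<psi>n n x *\<^sub>R (v x - u x)) + pow_integral p (\<lambda>x. (\<psi>n n x - 1) *\<^sub>R u x))"
      unfolding C_def by (rule pow_integral_add_le[OF p0]) auto
    also have "\<dots> \<le> ennreal C * (ennreal e' + ennreal e')"
      using n(1) by (intro mult_left_mono add_mono order_trans[OF mul v(2)]) auto
    also have "\<dots> = ennreal (C * (e' + e'))" using C e' by (simp only: ennreal_mult ennreal_plus mult_nonneg_nonneg add_nonneg_nonneg less_imp_le)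
    also have "\<dots> \<le> ennreal e"
    proof (rule ennreal_leI)
      have "C \<ge> 1" unfolding C_def using p0 by (intro ge_one_powr_ge_zero) auto
      hence "e' \<le> C * e'" using e' by (simp add: mult_le_cancel_right1)
      hence "C * (e' + e') \<le> C * (C * e' + C * e' + e')" using C e' by (intro mult_left_mono) auto
      thus "C * (e' + e') \<le> e" by (simp only: C2)
    qed
    finally show "pow_integral p (\<lambda>x. \<psi>n n x * v x - u x) \<le> ennreal e" .
    have "pow_integral p (\<lambda>x. grad (\<lambda>x. \<psi>n n x * v x) x - g x)
      = pow_integral p (\<lambda>x. (\<psi>n n x *\<^sub>R (grad v x - g x) + (\<psi>n n x - 1) *\<^sub>R g x) + v x *\<^sub>R grad (\<psi>n n) x)"
      unfolding grad_mult[OF s\<psi>n v(1)] by (simp add: algebra_simps)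
    also have "\<dots> \<le> ennreal C * (pow_integral p (\<lambda>x. \<psi>n n x *\<^sub>R (grad v x - g x) + (\<psi>n n x - 1) *\<^sub>R g x) + pow_integral p (\<lambda>x. v x *\<^sub>R grad (\<psi>n n) x))"
      unfolding C_def by (rule pow_integral_add_le[OF p0]) auto
    also have "pow_integral p (\<lambda>x. \<psi>n n x *\<^sub>R (grad v x - g x) + (\<psi>n n x - 1) *\<^sub>R g x) \<le>
        ennreal C * (pow_integral p (\<lambda>x. \<psi>n n x *\<^sub>R (grad v x - g x)) + pow_integral p (\<lambda>x. (\<psi>n n x - 1) *\<^sub>R g x))"
      unfolding C_def by (rule pow_integral_add_le[OF p0]) auto
    also have "\<dots> \<le> ennreal C * (ennreal e' + ennreal e')"
      using n(2) by (intro mult_left_mono add_mono order_trans[OF mul v(3)]) auto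
    also have "ennreal C * (ennreal C * (ennreal e' + ennreal e') + pow_integral p (\<lambda>x. v x *\<^sub>R grad (\<psi>n n) x))
        \<le> ennreal C * (ennreal C * (ennreal e' + ennreal e') + ennreal e')"
      using n(3) by (intro mult_left_mono add_mono) auto
    also have "\<dots> = ennreal (C * (C * (e' + e') + e'))"
      using C e' by (simp only: ennreal_mult ennreal_plus mult_nonneg_nonneg add_nonneg_nonneg less_imp_le)
    also have "C * (C * (e' + e') + e') = e" using C2 by (simp add: algebra_simps)
    finally show "pow_integral p (\<lambda>x. grad (\<lambda>x. \<psi>n n x * v x) x - g x) \<le> ennreal e"
      by (auto simp: add_mono mult_left_mono)
  qed
qed

text \<open>Approximations with errors \<open>2 ^ (- n)\<close> have an integrable sum of error powers. That sum bounds every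
single error, which yields the majorant, and its finiteness almost everywhere yields pointwise
convergence.\<close>

lemma dominated_test_functions:
  fixes u :: "real ^ 'n \<Rightarrow> real"
  assumes p: "p \<ge> 1" and w: "weak_gradient u g" and fu: "pow_integral p u < \<infinity>" and fg: "pow_integral p g < \<infinity>"
  obtains \<phi> H where "\<And>n::nat. test_function (\<phi> n)" "H \<in> borel_measurable borel" "\<And>x. H x \<ge> 0" "pow_integral p H < \<infinity>"
    "AE x in lborel. (\<lambda>n. \<phi> n x) \<longlonglongrightarrow> u x" "AE x in lborel. (\<lambda>n. grad (\<phi> n) x) \<longlonglongrightarrow> g x"
    "AE x in lborel. \<forall>n. \<bar>\<phi> n x\<bar> \<le> H x" "AE x in lborel. \<forall>n. norm (grad (\<phi> n) x) \<le> H x"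
proof -
  note [measurable] = weak_gradient_measurable[OF w]
  have p0: "p \<ge> 0" using p by simp
  define P where "P n \<phi> \<longleftrightarrow> test_function \<phi> \<and> pow_integral p (\<lambda>x. \<phi> x - u x) \<le> ennreal ((1/2)^n) \<and> pow_integral p (\<lambda>x. grad \<phi> x - g x) \<le> ennreal ((1/2)^n)" for n :: nat and \<phi>
  have "\<forall>n. \<exists>\<phi>. P n \<phi>"
    unfolding P_def by (intro allI test_function_approximation[OF p w fu fg]) simp
  from choice[OF this] obtain \<phi> where "\<forall>n. P n (\<phi> n)" ..
  hence t: "test_function (\<phi> n)" and
    a: "pow_integral p (\<lambda>x. \<phi> n x - u x) \<le> ennreal ((1/2)^n)" "pow_integral p (\<lambda>x. grad (\<phi> n) x - g x) \<le> ennreal ((1/2)^n)" for n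
    unfolding P_def by blast+
  have s: "smooth (\<phi> n)" for n using t by (rule test_function_smooth)
  note [measurable] = smooth_measurable[OF s] smooth_grad_measurable[OF s]
  define d where "d n x = norm (\<phi> n x - u x) powr p + norm (grad (\<phi> n) x - g x) powr p" for n x
  have [measurable]: "d n \<in> borel_measurable borel" for n unfolding d_def by measurable
  have d0: "d n x \<ge> 0" for n x by (simp add: d_def)
  \<comment> \<open>The sum of all error powers; its \<open>p\<close>-th root enters the majorant.\<close>
  define D where "D x = (\<Sum>n. ennreal (d n x))" for x
  have [measurable]: "D \<in> borel_measurable borel" unfolding D_def by measurable
  have dn: "(\<integral>\<^sup>+x. ennreal (d n x) \<partial>lborel) \<le> ennreal (2 * (1/2)^n)" for n
  proof -
    have "(\<integral>\<^sup>+x. ennreal (d n x) \<partial>lborel) = pow_integral p (\<lambda>x. \<phi> n x - u x) + pow_integral p (\<lambda>x. grad (\<phi> n) x - g x)"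
      unfolding d_def pow_integral_def by (simp add: ennreal_plus nn_integral_add)
    also have "\<dots> \<le> ennreal ((1/2)^n) + ennreal ((1/2)^n)" by (intro add_mono a)
    also have "\<dots> = ennreal ((1/2)^n + (1/2)^n)" by (rule ennreal_plus[symmetric]) auto
    finally show ?thesis by (simp only: mult_2)
  qed
  have intD: "(\<integral>\<^sup>+x. D x \<partial>lborel) < \<infinity>"
  proof -
    have "(\<integral>\<^sup>+x. D x \<partial>lborel) = (\<Sum>n. \<integral>\<^sup>+x. ennreal (d n x) \<partial>lborel)"
      unfolding D_def by (rule nn_integral_suminf) measurable
    also have "\<dots> \<le> (\<Sum>n. ennreal (2 * (1/2)^n))" by (intro suminf_le dn) auto
    also have "\<dots> < \<infinity>" by (subst suminf_ennreal2) (auto intro!: summable_mult summable_geometric)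
    finally show ?thesis .
  qed
  have Dfin: "AE x in lborel. D x \<noteq> \<infinity>" by (rule nn_integral_PInf_AE) (use intD in auto)
  define H where "H x = \<bar>u x\<bar> + norm (g x) + enn2real (D x) powr (1 / p)" for x
  have [measurable]: "H \<in> borel_measurable borel" unfolding H_def by measurable
  have dle: "d n x \<le> enn2real (D x)" if "D x \<noteq> \<infinity>" for n x
  proof -
    have "ennreal (d n x) \<le> D x" unfolding D_def using sum_le_suminf[of "\<lambda>n. ennreal (d n x)" "{n}"] by simp
    hence "enn2real (ennreal (d n x)) \<le> enn2real (D x)" using that by (intro enn2real_mono) (auto simp: less_top)
    thus ?thesis using d0 by simp
  qed
  have lim: "(\<lambda>n. d n x) \<longlonglongrightarrow> 0" if "D x \<noteq> \<infinity>" for x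
  proof (rule summable_LIMSEQ_zero, rule summable_suminf_not_top)
    show "(\<Sum>n. ennreal (d n x)) \<noteq> \<top>" using that by (simp add: D_def)
  qed (rule d0)
  have root: "a \<le> b powr (1 / p)" if "a powr p \<le> b" "a \<ge> 0" for a b :: real
  proof -
    have "(a powr p) powr (1 / p) \<le> b powr (1 / p)" using that p by (intro powr_mono2) auto
    thus ?thesis using p that by (simp add: powr_powr)
  qed
  have to0: "(\<lambda>n. y n) \<longlonglongrightarrow> 0" if "(\<lambda>n. z n) \<longlonglongrightarrow> (0::real)" "\<And>n. norm (y n) powr p \<le> z n" for y :: "nat \<Rightarrow> 'b::real_normed_vector" and z
  proof (rule Lim_null_comparison[OF always_eventually])
    show "\<forall>n. norm (y n) \<le> z n powr (1 / p)" using root[OF that(2)] by simp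
    have "z n \<ge> 0" for n using that(2)[of n] powr_ge_zero[of "norm (y n)" p] by linarith
    hence "(\<lambda>n. z n powr (1 / p)) \<longlonglongrightarrow> 0 powr (1 / p)" using p by (intro tendsto_powr2 that(1)) auto
    thus "(\<lambda>n. z n powr (1 / p)) \<longlonglongrightarrow> 0" by simp
  qed
  show ?thesis
  proof (rule that[of \<phi> H])
    show "H x \<ge> 0" for x by (simp add: H_def)
    have "pow_integral p (\<lambda>x. enn2real (D x) powr (1 / p)) < \<infinity>"
    proof -
      have "pow_integral p (\<lambda>x. enn2real (D x) powr (1 / p)) \<le> (\<integral>\<^sup>+x. D x \<partial>lborel)"
        unfolding pow_integral_def using p
        by (intro nn_integral_mono) (simp add: powr_powr ennreal_enn2real_if)
      thus ?thesis using intD by (rule le_less_trans)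
    qed
    note f3 = this
    have f12: "pow_integral p (\<lambda>x. \<bar>u x\<bar> + norm (g x)) < \<infinity>"
    proof -
      have "pow_integral p (\<lambda>x. \<bar>u x\<bar> + norm (g x)) \<le> ennreal (2 powr p) * (pow_integral p (\<lambda>x. \<bar>u x\<bar>) + pow_integral p (\<lambda>x. norm (g x)))"
        by (rule pow_integral_add_le[OF p0]) auto
      also have "\<dots> < \<infinity>" using fu fg by (simp add: pow_integral_def ennreal_mult_less_top)
      finally show ?thesis .
    qed
    have "pow_integral p H \<le> ennreal (2 powr p) * (pow_integral p (\<lambda>x. \<bar>u x\<bar> + norm (g x)) + pow_integral p (\<lambda>x. enn2real (D x) powr (1 / p)))"
      unfolding H_def by (rule pow_integral_add_le[OF p0]) auto
    also have "\<dots> < \<infinity>" using f3 f12 by (simp add: ennreal_mult_less_top)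
    finally show "pow_integral p H < \<infinity>" .
    show "AE x in lborel. (\<lambda>n. \<phi> n x) \<longlonglongrightarrow> u x" using Dfin
    proof eventually_elim
      fix x assume "D x \<noteq> \<infinity>"
      hence "(\<lambda>n. \<phi> n x - u x) \<longlonglongrightarrow> 0" by (intro to0[OF lim]) (auto simp: d_def)
      thus "(\<lambda>n. \<phi> n x) \<longlonglongrightarrow> u x" by (rule LIM_zero_cancel)
    qed
    show "AE x in lborel. (\<lambda>n. grad (\<phi> n) x) \<longlonglongrightarrow> g x" using Dfin
    proof eventually_elim
      fix x assume "D x \<noteq> \<infinity>"
      hence "(\<lambda>n. grad (\<phi> n) x - g x) \<longlonglongrightarrow> 0" by (intro to0[OF lim]) (auto simp: d_def)
      thus "(\<lambda>n. grad (\<phi> n) x) \<longlonglongrightarrow> g x" by (rule LIM_zero_cancel)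
    qed
    show "AE x in lborel. \<forall>n. \<bar>\<phi> n x\<bar> \<le> H x" using Dfin
    proof eventually_elim
      fix x assume x: "D x \<noteq> \<infinity>"
      show "\<forall>n. \<bar>\<phi> n x\<bar> \<le> H x"
      proof
        fix n
        have "norm (\<phi> n x - u x) powr p \<le> d n x" by (simp add: d_def)
        hence "norm (\<phi> n x - u x) \<le> enn2real (D x) powr (1 / p)" by (intro root order_trans[OF _ dle[OF x]]) auto
        thus "\<bar>\<phi> n x\<bar> \<le> H x" unfolding H_def real_norm_def using norm_ge_zero[of "g x"] by linarith
      qed
    qed
    show "AE x in lborel. \<forall>n. norm (grad (\<phi> n) x) \<le> H x" using Dfin
    proof eventually_elim
      fix x assume x: "D x \<noteq> \<infinity>"
      show "\<forall>n. norm (grad (\<phi> n) x) \<le> H x"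
      proof
        fix n
        have "norm (grad (\<phi> n) x - g x) powr p \<le> d n x" by (simp add: d_def)
        hence "norm (grad (\<phi> n) x - g x) \<le> enn2real (D x) powr (1 / p)" by (intro root order_trans[OF _ dle[OF x]]) auto
        thus "norm (grad (\<phi> n) x) \<le> H x" unfolding H_def using norm_triangle_sub[of "grad (\<phi> n) x" "g x"] by simp
      qed
    qed
  qed (use t in auto)
qed

text \<open>All mollifications of such a function vanish, and they converge to it in \<open>L^1\<close> on every ball.\<close>

lemma AE_zero_by_test_functions:
  fixes f :: "'a::euclidean_space \<Rightarrow> real"
  assumes f: "locally_integrable f" and z: "\<And>\<phi>. test_function \<phi> \<Longrightarrow> (LINT x|lborel. f x * \<phi> x) = 0"
  shows "AE x in lborel. f x = 0"
proof -
  have [measurable]: "f \<in> borel_measurable borel" using f by (simp add: locally_integrable_def)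
  have conv0: "mollify \<rho> f x = 0" if \<rho>: "test_function \<rho>" for \<rho> x
  proof -
    obtain R where R: "R > 0" "\<And>x. norm x > R \<Longrightarrow> \<rho> x = 0" using test_function_support[OF \<rho>] by blast
    have "test_function (\<lambda>y. \<rho> ((-1) *\<^sub>R y + x))"
    proof (rule test_functionI[of _ "norm x + R"])
      show "smooth (\<lambda>y. \<rho> ((-1) *\<^sub>R y + x))" by (rule smooth_affine[OF test_function_smooth[OF \<rho>]])
      fix y :: 'a assume "norm y > norm x + R"
      moreover have "norm y \<le> norm x + norm (x - y)" using norm_triangle_sub[of y x] by (simp add: norm_minus_commute)
      ultimately show "\<rho> ((-1) *\<^sub>R y + x) = 0" using R(2)[of "x - y"] by simp
    qed
    from z[OF this] show ?thesis by (simp add: mollify_def mult.commute)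
  qed
  have "AE x in lborel. norm x \<le> real n \<longrightarrow> f x = 0" for n :: nat
  proof -
    define fR where "fR x = indicator (cball 0 (real n + 1)) x * f x" for x
    have [measurable]: "fR \<in> borel_measurable borel" unfolding fR_def by measurable
    have fin: "pow_integral 1 fR < \<infinity>"
      using f by (simp add: pow_integral_def fR_def locally_integrable_def integrable_iff_bounded)
    have "(\<integral>\<^sup>+x. ennreal (\<bar>f x\<bar>) * indicator (cball 0 (real n)) x \<partial>lborel) \<le> ennreal e" if e: "e > 0" for e
    proof -
      obtain \<delta> where \<delta>: "\<delta> > 0" "\<And>\<rho>. test_function \<rho> \<and> (\<forall>x. \<rho> x \<ge> 0) \<and> (\<forall>x. norm x \<ge> \<delta> \<longrightarrow> \<rho> x = 0) \<and> (LINT x|lborel. \<rho> x) = 1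
         \<Longrightarrow> pow_integral 1 (\<lambda>x. mollify \<rho> fR x - fR x) \<le> ennreal e"
        using mollify_approximates[of 1 fR e] fin e by auto
      have "min \<delta> 1 > 0" using \<delta> by simp
      then obtain \<rho> :: "'a \<Rightarrow> real" where \<rho>: "test_function \<rho>" "\<And>x. \<rho> x \<ge> 0" "\<And>x. norm x \<ge> min \<delta> 1 \<Longrightarrow> \<rho> x = 0" "(LINT x|lborel. \<rho> x) = 1"
        using mollifier_exists by blast
      have 1: "pow_integral 1 (\<lambda>x. mollify \<rho> fR x - fR x) \<le> ennreal e" using \<delta>(2)[of \<rho>] \<rho> by auto
      have "mollify \<rho> fR x = 0" if "norm x \<le> real n" for x
      proof -
        have "\<rho> (x - y) * fR y = \<rho> (x - y) * f y" for y
        proof (cases "norm (x - y) \<ge> 1")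
          case False
          hence "norm y \<le> real n + 1" using that norm_triangle_sub[of y x] by (simp add: norm_minus_commute)
          thus ?thesis by (simp add: fR_def)
        qed (simp add: \<rho>(3))
        hence "mollify \<rho> fR x = mollify \<rho> f x" unfolding mollify_def by (simp only:)
        thus ?thesis using conv0[OF \<rho>(1)] by simp
      qed
      hence "(\<integral>\<^sup>+x. ennreal (\<bar>f x\<bar>) * indicator (cball 0 (real n)) x \<partial>lborel) \<le> pow_integral 1 (\<lambda>x. mollify \<rho> fR x - fR x)"
        unfolding pow_integral_def by (intro nn_integral_mono) (auto simp: indicator_def fR_def)
      thus ?thesis using 1 by (rule order_trans)
    qed
    hence "(\<integral>\<^sup>+x. ennreal (\<bar>f x\<bar>) * indicator (cball 0 (real n)) x \<partial>lborel) \<le> 0"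
      by (rule_tac ennreal_le_epsilon) simp
    hence "AE x in lborel. ennreal \<bar>f x\<bar> * indicator (cball 0 (real n)) x = 0"
      by (subst nn_integral_0_iff_AE[symmetric]) auto
    thus ?thesis by (rule eventually_mono) (auto simp: indicator_def split: if_splits)
  qed
  hence "AE x in lborel. \<forall>n::nat. norm x \<le> real n \<longrightarrow> f x = 0" by (subst AE_all_countable) simp
  thus ?thesis by (rule eventually_mono) (metis real_arch_simple)
qed

text \<open>The gradient in the weak equation and the one that witnesses membership in the Sobolev space are given
separately; this identifies them.\<close>

lemma weak_gradient_unique:
  fixes u :: "real ^ 'n \<Rightarrow> real"
  assumes "weak_gradient u g" "weak_gradient u g'"
  shows "AE x in lborel. g x = g' x"
proof -
  have "AE x in lborel. g x $ i - g' x $ i = 0" for i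
  proof (rule AE_zero_by_test_functions)
    have l: "locally_integrable (\<lambda>x. g x $ i)" "locally_integrable (\<lambda>x. g' x $ i)" using assms by (auto simp: weak_gradient_def)
    show "locally_integrable (\<lambda>x. g x $ i - g' x $ i)" using l by (auto simp: locally_integrable_def right_diff_distrib)
    fix \<phi> :: "real^'n \<Rightarrow> real" assume t: "test_function \<phi>"
    obtain R where R: "R > 0" "\<And>x. norm x > R \<Longrightarrow> \<phi> x = 0" using test_function_support[OF t] by blast
    have i: "integrable lborel (\<lambda>x. g x $ i * \<phi> x)" "integrable lborel (\<lambda>x. g' x $ i * \<phi> x)"
      using l[THEN locally_integrable_mult[OF _ test_function_continuous[OF t] R(2)]] by (simp_all add: mult.commute)
    have "(LINT x|lborel. g x $ i * \<phi> x) = (LINT x|lborel. g' x $ i * \<phi> x)"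
    proof -
      have "(LINT x|lborel. u x * grad \<phi> x $ i) = - (LINT x|lborel. g x $ i * \<phi> x)"
        "(LINT x|lborel. u x * grad \<phi> x $ i) = - (LINT x|lborel. g' x $ i * \<phi> x)"
        using assms t unfolding weak_gradient_def by blast+
      thus ?thesis by simp
    qed
    thus "(LINT x|lborel. (g x $ i - g' x $ i) * \<phi> x) = 0" using i by (simp add: left_diff_distrib)
  qed
  hence "AE x in lborel. \<forall>i. g x $ i - g' x $ i = 0" by (simp add: AE_all_countable)
  thus ?thesis by (rule eventually_mono) (simp add: vec_eq_iff)
qed

section \<open>Displacements and level sets\<close>

text \<open>Fatou's lemma for a pointwise limit whose approximants have convergent upper bounds.\<close>

lemma nn_integral_limit_le:
  fixes f :: "nat \<Rightarrow> 'a \<Rightarrow> ennreal"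
  assumes [measurable]: "\<And>n. f n \<in> borel_measurable M"
    and lim: "AE x in M. (\<lambda>n. f n x) \<longlonglongrightarrow> F x" and le: "\<And>n. (\<integral>\<^sup>+x. f n x \<partial>M) \<le> c n" and c: "c \<longlonglongrightarrow> C"
  shows "(\<integral>\<^sup>+x. F x \<partial>M) \<le> C"
proof -
  have "(\<integral>\<^sup>+x. F x \<partial>M) = (\<integral>\<^sup>+x. liminf (\<lambda>n. f n x) \<partial>M)"
    by (rule nn_integral_cong_AE) (use lim in \<open>eventually_elim, simp add: lim_imp_Liminf\<close>)
  also have "\<dots> \<le> liminf (\<lambda>n. \<integral>\<^sup>+x. f n x \<partial>M)" by (rule nn_integral_liminf) simp
  also have "\<dots> \<le> liminf c" by (rule Liminf_mono) (simp add: le)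
  also have "\<dots> = C" by (rule lim_imp_Liminf[OF _ c]) simp
  finally show ?thesis .
qed

text \<open>The fundamental theorem of calculus along the segment from \<open>x\<close> to \<open>\<mu> x + h\<close>, Jensen's inequality on that
segment, and Tonelli. For fixed time the intermediate map is affine with expansion factor at least 1, so
its substitution does not increase the integral. Translations (\<open>\<mu> = 1\<close>) serve the level set estimate,
dilations (\<open>h = 0\<close>) the final argument.\<close>

lemma displacement_smooth:
  fixes v :: "real ^ 'n \<Rightarrow> real"
  assumes p: "p \<ge> 1" and v: "smooth v" and l: "\<mu> \<ge> 1" and [measurable]: "K \<in> sets borel"
    and B: "\<And>x. x \<in> K \<Longrightarrow> norm ((\<mu> - 1) *\<^sub>R x + h) \<le> B" and B0: "B \<ge> 0"
  shows "(\<integral>\<^sup>+x. ennreal (\<bar>v (\<mu> *\<^sub>R x + h) - v x\<bar> powr p) * indicator K x \<partial>lborel) \<le> ennreal (B powr p) * pow_integral p (grad v)"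
proof -
  note [measurable] = smooth_measurable[OF v] smooth_grad_measurable[OF v]
  define I where "I = {0..1::real}"
  define M where "M = density lborel (\<lambda>t. ennreal (indicator I t))"
  interpret M: prob_space M
    by (rule prob_spaceI) (simp add: M_def emeasure_density I_def ennreal_indicator)
  define c where "c t = 1 + t * (\<mu> - 1)" for t
  have pt: "ennreal (\<bar>v (\<mu> *\<^sub>R x + h) - v x\<bar> powr p) * indicator K x
      \<le> (\<integral>\<^sup>+t. indicator I t * (ennreal (B powr p) * ennreal (norm (grad v (c t *\<^sub>R x + t *\<^sub>R h)) powr p)) \<partial>lborel)" for x
  proof (cases "x \<in> K")
    case True
    define w where "w = (\<mu> - 1) *\<^sub>R x + h"
    define k where "k t = grad v (x + t *\<^sub>R w) \<bullet> w" for t :: real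
    have ck: "continuous_on S k" for S unfolding k_def
      by (intro continuous_intros continuous_on_compose2[OF smooth_grad_continuous[OF v]]) auto
    have [measurable]: "k \<in> borel_measurable borel" using ck by (rule borel_measurable_continuous_onI)
    have eqx: "x + t *\<^sub>R w = c t *\<^sub>R x + t *\<^sub>R h" for t by (simp add: w_def c_def algebra_simps)
    have "(LINT t|lborel. indicator {0..1} t *\<^sub>R k t) = v (x + 1 *\<^sub>R w) - v (x + 0 *\<^sub>R w)"
    proof (rule integral_FTC_atLeastAtMost[where F = "\<lambda>t. v (x + t *\<^sub>R w)"])
      fix t :: real
      have "((\<lambda>t. v (x + t *\<^sub>R w)) has_derivative (\<lambda>s. grad v (x + t *\<^sub>R w) \<bullet> (s *\<^sub>R w))) (at t)"
        by (rule has_derivative_compose[OF _ smooth_has_grad[OF v]]) (auto intro!: derivative_eq_intros)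
      thus "((\<lambda>t. v (x + t *\<^sub>R w)) has_vector_derivative k t) (at t within {0..1})"
        by (simp add: has_vector_derivative_def k_def has_derivative_at_withinI)
    qed (use ck in auto)
    also have "v (x + 1 *\<^sub>R w) = v (\<mu> *\<^sub>R x + h)" by (simp add: w_def algebra_simps)
    also have "(LINT t|lborel. indicator {0..1} t *\<^sub>R k t) = M.expectation k"
      unfolding M_def I_def by (subst integral_density) auto
    finally have eq: "M.expectation k = v (\<mu> *\<^sub>R x + h) - v x" by simp
    have "integrable M k" unfolding M_def I_def
      using borel_integrable_compact[of "{0..1}" k] ck by (subst integrable_density) auto
    from M.jensen_powr[OF p this]
    have "ennreal (\<bar>v (\<mu> *\<^sub>R x + h) - v x\<bar> powr p) \<le> (\<integral>\<^sup>+t. ennreal (indicator I t) * ennreal (\<bar>k t\<bar> powr p) \<partial>lborel)"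
      unfolding eq by (subst (asm) M_def, subst (asm) nn_integral_density) (auto simp: I_def)
    also have "\<dots> \<le> (\<integral>\<^sup>+t. indicator I t * (ennreal (B powr p) * ennreal (norm (grad v (c t *\<^sub>R x + t *\<^sub>R h)) powr p)) \<partial>lborel)"
    proof (intro nn_integral_mono)
      fix t
      have "\<bar>k t\<bar> \<le> norm (grad v (c t *\<^sub>R x + t *\<^sub>R h)) * norm w"
        unfolding k_def eqx by (rule Cauchy_Schwarz_ineq2)
      also have "\<dots> \<le> norm (grad v (c t *\<^sub>R x + t *\<^sub>R h)) * B"
        using B[OF True] by (intro mult_left_mono) (auto simp: w_def)
      finally have "\<bar>k t\<bar> powr p \<le> (norm (grad v (c t *\<^sub>R x + t *\<^sub>R h)) * B) powr p"
        using p by (intro powr_mono2) auto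
      also have "\<dots> = B powr p * norm (grad v (c t *\<^sub>R x + t *\<^sub>R h)) powr p" using B0 by (simp add: powr_mult)
      finally show "ennreal (indicator I t) * ennreal (\<bar>k t\<bar> powr p)
          \<le> indicator I t * (ennreal (B powr p) * ennreal (norm (grad v (c t *\<^sub>R x + t *\<^sub>R h)) powr p))"
        by (auto simp: indicator_def ennreal_mult[symmetric] intro!: ennreal_leI)
    qed
    finally show ?thesis using True by simp
  qed simp
  have "(\<integral>\<^sup>+x. ennreal (\<bar>v (\<mu> *\<^sub>R x + h) - v x\<bar> powr p) * indicator K x \<partial>lborel)
    \<le> (\<integral>\<^sup>+x. \<integral>\<^sup>+t. indicator I t * (ennreal (B powr p) * ennreal (norm (grad v (c t *\<^sub>R x + t *\<^sub>R h)) powr p)) \<partial>lborel \<partial>lborel)"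
    by (intro nn_integral_mono pt)
  also have "\<dots> = (\<integral>\<^sup>+t. \<integral>\<^sup>+x. indicator I t * (ennreal (B powr p) * ennreal (norm (grad v (c t *\<^sub>R x + t *\<^sub>R h)) powr p)) \<partial>lborel \<partial>lborel)"
    unfolding c_def I_def by (rule lborel_pair.Fubini') measurable
  also have "\<dots> \<le> (\<integral>\<^sup>+t. indicator I t * (ennreal (B powr p) * pow_integral p (grad v)) \<partial>lborel)"
  proof (intro nn_integral_mono)
    fix t
    show "(\<integral>\<^sup>+x. indicator I t * (ennreal (B powr p) * ennreal (norm (grad v (c t *\<^sub>R x + t *\<^sub>R h)) powr p)) \<partial>lborel)
        \<le> indicator I t * (ennreal (B powr p) * pow_integral p (grad v))"
    proof (cases "t \<in> I")
      case True
      hence ct: "c t \<ge> 1" using l by (simp add: c_def I_def)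
      have "(\<integral>\<^sup>+x. ennreal (norm (grad v (c t *\<^sub>R x + t *\<^sub>R h)) powr p) \<partial>lborel) = ennreal (1 / \<bar>c t\<bar> ^ DIM(real^'n)) * pow_integral p (grad v)"
        unfolding pow_integral_def using ct by (subst nn_integral_affine[symmetric]) auto
      also have "\<dots> \<le> 1 * pow_integral p (grad v)"
        using ct by (intro mult_right_mono) (auto simp: ennreal_le_1 divide_le_eq_1 intro!: one_le_power)
      finally show ?thesis by (simp add: nn_integral_cmult mult_left_mono)
    qed simp
  qed
  also have "\<dots> = ennreal (B powr p) * pow_integral p (grad v)" by (simp add: nn_integral_multc I_def)
  finally show ?thesis .
qed

lemma displacement:
  fixes U :: "real ^ 'n \<Rightarrow> real"
  assumes p: "p \<ge> 1" and t: "\<And>n::nat. smooth (\<phi> n)" and [measurable]: "U \<in> borel_measurable borel" "G \<in> borel_measurable borel" "H \<in> borel_measurable borel"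
    and U: "AE x in lborel. (\<lambda>n. \<phi> n x) \<longlonglongrightarrow> U x" and G: "AE x in lborel. (\<lambda>n. grad (\<phi> n) x) \<longlonglongrightarrow> G x"
    and H: "AE x in lborel. \<forall>n. norm (grad (\<phi> n) x) \<le> H x" and fH: "pow_integral p H < \<infinity>"
    and l: "\<mu> \<ge> 1" and [measurable]: "K \<in> sets borel"
    and B: "\<And>x. x \<in> K \<Longrightarrow> norm ((\<mu> - 1) *\<^sub>R x + h) \<le> B" and B0: "B \<ge> 0"
  shows "(\<integral>\<^sup>+x. ennreal (\<bar>U (\<mu> *\<^sub>R x + h) - U x\<bar> powr p) * indicator K x \<partial>lborel) \<le> ennreal (B powr p) * pow_integral p G"
proof (rule nn_integral_limit_le[where f = "\<lambda>n x. ennreal (\<bar>\<phi> n (\<mu> *\<^sub>R x + h) - \<phi> n x\<bar> powr p) * indicator K x"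
      and c = "\<lambda>n. ennreal (B powr p) * pow_integral p (grad (\<phi> n))"])
  note [measurable] = smooth_measurable[OF t] smooth_grad_measurable[OF t]
  have p0: "p > 0" using p by simp
  show "(\<lambda>x. ennreal (\<bar>\<phi> n (\<mu> *\<^sub>R x + h) - \<phi> n x\<bar> powr p) * indicator K x) \<in> borel_measurable lborel" for n
    by measurable
  show "(\<integral>\<^sup>+x. ennreal (\<bar>\<phi> n (\<mu> *\<^sub>R x + h) - \<phi> n x\<bar> powr p) * indicator K x \<partial>lborel) \<le> ennreal (B powr p) * pow_integral p (grad (\<phi> n))" for n
    by (rule displacement_smooth[OF p t l _ B B0]) auto
  have U': "AE x in lborel. (\<lambda>n. \<phi> n (\<mu> *\<^sub>R x + h)) \<longlonglongrightarrow> U (\<mu> *\<^sub>R x + h)"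
    by (rule AE_affine[OF U]) (use l in auto)
  show "AE x in lborel. (\<lambda>n. ennreal (\<bar>\<phi> n (\<mu> *\<^sub>R x + h) - \<phi> n x\<bar> powr p) * indicator K x)
      \<longlonglongrightarrow> ennreal (\<bar>U (\<mu> *\<^sub>R x + h) - U x\<bar> powr p) * indicator K x"
    using U U'
  proof eventually_elim
    fix x assume "(\<lambda>n. \<phi> n x) \<longlonglongrightarrow> U x" "(\<lambda>n. \<phi> n (\<mu> *\<^sub>R x + h)) \<longlonglongrightarrow> U (\<mu> *\<^sub>R x + h)"
    hence "(\<lambda>n. \<bar>\<phi> n (\<mu> *\<^sub>R x + h) - \<phi> n x\<bar> powr p) \<longlonglongrightarrow> \<bar>U (\<mu> *\<^sub>R x + h) - U x\<bar> powr p"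
      using p0 by (intro tendsto_powr2 tendsto_intros) auto
    thus "(\<lambda>n. ennreal (\<bar>\<phi> n (\<mu> *\<^sub>R x + h) - \<phi> n x\<bar> powr p) * indicator K x)
      \<longlonglongrightarrow> ennreal (\<bar>U (\<mu> *\<^sub>R x + h) - U x\<bar> powr p) * indicator K x"
      by (cases "x \<in> K") (auto intro: tendsto_ennrealI)
  qed
  have "(\<lambda>n. pow_integral p (grad (\<phi> n))) \<longlonglongrightarrow> pow_integral p G"
    unfolding pow_integral_def
  proof (rule nn_integral_dominated_convergence[where w = "\<lambda>x. ennreal (norm (H x) powr p)"])
    show "AE x in lborel. ennreal (norm (grad (\<phi> n) x) powr p) \<le> ennreal (norm (H x) powr p)" for n
      using H
    proof eventually_elim
      fix x assume "\<forall>n. norm (grad (\<phi> n) x) \<le> H x"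
      hence "norm (grad (\<phi> n) x) \<le> norm (H x)" by (metis abs_ge_self order_trans real_norm_def)
      thus "ennreal (norm (grad (\<phi> n) x) powr p) \<le> ennreal (norm (H x) powr p)"
        using p0 by (intro ennreal_leI powr_mono2) auto
    qed
    show "AE x in lborel. (\<lambda>n. ennreal (norm (grad (\<phi> n) x) powr p)) \<longlonglongrightarrow> ennreal (norm (G x) powr p)"
      using G by eventually_elim (use p0 in \<open>auto intro!: tendsto_ennrealI tendsto_powr2 tendsto_norm\<close>)
    show "(\<integral>\<^sup>+x. ennreal (norm (H x) powr p) \<partial>lborel) < \<infinity>" using fH by (simp add: pow_integral_def)
  qed auto
  thus "(\<lambda>n. ennreal (B powr p) * pow_integral p (grad (\<phi> n))) \<longlonglongrightarrow> ennreal (B powr p) * pow_integral p G"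
    by (rule ennreal_tendsto_cmult[rotated]) simp
qed

text \<open>If \<open>V\<close> is nonzero only on \<open>E\<close> and at least \<open>s\<close> on \<open>F\<close>, then for \<open>x\<close> in \<open>F\<close> at least half of a ball of
volume \<open>2 * measure lborel E\<close> consists of \<open>h\<close> with \<open>V (x + h) = 0\<close>, where the difference is at least \<open>s\<close>.
Averaging the translation estimate over that ball bounds the measure of \<open>F\<close>. The exponent \<open>p / N\<close> comes
from expressing the radius of the ball by its volume.\<close>

lemma level_set_estimate:
  fixes V :: "real ^ 'n \<Rightarrow> real"
  assumes p: "p > 0" and [measurable]: "V \<in> borel_measurable borel" "E \<in> sets borel" "F \<in> sets borel"
    and VE: "\<And>x. x \<notin> E \<Longrightarrow> V x = 0" and Efin: "emeasure lborel E < \<infinity>"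
    and VF: "\<And>x. x \<in> F \<Longrightarrow> \<bar>V x\<bar> \<ge> s" and s: "s > 0" and G: "G \<ge> 0"
    and mod: "\<And>h. pow_integral p (\<lambda>x. V (x + h) - V x) \<le> ennreal (norm h powr p * G)"
  shows "measure lborel F * s powr p \<le> 2 * (2 * measure lborel E / unit_ball_vol (real CARD('n))) powr (p / real CARD('n)) * G"
proof -
  define N where "N = real CARD('n)"
  define \<omega> where "\<omega> = unit_ball_vol N"
  have N: "N > 0" and \<omega>: "\<omega> > 0" by (auto simp: N_def \<omega>_def)
  define m where "m = measure lborel E"
  have Em: "emeasure lborel E = ennreal m" using Efin by (simp add: m_def emeasure_eq_ennreal_measure)
  have FE: "F \<subseteq> E" using VE VF s by force
  have Ffin: "emeasure lborel F = ennreal (measure lborel F)"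
  proof (rule emeasure_eq_ennreal_measure)
    have "emeasure lborel F < \<infinity>" by (rule le_less_trans[OF emeasure_mono[OF FE] Efin]) simp
    thus "emeasure lborel F \<noteq> \<top>" by simp
  qed
  have Fm: "measure lborel F \<le> m"
    using emeasure_mono[OF FE, of lborel] unfolding Ffin Em by (simp add: m_def)
  show ?thesis
  proof (cases "m = 0")
    case True
    hence "measure lborel F = 0" using Fm measure_nonneg[of lborel F] by linarith
    thus ?thesis using G by simp
  next
    case False
    hence m: "m > 0" by (simp add: m_def order_less_le)
    \<comment> \<open>The radius of a ball with twice the volume of \<open>E\<close>.\<close>
    define r where "r = (2 * m / \<omega>) powr (1 / N)"
    have r: "r > 0" using m \<omega> by (simp add: r_def)
    have rN: "\<omega> * r ^ CARD('n) = 2 * m"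
      using m \<omega> N r by (simp add: powr_realpow[symmetric] r_def powr_powr N_def)
    have Br: "emeasure lborel (cball (0::real^'n) r) = ennreal (2 * m)"
      using r by (simp add: emeasure_cball rN[symmetric] \<omega>_def N_def)
    let ?B = "cball (0::real^'n) r"
    have "(\<integral>\<^sup>+x. \<integral>\<^sup>+h. indicator ?B h * ennreal (\<bar>V (x + h) - V x\<bar> powr p) \<partial>lborel \<partial>lborel)
       = (\<integral>\<^sup>+h. \<integral>\<^sup>+x. indicator ?B h * ennreal (\<bar>V (x + h) - V x\<bar> powr p) \<partial>lborel \<partial>lborel)"
      by (rule lborel_pair.Fubini') measurable
    also have "\<dots> = (\<integral>\<^sup>+h. indicator ?B h * pow_integral p (\<lambda>x. V (x + h) - V x) \<partial>lborel)"
      by (simp add: nn_integral_cmult pow_integral_def)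
    also have "\<dots> \<le> (\<integral>\<^sup>+h. ennreal (r powr p * G) * indicator ?B h \<partial>lborel)"
    proof (intro nn_integral_mono)
      fix h :: "real^'n"
      show "indicator ?B h * pow_integral p (\<lambda>x. V (x + h) - V x) \<le> ennreal (r powr p * G) * indicator ?B h"
      proof (cases "h \<in> ?B")
        case True
        have "pow_integral p (\<lambda>x. V (x + h) - V x) \<le> ennreal (norm h powr p * G)" by (rule mod)
        also have "\<dots> \<le> ennreal (r powr p * G)"
          using True p G by (intro ennreal_leI mult_right_mono powr_mono2) auto
        finally show ?thesis using True by simp
      qed simp
    qed
    also have "\<dots> = ennreal (r powr p * G) * ennreal (2 * m)" by (simp add: nn_integral_cmult_indicator Br)
    also have "\<dots> = ennreal (r powr p * G * (2 * m))" using G m by (simp add: ennreal_mult'')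
    finally have up: "(\<integral>\<^sup>+x. \<integral>\<^sup>+h. indicator ?B h * ennreal (\<bar>V (x + h) - V x\<bar> powr p) \<partial>lborel \<partial>lborel) \<le> ennreal (r powr p * G * (2 * m))" .
    have low: "ennreal (s powr p * m) * indicator F x \<le> (\<integral>\<^sup>+h. indicator ?B h * ennreal (\<bar>V (x + h) - V x\<bar> powr p) \<partial>lborel)" for x
    proof (cases "x \<in> F")
      case True
      let ?A = "{h. x + h \<in> E}"
      have [measurable]: "?A \<in> sets borel" by measurable
      have "emeasure lborel ?A = (\<integral>\<^sup>+h. indicator ?A h \<partial>lborel)" by (rule nn_integral_indicator[symmetric]) simp
      also have "\<dots> = (\<integral>\<^sup>+h. indicator E (1 *\<^sub>R h + x) \<partial>lborel)"
        by (intro nn_integral_cong) (simp add: indicator_def add.commute)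
      also have "\<dots> = ennreal m" by (subst nn_integral_affine) (auto simp: Em)
      finally have A: "emeasure lborel ?A = ennreal m" .
      have "ennreal (2 * m) = emeasure lborel ?B" by (simp add: Br)
      also have "\<dots> \<le> emeasure lborel (?A \<union> (?B - ?A))" by (rule emeasure_mono) auto
      also have "\<dots> \<le> emeasure lborel ?A + emeasure lborel (?B - ?A)" by (rule emeasure_subadditive) auto
      also have "ennreal (2 * m) = ennreal m + ennreal m" using m by (subst ennreal_plus[symmetric]) auto
      finally have BA: "ennreal m \<le> emeasure lborel (?B - ?A)"
        unfolding A ennreal_add_left_cancel_le by simp
      have "ennreal (s powr p * m) = ennreal (s powr p) * ennreal m" using m by (simp add: ennreal_mult')
      also have "\<dots> \<le> ennreal (s powr p) * emeasure lborel (?B - ?A)" by (intro mult_left_mono BA) auto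
      also have "\<dots> = (\<integral>\<^sup>+h. ennreal (s powr p) * indicator (?B - ?A) h \<partial>lborel)"
        by (rule nn_integral_cmult_indicator[symmetric]) auto
      also have "\<dots> \<le> (\<integral>\<^sup>+h. indicator ?B h * ennreal (\<bar>V (x + h) - V x\<bar> powr p) \<partial>lborel)"
      proof (intro nn_integral_mono)
        fix h
        have "s powr p \<le> \<bar>V x\<bar> powr p" using VF[OF True] s p by (intro powr_mono2) auto
        thus "ennreal (s powr p) * indicator (?B - ?A) h \<le> indicator ?B h * ennreal (\<bar>V (x + h) - V x\<bar> powr p)"
          using VE[of "x + h"] by (auto simp: indicator_def intro!: ennreal_leI)
      qed
      finally show ?thesis using True by simp
    qed simp
    have "ennreal (s powr p * m * measure lborel F) = (\<integral>\<^sup>+x. ennreal (s powr p * m) * indicator F x \<partial>lborel)"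
      using m by (simp add: nn_integral_cmult_indicator Ffin ennreal_mult)
    also have "\<dots> \<le> (\<integral>\<^sup>+x. \<integral>\<^sup>+h. indicator ?B h * ennreal (\<bar>V (x + h) - V x\<bar> powr p) \<partial>lborel \<partial>lborel)"
      by (intro nn_integral_mono low)
    also note up
    finally have "s powr p * m * measure lborel F \<le> r powr p * G * (2 * m)"
      using m G by (subst (asm) ennreal_le_iff) auto
    hence "m * (measure lborel F * s powr p) \<le> m * (2 * r powr p * G)" by (simp add: mult_ac)
    hence "measure lborel F * s powr p \<le> 2 * r powr p * G" using m by simp
    also have "r powr p = (2 * m / \<omega>) powr (p / N)" by (simp add: r_def powr_powr)
    finally show ?thesis by (simp add: m_def \<omega>_def N_def)
  qed
qed

section \<open>The Sobolev embedding by slicing the range\<close>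

text \<open>The estimates below use only these properties of the slicing function; its derivative and the bound \<open>C\<close>
are parameters because they enter the energies.\<close>

definition slice_fn :: "(real \<Rightarrow> real) \<Rightarrow> (real \<Rightarrow> real) \<Rightarrow> real \<Rightarrow> bool" where
  "slice_fn T T' C \<longleftrightarrow> C > 0 \<and> smooth T \<and> continuous_on UNIV T' \<and> (\<forall>s. (T has_real_derivative T' s) (at s)) \<and>
     (\<forall>s. \<bar>s\<bar> \<le> 1 \<longrightarrow> T s = 0 \<and> T' s = 0) \<and> (\<forall>s. \<bar>s\<bar> \<ge> 2 \<longrightarrow> \<bar>T s\<bar> = 1 \<and> T' s = 0) \<and>
     (\<forall>s. 0 \<le> T' s \<and> T' s \<le> C \<and> \<bar>T s\<bar> \<le> 1 \<and> 0 \<le> s * T s)"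

text \<open>On the dyadic layer \<open>2 ^ k < \<bar>u\<bar> \<le> 2 ^ (k + 1)\<close> the power is at most its value at the upper end.\<close>

lemma layer_sum:
  fixes u :: "'a::euclidean_space \<Rightarrow> real"
  assumes s: "s \<ge> 0" and [measurable]: "u \<in> borel_measurable borel"
  shows "(\<integral>\<^sup>+x. ennreal (\<bar>u x\<bar> powr s) * indicator {x. 2 ^ j < \<bar>u x\<bar>} x \<partial>lborel)
      \<le> (\<Sum>i. ennreal (2 powr (real (i + j + 1) * s)) * emeasure lborel {x. 2 ^ (i + j) < \<bar>u x\<bar>})"
proof -
  have [measurable]: "{x. 2 ^ k < \<bar>u x\<bar>} \<in> sets borel" for k :: nat by measurable
  have pt: "ennreal (\<bar>u x\<bar> powr s) * indicator {x. 2 ^ j < \<bar>u x\<bar>} x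
      \<le> (\<Sum>i. ennreal (2 powr (real (i + j + 1) * s)) * indicator {x. 2 ^ (i + j) < \<bar>u x\<bar>} x)" for x
  proof (cases "2 ^ j < \<bar>u x\<bar>")
    case True
    define i where "i = (LEAST i. \<bar>u x\<bar> \<le> 2 ^ (i + j + 1))"
    obtain n where n: "\<bar>u x\<bar> < 2 ^ n" using real_arch_pow[of 2 "\<bar>u x\<bar>"] by auto
    have "(2::real) ^ n \<le> 2 ^ (n + j + 1)" by (rule power_increasing) auto
    hence "\<bar>u x\<bar> \<le> 2 ^ (n + j + 1)" using n by linarith
    hence i1: "\<bar>u x\<bar> \<le> 2 ^ (i + j + 1)" unfolding i_def by (rule LeastI)
    have i2: "2 ^ (i + j) < \<bar>u x\<bar>"
    proof (cases i)
      case 0 thus ?thesis using True by simp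
    next
      case (Suc k)
      have "\<not> \<bar>u x\<bar> \<le> 2 ^ (k + j + 1)" using not_less_Least[of k "\<lambda>i. \<bar>u x\<bar> \<le> 2 ^ (i + j + 1)"] Suc i_def by auto
      thus ?thesis using Suc by simp
    qed
    have "\<bar>u x\<bar> powr s \<le> (2 ^ (i + j + 1)) powr s" using s i1 by (intro powr_mono2) auto
    also have "\<dots> = 2 powr (real (i + j + 1) * s)" by (simp only: powr_powr powr_realpow[symmetric] zero_less_numeral)
    finally have "ennreal (\<bar>u x\<bar> powr s) \<le> ennreal (2 powr (real (i + j + 1) * s)) * indicator {x. 2 ^ (i + j) < \<bar>u x\<bar>} x"
      using i2 by (simp add: ennreal_leI)
    also have "\<dots> \<le> (\<Sum>i. ennreal (2 powr (real (i + j + 1) * s)) * indicator {x. 2 ^ (i + j) < \<bar>u x\<bar>} x)"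
    proof -
      have "sum f {i} \<le> suminf f" for f :: "nat \<Rightarrow> ennreal" by (rule sum_le_suminf) auto
      hence "f i \<le> suminf f" for f :: "nat \<Rightarrow> ennreal" by simp
      thus ?thesis .
    qed
    finally show ?thesis using True by simp
  qed simp
  have "(\<integral>\<^sup>+x. ennreal (\<bar>u x\<bar> powr s) * indicator {x. 2 ^ j < \<bar>u x\<bar>} x \<partial>lborel)
    \<le> (\<integral>\<^sup>+x. (\<Sum>i. ennreal (2 powr (real (i + j + 1) * s)) * indicator {x. 2 ^ (i + j) < \<bar>u x\<bar>} x) \<partial>lborel)"
    by (intro nn_integral_mono pt)
  also have "\<dots> = (\<Sum>i. \<integral>\<^sup>+x. ennreal (2 powr (real (i + j + 1) * s)) * indicator {x. 2 ^ (i + j) < \<bar>u x\<bar>} x \<partial>lborel)"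
    by (rule nn_integral_suminf) measurable
  also have "\<dots> = (\<Sum>i. ennreal (2 powr (real (i + j + 1) * s)) * emeasure lborel {x. 2 ^ (i + j) < \<bar>u x\<bar>})"
    by (intro suminf_cong nn_integral_cmult_indicator) auto
  finally show ?thesis .
qed

text \<open>The dimension is carried as a real number \<open>N\<close>, since it occurs mostly in exponents.\<close>

locale sobolev_function =
  fixes p N :: real and u :: "real ^ 'n \<Rightarrow> real" and g :: "real ^ 'n \<Rightarrow> real ^ 'n"
  assumes N: "N = real CARD('n)" and p1: "1 < p" and pN: "p < N" and wg: "weak_gradient u g"
    and fu: "pow_integral p u < \<infinity>" and fg: "pow_integral p g < \<infinity>"
begin

abbreviation "pc \<equiv> N * p / (N - p)"
abbreviation "\<theta> \<equiv> p / N"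

definition level :: "nat \<Rightarrow> (real ^ 'n) set" where "level j = {x. 2 ^ j < \<bar>u x\<bar>}"

text \<open>The contribution of the level \<open>2 ^ j\<close> to the critical power integral. In these variables the recursion of
\<open>level_step\<close> no longer contains powers of 2, which expresses the scaling invariance of the critical
exponent.\<close>

definition level_weight :: "nat \<Rightarrow> real" where "level_weight j = 2 powr (real j * pc) * measure lborel (level j)"

definition step_const :: real where "step_const = 2 powr pc * (2 * (2 / unit_ball_vol N) powr \<theta>)"

lemma meas [measurable]: "u \<in> borel_measurable borel" "g \<in> borel_measurable borel"
  using weak_gradient_measurable[OF wg] by auto

lemma level_borel [measurable]: "level j \<in> sets borel"
  unfolding level_def by measurable

lemma pc_gt: "pc > p" and pc_\<theta>: "pc * \<theta> = pc - p" and \<theta>: "0 < \<theta>" "\<theta> < 1"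
  using p1 pN by (auto simp: field_simps)

lemma step_const_pos: "step_const > 0"
proof -
  have "unit_ball_vol N > 0" by (rule unit_ball_vol_pos) (simp add: N)
  thus ?thesis by (simp add: step_const_def)
qed

lemma emeasure_level: "emeasure lborel (level j) = ennreal (measure lborel (level j))"
proof (rule emeasure_eq_ennreal_measure)
  have "emeasure lborel (level j) = (\<integral>\<^sup>+x. indicator (level j) x \<partial>lborel)" by simp
  also have "\<dots> \<le> pow_integral p u" unfolding pow_integral_def
  proof (intro nn_integral_mono)
    fix x
    show "indicator (level j) x \<le> ennreal (norm (u x) powr p)"
    proof (cases "x \<in> level j")
      case True
      have "1 \<le> (2::real) ^ j" by simp
      moreover have "2 ^ j < \<bar>u x\<bar>" using True by (simp add: level_def)
      ultimately have "1 \<le> \<bar>u x\<bar>" by linarith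
      hence "1 \<le> norm (u x) powr p" using p1 by (auto intro!: ge_one_powr_ge_zero)
      thus ?thesis using True by simp
    qed simp
  qed
  finally show "emeasure lborel (level j) \<noteq> \<top>" using fu by (auto simp: top_unique)
qed

lemma level_weight_nonneg: "level_weight j \<ge> 0" by (simp add: level_weight_def)

text \<open>Below height 1 the \<open>q\<close>-th power is dominated by the \<open>p\<close>-th; above it the layers are summed.\<close>

lemma summable_levels_imp_pow_integral:
  assumes q: "q \<ge> p" and sum: "summable (\<lambda>i. 2 powr (real i * q) * measure lborel (level i))"
  shows "pow_integral q u < \<infinity>"
proof -
  have q0: "q \<ge> 0" using q p1 by simp
  have "pow_integral q u \<le> (\<integral>\<^sup>+x. ennreal (\<bar>u x\<bar> powr p) + ennreal (\<bar>u x\<bar> powr q) * indicator {x. 2 ^ 0 < \<bar>u x\<bar>} x \<partial>lborel)"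
    unfolding pow_integral_def
  proof (intro nn_integral_mono)
    fix x
    show "ennreal (norm (u x) powr q) \<le> ennreal (\<bar>u x\<bar> powr p) + ennreal (\<bar>u x\<bar> powr q) * indicator {x. 2 ^ 0 < \<bar>u x\<bar>} x"
    proof (cases "1 < \<bar>u x\<bar>")
      case False
      hence "\<bar>u x\<bar> powr q \<le> \<bar>u x\<bar> powr p" using q by (intro powr_mono') auto
      thus ?thesis using False by (simp add: ennreal_leI)
    qed simp
  qed
  also have "\<dots> = pow_integral p u + (\<integral>\<^sup>+x. ennreal (\<bar>u x\<bar> powr q) * indicator {x. 2 ^ 0 < \<bar>u x\<bar>} x \<partial>lborel)"
    unfolding pow_integral_def by (subst nn_integral_add) auto
  also have "\<dots> \<le> pow_integral p u + (\<Sum>i. ennreal (2 powr (real (i + 0 + 1) * q)) * emeasure lborel {x. 2 ^ (i + 0) < \<bar>u x\<bar>})"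
    by (intro add_mono order_refl layer_sum q0) measurable
  also have "(\<Sum>i. ennreal (2 powr (real (i + 0 + 1) * q)) * emeasure lborel {x. 2 ^ (i + 0) < \<bar>u x\<bar>})
      = (\<Sum>i. ennreal (2 powr q * (2 powr (real i * q) * measure lborel (level i))))"
  proof (intro suminf_cong)
    fix i
    have "2 powr (real (i + 0 + 1) * q) = 2 powr q * 2 powr (real i * q)" by (simp add: powr_add[symmetric] algebra_simps)
    thus "ennreal (2 powr (real (i + 0 + 1) * q)) * emeasure lborel {x. 2 ^ (i + 0) < \<bar>u x\<bar>}
        = ennreal (2 powr q * (2 powr (real i * q) * measure lborel (level i)))"
      using emeasure_level[of i] by (simp add: level_def ennreal_mult mult.assoc)
  qed
  also have "pow_integral p u + \<dots> < \<infinity>"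
    using fu summable_mult[OF sum, of "2 powr q"] by (subst suminf_ennreal2) auto
  finally show ?thesis .
qed

text \<open>One fixed dominated sequence of test functions, shared by all limit passages for \<open>u\<close>.\<close>

definition approximation :: "(nat \<Rightarrow> real ^ 'n \<Rightarrow> real) \<times> (real ^ 'n \<Rightarrow> real)" where
  "approximation = (SOME (\<phi>, H). (\<forall>n. test_function (\<phi> n)) \<and> H \<in> borel_measurable borel \<and> (\<forall>x. H x \<ge> 0) \<and> pow_integral p H < \<infinity> \<and>
    (AE x in lborel. (\<lambda>n. \<phi> n x) \<longlonglongrightarrow> u x) \<and> (AE x in lborel. (\<lambda>n. grad (\<phi> n) x) \<longlonglongrightarrow> g x) \<and>
    (AE x in lborel. \<forall>n. \<bar>\<phi> n x\<bar> \<le> H x) \<and> (AE x in lborel. \<forall>n. norm (grad (\<phi> n) x) \<le> H x))"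

definition approx :: "nat \<Rightarrow> real ^ 'n \<Rightarrow> real" where "approx = fst approximation"

definition majorant :: "real ^ 'n \<Rightarrow> real" where "majorant = snd approximation"

lemma approx_test: "test_function (approx n)"
  and majorant_meas [measurable]: "majorant \<in> borel_measurable borel"
  and majorant_nonneg: "majorant x \<ge> 0"
  and majorant_finite: "pow_integral p majorant < \<infinity>"
  and approx_tendsto: "AE x in lborel. (\<lambda>n. approx n x) \<longlonglongrightarrow> u x"
  and grad_approx_tendsto: "AE x in lborel. (\<lambda>n. grad (approx n) x) \<longlonglongrightarrow> g x"
  and approx_le: "AE x in lborel. \<forall>n. \<bar>approx n x\<bar> \<le> majorant x"
  and grad_approx_le: "AE x in lborel. \<forall>n. norm (grad (approx n) x) \<le> majorant x"
proof -
  define P where "P \<phi> H \<longleftrightarrow> (\<forall>n. test_function (\<phi> n)) \<and> H \<in> borel_measurable borel \<and> (\<forall>x. H x \<ge> 0) \<and> pow_integral p H < \<infinity> \<and>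
    (AE x in lborel. (\<lambda>n. \<phi> n x) \<longlonglongrightarrow> u x) \<and> (AE x in lborel. (\<lambda>n. grad (\<phi> n) x) \<longlonglongrightarrow> g x) \<and>
    (AE x in lborel. \<forall>n. \<bar>\<phi> n x\<bar> \<le> H x) \<and> (AE x in lborel. \<forall>n. norm (grad (\<phi> n) x) \<le> H x)" for \<phi> :: "nat \<Rightarrow> real ^ 'n \<Rightarrow> real" and H
  have pge: "p \<ge> 1" using p1 by simp
  obtain \<phi> H where "P \<phi> H"
    by (rule dominated_test_functions[OF pge wg fu fg], rule that) (unfold P_def, intro conjI allI; assumption)
  hence "\<exists>z. case z of (\<phi>, H) \<Rightarrow> P \<phi> H" by (intro exI[of _ "(\<phi>, H)"]) simp
  hence "case (SOME (\<phi>, H). P \<phi> H) of (\<phi>, H) \<Rightarrow> P \<phi> H" by (rule someI_ex)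
  hence "P approx majorant" by (simp add: approx_def majorant_def approximation_def P_def case_prod_beta)
  thus "test_function (approx n)" "majorant \<in> borel_measurable borel" "majorant x \<ge> 0" "pow_integral p majorant < \<infinity>"
    "AE x in lborel. (\<lambda>n. approx n x) \<longlonglongrightarrow> u x" "AE x in lborel. (\<lambda>n. grad (approx n) x) \<longlonglongrightarrow> g x"
    "AE x in lborel. \<forall>n. \<bar>approx n x\<bar> \<le> majorant x" "AE x in lborel. \<forall>n. norm (grad (approx n) x) \<le> majorant x"
    unfolding P_def by blast+
qed

lemma slice_properties:
  assumes T: "slice_fn T T' C"
  shows "smooth (\<lambda>s. 2 ^ j * T (s / 2 ^ j))" "((\<lambda>s. 2 ^ j * T (s / 2 ^ j)) has_real_derivative T' (s / 2 ^ j)) (at s)"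
proof -
  have "smooth (\<lambda>s. T (inverse (2 ^ j) * s + 0))" using T by (intro smooth_affine_real) (simp add: slice_fn_def)
  thus "smooth (\<lambda>s. 2 ^ j * T (s / 2 ^ j))" by (intro smooth_mult smooth_const) (simp add: field_simps)
  have "((\<lambda>s. T (s / 2 ^ j)) has_real_derivative T' (s / 2 ^ j) * (1 / 2 ^ j)) (at s)"
    by (rule DERIV_chain2[of T]) (use T in \<open>auto simp: slice_fn_def intro!: derivative_eq_intros\<close>)
  from DERIV_cmult[OF this, of "2 ^ j"] show "((\<lambda>s. 2 ^ j * T (s / 2 ^ j)) has_real_derivative T' (s / 2 ^ j)) (at s)"
    by simp
qed

text \<open>Slices vanish near zero, so a slice of a test function is again a test function.\<close>

lemma slice_approximation:
  assumes T: "slice_fn T T' C" and \<phi>: "test_function \<phi>"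
  shows "test_function (\<lambda>x. 2 ^ j * T (\<phi> x / 2 ^ j))"
    and "grad (\<lambda>x. 2 ^ j * T (\<phi> x / 2 ^ j)) x = T' (\<phi> x / 2 ^ j) *\<^sub>R grad \<phi> x"
proof -
  have sm: "smooth \<phi>" using \<phi> by (rule test_function_smooth)
  obtain R where R: "R > 0" "\<And>x. norm x > R \<Longrightarrow> \<phi> x = 0" using test_function_support[OF \<phi>] by blast
  have T0: "T 0 = 0" using T by (simp add: slice_fn_def)
  show "test_function (\<lambda>x. 2 ^ j * T (\<phi> x / 2 ^ j))"
    by (rule test_functionI[OF smooth_compose[OF slice_properties(1)[OF T] sm], of R]) (simp add: R T0)
  show "grad (\<lambda>x. 2 ^ j * T (\<phi> x / 2 ^ j)) x = T' (\<phi> x / 2 ^ j) *\<^sub>R grad \<phi> x"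
    by (rule grad_compose[OF slice_properties(2)[OF T] sm])
qed

lemma slice_tendsto:
  assumes T: "slice_fn T T' C"
  shows "AE x in lborel. (\<lambda>n. 2 ^ j * T (approx n x / 2 ^ j)) \<longlonglongrightarrow> 2 ^ j * T (u x / 2 ^ j)"
    and "AE x in lborel. (\<lambda>n. grad (\<lambda>x. 2 ^ j * T (approx n x / 2 ^ j)) x) \<longlonglongrightarrow> T' (u x / 2 ^ j) *\<^sub>R g x"
    and "AE x in lborel. \<forall>n. norm (grad (\<lambda>x. 2 ^ j * T (approx n x / 2 ^ j)) x) \<le> C * majorant x"
proof -
  have cT: "continuous_on UNIV T" "continuous_on UNIV T'" and b: "\<And>s. 0 \<le> T' s \<and> T' s \<le> C"
    using T smooth_continuous by (auto simp: slice_fn_def)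
  note grad_slice = slice_approximation(2)[OF T approx_test]
  have scaled: "(\<lambda>n. F (approx n x / 2 ^ j)) \<longlonglongrightarrow> F (u x / 2 ^ j)"
    if "(\<lambda>n. approx n x) \<longlonglongrightarrow> u x" "continuous_on UNIV F" for F :: "real \<Rightarrow> real" and x
    by (rule continuous_on_tendsto_compose[OF that(2) tendsto_divide[OF that(1) tendsto_const]]) auto
  show "AE x in lborel. (\<lambda>n. 2 ^ j * T (approx n x / 2 ^ j)) \<longlonglongrightarrow> 2 ^ j * T (u x / 2 ^ j)"
    using approx_tendsto by eventually_elim (intro tendsto_intros scaled cT)
  show "AE x in lborel. (\<lambda>n. grad (\<lambda>x. 2 ^ j * T (approx n x / 2 ^ j)) x) \<longlonglongrightarrow> T' (u x / 2 ^ j) *\<^sub>R g x"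
    unfolding grad_slice using approx_tendsto grad_approx_tendsto by eventually_elim (intro tendsto_scaleR scaled cT)
  show "AE x in lborel. \<forall>n. norm (grad (\<lambda>x. 2 ^ j * T (approx n x / 2 ^ j)) x) \<le> C * majorant x"
    unfolding grad_slice norm_scaleR using grad_approx_le
  proof eventually_elim
    fix x assume *: "\<forall>n. norm (grad (approx n) x) \<le> majorant x"
    have "\<bar>T' (approx n x / 2 ^ j)\<bar> * norm (grad (approx n) x) \<le> C * majorant x" for n
      using * b[of "approx n x / 2 ^ j"] order_trans[OF conjunct1[OF b] conjunct2[OF b]] by (intro mult_mono) auto
    thus "\<forall>n. \<bar>T' (approx n x / 2 ^ j)\<bar> * norm (grad (approx n) x) \<le> C * majorant x" by blast
  qed
qed

lemma slice_energy_integrable: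
  assumes T: "slice_fn T T' C"
  shows "integrable lborel (\<lambda>x. (T' (u x / 2 ^ j) * norm (g x)) powr p)"
    and "pow_integral p (\<lambda>x. T' (u x / 2 ^ j) *\<^sub>R g x) = ennreal (LINT x|lborel. (T' (u x / 2 ^ j) * norm (g x)) powr p)"
proof -
  have cT: "continuous_on UNIV T'" and b: "\<And>s. 0 \<le> T' s \<and> T' s \<le> C" and C: "C > 0" using T by (auto simp: slice_fn_def)
  have [measurable]: "T' \<in> borel_measurable borel" using cT by (rule borel_measurable_continuous_onI)
  have ig: "integrable lborel (\<lambda>x. C powr p * norm (g x) powr p)"
    using fg pow_integral_finite_iff[of g p] by simp
  show i: "integrable lborel (\<lambda>x. (T' (u x / 2 ^ j) * norm (g x)) powr p)"
  proof (rule Bochner_Integration.integrable_bound[OF ig])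
    show "AE x in lborel. norm ((T' (u x / 2 ^ j) * norm (g x)) powr p) \<le> norm (C powr p * norm (g x) powr p)"
    proof (rule AE_I2)
      fix x
      have "(T' (u x / 2 ^ j) * norm (g x)) powr p \<le> (C * norm (g x)) powr p"
        using b p1 by (intro powr_mono2 mult_right_mono) auto
      thus "norm ((T' (u x / 2 ^ j) * norm (g x)) powr p) \<le> norm (C powr p * norm (g x) powr p)"
        using C by (simp add: powr_mult)
    qed
  qed measurable
  show "pow_integral p (\<lambda>x. T' (u x / 2 ^ j) *\<^sub>R g x) = ennreal (LINT x|lborel. (T' (u x / 2 ^ j) * norm (g x)) powr p)"
    unfolding pow_integral_def using b by (subst nn_integral_eq_integral[OF i, symmetric]) auto
qed

text \<open>The slice at height \<open>2 ^ j\<close> is supported in the level \<open>j\<close> and has modulus \<open>2 ^ j\<close> on the level \<open>j + 1\<close>;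
\<open>level_set_estimate\<close> applies to it.\<close>

lemma level_step_measure:
  assumes T: "slice_fn T T' C"
  shows "measure lborel (level (Suc j)) * (2 ^ j) powr p
    \<le> 2 * (2 * measure lborel (level j) / unit_ball_vol N) powr \<theta>
        * (LINT x|lborel. (T' (u x / 2 ^ j) * norm (g x)) powr p)"
proof -
  have pge: "p \<ge> 1" using p1 by simp
  have cT: "continuous_on UNIV T'" and b: "\<And>s. 0 \<le> T' s \<and> T' s \<le> C" and C: "C > 0" 
    and sT: "smooth T" and T0: "\<And>s. \<bar>s\<bar> \<le> 1 \<Longrightarrow> T s = 0" and T2: "\<And>s. \<bar>s\<bar> \<ge> 2 \<Longrightarrow> \<bar>T s\<bar> = 1"
    using T by (auto simp: slice_fn_def)
  have [measurable]: "T' \<in> borel_measurable borel" using cT by (rule borel_measurable_continuous_onI)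
  have [measurable]: "T \<in> borel_measurable borel" using sT by (rule smooth_measurable)
  let ?V = "\<lambda>x. 2 ^ j * T (u x / 2 ^ j)"
  let ?G = "\<lambda>x. T' (u x / 2 ^ j) *\<^sub>R g x"
  show ?thesis
    unfolding N
  proof (rule level_set_estimate[where V = ?V])
    fix h
    have "pow_integral p (\<lambda>x. ?V (x + h) - ?V x) = (\<integral>\<^sup>+x. ennreal (\<bar>?V (1 *\<^sub>R x + h) - ?V x\<bar> powr p) * indicator UNIV x \<partial>lborel)"
      by (simp add: pow_integral_def)
    also have "\<dots> \<le> ennreal (norm h powr p) * pow_integral p ?G"
    proof (rule displacement[where \<phi> = "\<lambda>n x. 2 ^ j * T (approx n x / 2 ^ j)" and H = "\<lambda>x. C * majorant x"])
      show "smooth (\<lambda>x. 2 ^ j * T (approx n x / 2 ^ j))" for n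
        by (rule test_function_smooth[OF slice_approximation(1)[OF T approx_test]])
      show "pow_integral p (\<lambda>x. C * majorant x) < \<infinity>"
        using majorant_finite pow_integral_cmult[of majorant p C] by (simp add: ennreal_mult_less_top)
    qed (use pge slice_tendsto[OF T] in auto)
    also have "\<dots> = ennreal (norm h powr p * (LINT x|lborel. (T' (u x / 2 ^ j) * norm (g x)) powr p))"
      unfolding slice_energy_integrable(2)[OF T] by (rule ennreal_mult'[symmetric]) simp
    finally show "pow_integral p (\<lambda>x. ?V (x + h) - ?V x) \<le> ennreal (norm h powr p * (LINT x|lborel. (T' (u x / 2 ^ j) * norm (g x)) powr p))" .
  next
    fix x assume "x \<notin> level j"
    hence "\<bar>u x / 2 ^ j\<bar> \<le> 1" by (simp add: level_def abs_divide not_less)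
    thus "?V x = 0" using T0 by simp
  next
    fix x assume "x \<in> level (Suc j)"
    hence "\<bar>u x / 2 ^ j\<bar> \<ge> 2" by (simp add: level_def abs_divide field_simps)
    thus "2 ^ j \<le> \<bar>?V x\<bar>" using T2 by (simp add: abs_mult)
  qed (use p1 emeasure_level[of j] in auto)
qed

lemma level_step:
  assumes T: "slice_fn T T' C"
  shows "level_weight (Suc j) \<le> step_const * level_weight j powr \<theta> * (LINT x|lborel. (T' (u x / 2 ^ j) * norm (g x)) powr p)"
proof -
  define G where "G = (LINT x|lborel. (T' (u x / 2 ^ j) * norm (g x)) powr p)"
  define \<omega> where "\<omega> = unit_ball_vol N"
  define m where "m = measure lborel (level j)"
  define m' where "m' = measure lborel (level (Suc j))"
  have \<omega>: "\<omega> > 0" by (simp add: \<omega>_def N)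
  have m: "m \<ge> 0" by (simp add: m_def)
  have st: "m' * (2 ^ j) powr p \<le> 2 * (2 * m / \<omega>) powr \<theta> * G"
    using level_step_measure[OF T, of j] by (simp add: G_def \<omega>_def m_def m'_def)
  have pj: "((2::real) ^ j) powr p = 2 powr (real j * p)" by (simp add: powr_realpow[symmetric] powr_powr)
  have gen: "2 powr (real (Suc j) * q) = 2 powr q * 2 powr (real j * (q - p)) * 2 powr (real j * p)" for q :: real
    by (simp add: powr_add[symmetric] algebra_simps)
  have "level_weight (Suc j) = 2 powr pc * 2 powr (real j * (pc - p)) * (m' * (2 ^ j) powr p)"
    unfolding level_weight_def m'_def[symmetric] pj gen by (simp only: mult_ac)
  also have "\<dots> \<le> 2 powr pc * 2 powr (real j * (pc - p)) * (2 * (2 * m / \<omega>) powr \<theta> * G)"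
    by (intro mult_left_mono st) auto
  also have "(2 * m / \<omega>) powr \<theta> = (2 / \<omega>) powr \<theta> * m powr \<theta>"
    using m \<omega> by (simp add: powr_mult[symmetric])
  also have "2 powr (real j * (pc - p)) = (2 powr (real j * pc)) powr \<theta>"
    by (simp only: powr_powr pc_\<theta>[symmetric] mult.assoc)
  also have "2 powr pc * (2 powr (real j * pc)) powr \<theta> * (2 * ((2 / \<omega>) powr \<theta> * m powr \<theta>) * G)
     = step_const * ((2 powr (real j * pc)) powr \<theta> * m powr \<theta>) * G" by (simp add: step_const_def \<omega>_def mult_ac)
  also have "(2 powr (real j * pc)) powr \<theta> * m powr \<theta> = level_weight j powr \<theta>"
    using m by (simp add: powr_mult level_weight_def m_def)
  finally show ?thesis by (simp add: G_def)
qed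

text \<open>At every point at most one dyadic slice has nonzero derivative.\<close>

lemma slice_energies_sum:
  assumes T: "slice_fn T T' C"
  shows "(\<Sum>j<J. LINT x|lborel. (T' (u x / 2 ^ j) * norm (g x)) powr p) \<le> C powr p * (LINT x|lborel. norm (g x) powr p)"
proof -
  have b: "\<And>s. 0 \<le> T' s \<and> T' s \<le> C" and C: "C > 0"
    and T0: "\<And>s. \<bar>s\<bar> \<le> 1 \<Longrightarrow> T' s = 0" and T2: "\<And>s. \<bar>s\<bar> \<ge> 2 \<Longrightarrow> T' s = 0"
    using T by (auto simp: slice_fn_def)
  have ig: "integrable lborel (\<lambda>x. norm (g x) powr p)"
    using fg pow_integral_finite_iff[of g p] by simp
  have pt: "(\<Sum>j<J. (T' (u x / 2 ^ j) * norm (g x)) powr p) \<le> C powr p * norm (g x) powr p" for x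
  proof (cases "\<exists>i<J. T' (u x / 2 ^ i) \<noteq> 0")
    case False
    thus ?thesis by simp
  next
    case True
    then obtain i where i: "i < J" "T' (u x / 2 ^ i) \<noteq> 0" by blast
    have range: "2 ^ j < \<bar>u x\<bar> \<and> \<bar>u x\<bar> < 2 ^ Suc j" if "T' (u x / 2 ^ j) \<noteq> 0" for j
    proof -
      have "\<not> \<bar>u x / 2 ^ j\<bar> \<le> 1" "\<not> \<bar>u x / 2 ^ j\<bar> \<ge> 2" using that T0 T2 by blast+
      thus ?thesis by (auto simp: abs_divide field_simps)
    qed
    have uniq: "T' (u x / 2 ^ j) = 0" if "j \<noteq> i" for j
    proof (rule ccontr)
      assume nz: "T' (u x / 2 ^ j) \<noteq> 0"
      have "(2::real) ^ j < 2 ^ Suc i" "(2::real) ^ i < 2 ^ Suc j" using range[OF nz] range[OF i(2)] by linarith+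
      hence "j < Suc i" "i < Suc j" by (simp_all only: power_strict_increasing_iff one_less_numeral_iff semiring_norm)
      thus False using that by simp
    qed
    have "(\<Sum>j<J. (T' (u x / 2 ^ j) * norm (g x)) powr p) = (T' (u x / 2 ^ i) * norm (g x)) powr p"
      using i(1) uniq by (subst sum.remove[of _ i]) (auto intro!: sum.neutral)
    also have "\<dots> \<le> (C * norm (g x)) powr p"
      using b p1 by (intro powr_mono2 mult_right_mono) auto
    finally show ?thesis using C by (simp add: powr_mult)
  qed
  have "(\<Sum>j<J. LINT x|lborel. (T' (u x / 2 ^ j) * norm (g x)) powr p) = (LINT x|lborel. (\<Sum>j<J. (T' (u x / 2 ^ j) * norm (g x)) powr p))"
    by (rule Bochner_Integration.integral_sum[symmetric]) (rule slice_energy_integrable(1)[OF T])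
  also have "\<dots> \<le> (LINT x|lborel. C powr p * norm (g x) powr p)"
    by (intro integral_mono pt) (use ig slice_energy_integrable(1)[OF T] in auto)
  finally show ?thesis by simp
qed

text \<open>Since \<open>\<theta> < 1\<close>, the recursion of \<open>level_step\<close> with bounded energies keeps the sequence bounded; with a
bounded factor in front, summability of the energies carries over.\<close>

lemma summable_level_weight: "summable level_weight"
proof -
  obtain T T' C where T: "slice_fn T T' C" using smooth_slice_exists unfolding slice_fn_def by blast
  define G where "G j = (LINT x|lborel. (T' (u x / 2 ^ j) * norm (g x)) powr p)" for j
  define S where "S = C powr p * (LINT x|lborel. norm (g x) powr p)"
  have G0: "G j \<ge> 0" for j by (simp add: G_def)
  have sumG: "(\<Sum>j<J. G j) \<le> S" for J unfolding G_def S_def by (rule slice_energies_sum[OF T])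
  have S: "S \<ge> 0" using sumG[of 0] by simp
  have GS: "G j \<le> S" for j using sumG[of "Suc j"] sum_nonneg[of "{..<j}" G] G0 by simp
  have st: "level_weight (Suc j) \<le> step_const * level_weight j powr \<theta> * G j" for j unfolding G_def by (rule level_step[OF T])
  define K where "K = step_const * S"
  have K: "K \<ge> 0" using step_const_pos S by (simp add: K_def)
  \<comment> \<open>A fixed bound: \<open>K * Bd powr \<theta> \<le> Bd\<close> makes the induction below close.\<close>
  define Bd where "Bd = max (max 1 (level_weight 0)) (K powr (1 / (1 - \<theta>)))"
  have Bd: "Bd \<ge> 1" "level_weight 0 \<le> Bd" by (auto simp: Bd_def)
  have KBd: "K \<le> Bd powr (1 - \<theta>)"
  proof -
    have ne: "1 - \<theta> \<noteq> 0" using \<theta>(2) by linarith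
    have "1 / (1 - \<theta>) * (1 - \<theta>) = 1" by (simp only: times_divide_eq_left mult_1 divide_self[OF ne])
    hence "K = (K powr (1 / (1 - \<theta>))) powr (1 - \<theta>)" using K by (simp only: powr_powr powr_one)
    also have "\<dots> \<le> Bd powr (1 - \<theta>)" using \<theta> by (intro powr_mono2) (auto simp: Bd_def)
    finally show ?thesis .
  qed
  have eB: "level_weight j \<le> Bd" for j
  proof (induction j)
    case (Suc j)
    have "level_weight (Suc j) \<le> step_const * level_weight j powr \<theta> * G j" by (rule st)
    also have "\<dots> \<le> step_const * Bd powr \<theta> * S"
      using step_const_pos level_weight_nonneg[of j] Suc \<theta> GS[of j] G0[of j] by (intro mult_mono powr_mono2) auto
    also have "\<dots> = K * Bd powr \<theta>" by (simp add: K_def)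
    also have "\<dots> \<le> Bd powr (1 - \<theta>) * Bd powr \<theta>" by (intro mult_right_mono KBd) simp
    also have "\<dots> = Bd" using Bd by (simp add: powr_add[symmetric])
    finally show ?case .
  qed (rule Bd)
  have "summable (\<lambda>j. level_weight (Suc j))"
  proof (rule summableI_nonneg_bounded)
    fix J
    have "(\<Sum>j<J. level_weight (Suc j)) \<le> (\<Sum>j<J. step_const * Bd powr \<theta> * G j)"
    proof (rule sum_mono)
      fix j
      have "level_weight (Suc j) \<le> step_const * level_weight j powr \<theta> * G j" by (rule st)
      also have "\<dots> \<le> step_const * Bd powr \<theta> * G j"
        using step_const_pos level_weight_nonneg[of j] eB[of j] \<theta> G0[of j] by (intro mult_mono powr_mono2) auto
      finally show "level_weight (Suc j) \<le> step_const * Bd powr \<theta> * G j" .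
    qed
    also have "\<dots> = step_const * Bd powr \<theta> * (\<Sum>j<J. G j)" by (simp add: sum_distrib_left)
    also have "\<dots> \<le> step_const * Bd powr \<theta> * S" using step_const_pos by (intro mult_left_mono sumG) auto
    finally show "(\<Sum>j<J. level_weight (Suc j)) \<le> step_const * Bd powr \<theta> * S" .
  qed (rule level_weight_nonneg)
  thus ?thesis by (simp add: summable_Suc_iff)
qed

text \<open>The embedding into the critical Lebesgue space. It makes the right-hand side of the equation meaningful
and is the starting point for higher integrability.\<close>

theorem sobolev_embedding: "pow_integral pc u < \<infinity>"
proof (rule summable_levels_imp_pow_integral)
  show "p \<le> pc" using pc_gt by simp
  show "summable (\<lambda>i. 2 powr (real i * pc) * measure lborel (level i))"
    using summable_level_weight unfolding level_weight_def .
qed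

end

section \<open>Higher integrability of solutions\<close>

lemma powr_pred_mult: "(x::real) \<ge> 0 \<Longrightarrow> x powr (q - 1) * x = x powr q"
  by (cases "x = 0") (simp_all add: powr_mult_base mult.commute)

lemma norm_powr_scaleR: "norm (norm x powr (q - 2) *\<^sub>R x) = norm x powr (q - 1)" for x :: "'a::real_normed_vector"
  using powr_pred_mult[of "norm x" "q - 1"] by simp

lemma integrable_powr_mult:
  fixes f h :: "'a::euclidean_space \<Rightarrow> real"
  assumes p: "p > 1" and [measurable]: "f \<in> borel_measurable borel" "h \<in> borel_measurable borel"
    and f: "pow_integral p f < \<infinity>" and h: "pow_integral p h < \<infinity>"
  shows "integrable lborel (\<lambda>x. \<bar>f x\<bar> powr (p - 1) * \<bar>h x\<bar>)"
proof (rule Bochner_Integration.integrable_bound)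
  have "integrable lborel (\<lambda>x. \<bar>f x\<bar> powr p)" "integrable lborel (\<lambda>x. \<bar>h x\<bar> powr p)"
    using pow_integral_finite_iff[of f p] pow_integral_finite_iff[of h p] f h by auto
  thus "integrable lborel (\<lambda>x. (p - 1) / p * \<bar>f x\<bar> powr p + \<bar>h x\<bar> powr p / p)" by auto
  show "AE x in lborel. norm (\<bar>f x\<bar> powr (p - 1) * \<bar>h x\<bar>) \<le> norm ((p - 1) / p * \<bar>f x\<bar> powr p + \<bar>h x\<bar> powr p / p)"
  proof (rule AE_I2)
    fix x
    have "\<bar>f x\<bar> powr (p - 1) * \<bar>h x\<bar> \<le> (p - 1) / p * \<bar>f x\<bar> powr p + \<bar>h x\<bar> powr p / p"
      by (rule Young_powr[OF p]) auto
    thus "norm (\<bar>f x\<bar> powr (p - 1) * \<bar>h x\<bar>) \<le> norm ((p - 1) / p * \<bar>f x\<bar> powr p + \<bar>h x\<bar> powr p / p)"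
      by simp
  qed
qed measurable

text \<open>Homogeneity of degree zero enters as invariance of the weight under dilations, which is the form in which
the substitution \<open>x \<mapsto> \<mu> x\<close> uses it.\<close>

locale critical_solution = sobolev_function p N u g
  for p N :: real and u :: "real ^ 'n \<Rightarrow> real" and g :: "real ^ 'n \<Rightarrow> real ^ 'n" +
  fixes a :: "real ^ 'n \<Rightarrow> real" and am aM :: real
  assumes a_meas [measurable]: "a \<in> borel_measurable borel"
    and am: "0 < am" and a_lower: "\<And>x. am \<le> a x" and a_upper: "\<And>x. a x \<le> aM"
    and a_dilation: "\<And>\<mu> x. \<mu> > 0 \<Longrightarrow> a (\<mu> *\<^sub>R x) = a x"
    and weak_eq: "\<And>\<phi>. test_function \<phi> \<Longrightarrow>
      (LINT x|lborel. norm (g x) powr (p - 2) * (g x \<bullet> grad \<phi> x) + a x * \<bar>u x\<bar> powr (p - 2) * u x * \<phi> x)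
      = (LINT x|lborel. \<bar>u x\<bar> powr (pc - 2) * u x * \<phi> x)"
begin

lemma aM: "aM > 0" and a_pos: "a x > 0"
  using am a_lower[of undefined] a_upper[of undefined] a_lower[of x] by linarith+

lemma abs_powr_sub_one: "\<bar>\<bar>u x\<bar> powr (q - 2) * u x\<bar> = \<bar>u x\<bar> powr (q - 1)"
  using norm_powr_scaleR[of "u x" q] by simp

text \<open>Dominated convergence in each of the three terms. In this way slices of \<open>u\<close>, the solution itself and its
truncated dilations become admissible in the weak equation.\<close>

lemma weak_eq_limit:
  assumes t: "\<And>n::nat. test_function (\<phi> n)" and [measurable]: "\<Phi> \<in> borel_measurable borel" "\<Gamma> \<in> borel_measurable borel"
    and [measurable]: "H1 \<in> borel_measurable borel" "H2 \<in> borel_measurable borel"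
    and l1: "AE x in lborel. (\<lambda>n. \<phi> n x) \<longlonglongrightarrow> \<Phi> x" and l2: "AE x in lborel. (\<lambda>n. grad (\<phi> n) x) \<longlonglongrightarrow> \<Gamma> x"
    and b1: "AE x in lborel. \<forall>n. \<bar>\<phi> n x\<bar> \<le> H2 x" and b2: "AE x in lborel. \<forall>n. norm (grad (\<phi> n) x) \<le> H1 x"
    and i1: "integrable lborel (\<lambda>x. norm (g x) powr (p - 1) * H1 x)"
    and i2: "integrable lborel (\<lambda>x. \<bar>u x\<bar> powr (p - 1) * H2 x)"
    and i3: "integrable lborel (\<lambda>x. \<bar>u x\<bar> powr (pc - 1) * H2 x)"
  shows "integrable lborel (\<lambda>x. norm (g x) powr (p - 2) * (g x \<bullet> \<Gamma> x))"
    and "integrable lborel (\<lambda>x. a x * \<bar>u x\<bar> powr (p - 2) * u x * \<Phi> x)"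
    and "integrable lborel (\<lambda>x. \<bar>u x\<bar> powr (pc - 2) * u x * \<Phi> x)"
    and "(LINT x|lborel. norm (g x) powr (p - 2) * (g x \<bullet> \<Gamma> x)) + (LINT x|lborel. a x * \<bar>u x\<bar> powr (p - 2) * u x * \<Phi> x)
      = (LINT x|lborel. \<bar>u x\<bar> powr (pc - 2) * u x * \<Phi> x)"
proof -
  have sm: "smooth (\<phi> n)" for n using t by (rule test_function_smooth)
  note [measurable] = smooth_measurable[OF sm] smooth_grad_measurable[OF sm]
  have B1: "\<bar>norm (g x) powr (p - 2) * (g x \<bullet> v)\<bar> \<le> norm (g x) powr (p - 1) * h" if "norm v \<le> h" for v h x
  proof -
    have "\<bar>norm (g x) powr (p - 2) * (g x \<bullet> v)\<bar> = \<bar>(norm (g x) powr (p - 2) *\<^sub>R g x) \<bullet> v\<bar>" by simp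
    also have "\<dots> \<le> norm (norm (g x) powr (p - 2) *\<^sub>R g x) * norm v" by (rule Cauchy_Schwarz_ineq2)
    also have "\<dots> \<le> norm (g x) powr (p - 1) * h" unfolding norm_powr_scaleR using that by (intro mult_left_mono) auto
    finally show ?thesis .
  qed
  have B2: "\<bar>a x * \<bar>u x\<bar> powr (p - 2) * u x * v\<bar> \<le> aM * (\<bar>u x\<bar> powr (p - 1) * h)" if "\<bar>v\<bar> \<le> h" for v h x
  proof -
    have "\<bar>a x * \<bar>u x\<bar> powr (p - 2) * u x * v\<bar> = a x * (\<bar>\<bar>u x\<bar> powr (p - 2) * u x\<bar> * \<bar>v\<bar>)"
      using a_pos[of x] by (simp add: abs_mult mult.assoc)
    also have "\<dots> \<le> aM * (\<bar>\<bar>u x\<bar> powr (p - 2) * u x\<bar> * h)"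
      using that a_upper[of x] aM by (intro mult_mono mult_nonneg_nonneg) auto
    finally show ?thesis by (simp only: abs_powr_sub_one)
  qed
  have B3: "\<bar>\<bar>u x\<bar> powr (pc - 2) * u x * v\<bar> \<le> \<bar>u x\<bar> powr (pc - 1) * h" if "\<bar>v\<bar> \<le> h" for v h x
  proof -
    have "\<bar>\<bar>u x\<bar> powr (pc - 2) * u x * v\<bar> = \<bar>\<bar>u x\<bar> powr (pc - 2) * u x\<bar> * \<bar>v\<bar>" by (rule abs_mult)
    also have "\<dots> \<le> \<bar>u x\<bar> powr (pc - 1) * h" unfolding abs_powr_sub_one using that by (intro mult_left_mono) auto
    finally show ?thesis .
  qed
  have L1: "AE x in lborel. (\<lambda>n. norm (g x) powr (p - 2) * (g x \<bullet> grad (\<phi> n) x)) \<longlonglongrightarrow> norm (g x) powr (p - 2) * (g x \<bullet> \<Gamma> x)"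
    using l2 by eventually_elim (intro tendsto_intros)
  have L2: "AE x in lborel. (\<lambda>n. a x * \<bar>u x\<bar> powr (p - 2) * u x * \<phi> n x) \<longlonglongrightarrow> a x * \<bar>u x\<bar> powr (p - 2) * u x * \<Phi> x"
    using l1 by eventually_elim (intro tendsto_intros)
  have L3: "AE x in lborel. (\<lambda>n. \<bar>u x\<bar> powr (pc - 2) * u x * \<phi> n x) \<longlonglongrightarrow> \<bar>u x\<bar> powr (pc - 2) * u x * \<Phi> x"
    using l1 by eventually_elim (intro tendsto_intros)
  have D1: "AE x in lborel. norm (norm (g x) powr (p - 2) * (g x \<bullet> grad (\<phi> n) x)) \<le> norm (g x) powr (p - 1) * H1 x" for n
    using b2 by eventually_elim (use B1 in auto)
  have D2: "AE x in lborel. norm (a x * \<bar>u x\<bar> powr (p - 2) * u x * \<phi> n x) \<le> aM * (\<bar>u x\<bar> powr (p - 1) * H2 x)" for n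
    using b1 by eventually_elim (use B2 in auto)
  have D3: "AE x in lborel. norm (\<bar>u x\<bar> powr (pc - 2) * u x * \<phi> n x) \<le> \<bar>u x\<bar> powr (pc - 1) * H2 x" for n
    using b1 by eventually_elim (use B3 in auto)
  have i2': "integrable lborel (\<lambda>x. aM * (\<bar>u x\<bar> powr (p - 1) * H2 x))" using i2 by simp
  have m1: "(\<lambda>x. norm (g x) powr (p - 2) * (g x \<bullet> grad (\<phi> n) x)) \<in> borel_measurable lborel"
    and m2: "(\<lambda>x. a x * \<bar>u x\<bar> powr (p - 2) * u x * \<phi> n x) \<in> borel_measurable lborel"
    and m3: "(\<lambda>x. \<bar>u x\<bar> powr (pc - 2) * u x * \<phi> n x) \<in> borel_measurable lborel" for n
    by measurable
  have M1: "(\<lambda>x. norm (g x) powr (p - 2) * (g x \<bullet> \<Gamma> x)) \<in> borel_measurable lborel"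
    and M2: "(\<lambda>x. a x * \<bar>u x\<bar> powr (p - 2) * u x * \<Phi> x) \<in> borel_measurable lborel"
    and M3: "(\<lambda>x. \<bar>u x\<bar> powr (pc - 2) * u x * \<Phi> x) \<in> borel_measurable lborel"
    by measurable
  note dominated = integrable_dominated_convergence2 integrable_dominated_convergence integral_dominated_convergence
  note C1 = dominated[OF M1 m1 i1 L1 D1] and C2 = dominated[OF M2 m2 i2' L2 D2] and C3 = dominated[OF M3 m3 i3 L3 D3]
  show "integrable lborel (\<lambda>x. norm (g x) powr (p - 2) * (g x \<bullet> \<Gamma> x))"
    "integrable lborel (\<lambda>x. a x * \<bar>u x\<bar> powr (p - 2) * u x * \<Phi> x)"
    "integrable lborel (\<lambda>x. \<bar>u x\<bar> powr (pc - 2) * u x * \<Phi> x)"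
    by (rule C1(2) C2(2) C3(2))+
  have "(\<lambda>n. (LINT x|lborel. norm (g x) powr (p - 2) * (g x \<bullet> grad (\<phi> n) x)) + (LINT x|lborel. a x * \<bar>u x\<bar> powr (p - 2) * u x * \<phi> n x))
    \<longlonglongrightarrow> (LINT x|lborel. norm (g x) powr (p - 2) * (g x \<bullet> \<Gamma> x)) + (LINT x|lborel. a x * \<bar>u x\<bar> powr (p - 2) * u x * \<Phi> x)"
    by (intro tendsto_add C1(3) C2(3))
  moreover have "(LINT x|lborel. norm (g x) powr (p - 2) * (g x \<bullet> grad (\<phi> n) x)) + (LINT x|lborel. a x * \<bar>u x\<bar> powr (p - 2) * u x * \<phi> n x)
    = (LINT x|lborel. \<bar>u x\<bar> powr (pc - 2) * u x * \<phi> n x)" for n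
    using weak_eq[OF t, of n] C1(1)[of n] C2(1)[of n] by (subst Bochner_Integration.integral_add[symmetric]) auto
  ultimately show "(LINT x|lborel. norm (g x) powr (p - 2) * (g x \<bullet> \<Gamma> x)) + (LINT x|lborel. a x * \<bar>u x\<bar> powr (p - 2) * u x * \<Phi> x)
      = (LINT x|lborel. \<bar>u x\<bar> powr (pc - 2) * u x * \<Phi> x)"
    using C3(3) LIMSEQ_unique by simp
qed

lemma integrable_u_pc: "integrable lborel (\<lambda>x. \<bar>u x\<bar> powr pc)"
  using sobolev_embedding pow_integral_finite_iff[of u pc] by simp

text \<open>Testing with the slice of \<open>u\<close> at height \<open>2 ^ j\<close>: the zero order term is nonnegative and is dropped, and
the slice is at most \<open>2 ^ j\<close> in modulus and vanishes below the level \<open>j\<close>.\<close>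

lemma slice_energy_le:
  assumes T: "slice_fn T T' C"
  shows "(LINT x|lborel. (T' (u x / 2 ^ j) * norm (g x)) powr p)
    \<le> C powr (p - 1) * (2 ^ j * (LINT x|lborel. \<bar>u x\<bar> powr (pc - 1) * indicator (level j) x))"
    and "integrable lborel (\<lambda>x. \<bar>u x\<bar> powr (pc - 1) * indicator (level j) x)"
proof -
  have cT: "continuous_on UNIV T'" and b: "\<And>s. 0 \<le> T' s \<and> T' s \<le> C" and C: "C > 0" 
    and sT: "smooth T" and T0: "\<And>s. \<bar>s\<bar> \<le> 1 \<Longrightarrow> T s = 0" and T1: "\<And>s. \<bar>T s\<bar> \<le> 1" and Ts: "\<And>s. 0 \<le> s * T s"
    using T by (auto simp: slice_fn_def)
  have [measurable]: "T' \<in> borel_measurable borel" using cT by (rule borel_measurable_continuous_onI)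
  have [measurable]: "T \<in> borel_measurable borel" using sT by (rule smooth_measurable)
  let ?S = "\<lambda>s. 2 ^ j * T (s / 2 ^ j)"
  have S1: "\<bar>?S s\<bar> \<le> 2 ^ j" for s using T1[of "s / 2 ^ j"] by (simp add: abs_mult)
  have S2: "\<bar>?S s\<bar> \<le> \<bar>s\<bar>" for s
  proof (cases "\<bar>s / 2 ^ j\<bar> \<le> 1")
    case False
    hence "2 ^ j \<le> \<bar>s\<bar>" by (simp add: abs_divide)
    thus ?thesis using S1[of s] by linarith
  qed (simp add: T0)
  have f_ng: "pow_integral p (\<lambda>x. norm (g x)) < \<infinity>" using fg by (simp add: pow_integral_def)
  have igH: "integrable lborel (\<lambda>x. norm (g x) powr (p - 1) * majorant x)"
    using integrable_powr_mult[OF p1 _ majorant_meas f_ng majorant_finite] majorant_nonneg by simp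
  have iuH: "integrable lborel (\<lambda>x. \<bar>u x\<bar> powr (p - 1) * majorant x)"
    using integrable_powr_mult[OF p1 _ majorant_meas fu majorant_finite] majorant_nonneg by simp
  \<comment> \<open>Both bounds on the slices are needed: \<open>2 ^ j\<close> against the critical power where \<open>\<bar>u\<bar>\<close> is large,
    the \<open>L^p\<close> majorant where it is small.\<close>
  let ?H2 = "\<lambda>x. min (2 ^ j) (majorant x)"
  note lim = weak_eq_limit[where \<phi> = "\<lambda>n x. ?S (approx n x)" and \<Phi> = "\<lambda>x. ?S (u x)" and \<Gamma> = "\<lambda>x. T' (u x / 2 ^ j) *\<^sub>R g x"
      and ?H1.0 = "\<lambda>x. C * majorant x" and ?H2.0 = ?H2]
  have t: "test_function (\<lambda>x. ?S (approx n x))" for n by (rule slice_approximation(1)[OF T approx_test])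
  note L1 = slice_tendsto(1)[OF T, of j] and L2 = slice_tendsto(2)[OF T, of j] and B2 = slice_tendsto(3)[OF T, of j]
  have B1: "AE x in lborel. \<forall>n. \<bar>?S (approx n x)\<bar> \<le> ?H2 x"
    using approx_le by eventually_elim (use S1 S2 in \<open>auto intro: order_trans\<close>)
  have I1: "integrable lborel (\<lambda>x. norm (g x) powr (p - 1) * (C * majorant x))"
    using integrable_mult_right[OF igH, of C] by (simp add: mult_ac)
  have I2: "integrable lborel (\<lambda>x. \<bar>u x\<bar> powr (p - 1) * ?H2 x)"
    by (rule Bochner_Integration.integrable_bound[OF iuH]) (use majorant_nonneg in \<open>auto intro!: mult_left_mono simp: abs_mult\<close>)
  have I3: "integrable lborel (\<lambda>x. \<bar>u x\<bar> powr (pc - 1) * ?H2 x)"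
  proof (rule Bochner_Integration.integrable_bound)
    show "integrable lborel (\<lambda>x. 2 ^ j * \<bar>u x\<bar> powr pc + \<bar>u x\<bar> powr (p - 1) * majorant x)"
      using integrable_u_pc iuH by simp
    show "AE x in lborel. norm (\<bar>u x\<bar> powr (pc - 1) * ?H2 x) \<le> norm (2 ^ j * \<bar>u x\<bar> powr pc + \<bar>u x\<bar> powr (p - 1) * majorant x)"
    proof (rule AE_I2)
      fix x
      have nn: "2 ^ j * \<bar>u x\<bar> powr pc \<ge> 0" "\<bar>u x\<bar> powr (p - 1) * majorant x \<ge> 0" "?H2 x \<ge> 0" using majorant_nonneg[of x] by auto
      have "\<bar>u x\<bar> powr (pc - 1) * ?H2 x \<le> 2 ^ j * \<bar>u x\<bar> powr pc + \<bar>u x\<bar> powr (p - 1) * majorant x"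
      proof (cases "\<bar>u x\<bar> \<ge> 1")
        case True
        have "\<bar>u x\<bar> powr (pc - 1) * ?H2 x \<le> \<bar>u x\<bar> powr pc * 2 ^ j"
          using nn True by (intro mult_mono powr_mono) auto
        also have "\<dots> = 2 ^ j * \<bar>u x\<bar> powr pc" by (rule mult.commute)
        finally show ?thesis using nn by linarith
      next
        case False
        hence "\<bar>u x\<bar> powr (pc - 1) \<le> \<bar>u x\<bar> powr (p - 1)" using pc_gt by (intro powr_mono') auto
        hence "\<bar>u x\<bar> powr (pc - 1) * ?H2 x \<le> \<bar>u x\<bar> powr (p - 1) * majorant x"
          using nn by (intro mult_mono) auto
        thus ?thesis using nn by linarith
      qed
      thus "norm (\<bar>u x\<bar> powr (pc - 1) * ?H2 x) \<le> norm (2 ^ j * \<bar>u x\<bar> powr pc + \<bar>u x\<bar> powr (p - 1) * majorant x)"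
        using nn by simp
    qed
  qed measurable
  have lim: "integrable lborel (\<lambda>x. norm (g x) powr (p - 2) * (g x \<bullet> (T' (u x / 2 ^ j) *\<^sub>R g x)))"
    "integrable lborel (\<lambda>x. a x * \<bar>u x\<bar> powr (p - 2) * u x * ?S (u x))"
    "integrable lborel (\<lambda>x. \<bar>u x\<bar> powr (pc - 2) * u x * ?S (u x))"
    "(LINT x|lborel. norm (g x) powr (p - 2) * (g x \<bullet> (T' (u x / 2 ^ j) *\<^sub>R g x))) + (LINT x|lborel. a x * \<bar>u x\<bar> powr (p - 2) * u x * ?S (u x))
      = (LINT x|lborel. \<bar>u x\<bar> powr (pc - 2) * u x * ?S (u x))"
    by (rule lim; (rule t L1 L2 B1 B2 I1 I2 I3 | measurable))+
  show il: "integrable lborel (\<lambda>x. \<bar>u x\<bar> powr (pc - 1) * indicator (level j) x)"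
  proof (rule Bochner_Integration.integrable_bound[OF integrable_u_pc])
    show "AE x in lborel. norm (\<bar>u x\<bar> powr (pc - 1) * indicator (level j) x) \<le> norm (\<bar>u x\<bar> powr pc)"
    proof (rule AE_I2)
      fix x
      have "1 \<le> \<bar>u x\<bar>" if "x \<in> level j"
      proof -
        have "1 \<le> (2::real) ^ j" by simp
        moreover have "2 ^ j < \<bar>u x\<bar>" using that by (simp add: level_def)
        ultimately show ?thesis by linarith
      qed
      thus "norm (\<bar>u x\<bar> powr (pc - 1) * indicator (level j) x) \<le> norm (\<bar>u x\<bar> powr pc)"
        by (cases "x \<in> level j") (auto intro!: powr_mono)
    qed
  qed measurable
  have gg: "norm (g x) powr (p - 2) * (g x \<bullet> (T' (u x / 2 ^ j) *\<^sub>R g x)) = T' (u x / 2 ^ j) * norm (g x) powr p" for x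
  proof -
    have "norm (g x) powr (p - 2) * (g x \<bullet> (T' (u x / 2 ^ j) *\<^sub>R g x)) = T' (u x / 2 ^ j) * ((norm (g x) powr (p - 2) * norm (g x)) * norm (g x))"
      by (simp add: power2_norm_eq_inner[symmetric] power2_eq_square mult_ac)
    also have "norm (g x) powr (p - 2) * norm (g x) = norm (g x) powr (p - 1)" using powr_pred_mult[of "norm (g x)" "p - 1"] by simp
    finally show ?thesis by (simp add: powr_pred_mult)
  qed
  have "(LINT x|lborel. (T' (u x / 2 ^ j) * norm (g x)) powr p) \<le> (LINT x|lborel. C powr (p - 1) * (T' (u x / 2 ^ j) * norm (g x) powr p))"
  proof (rule integral_mono[OF slice_energy_integrable(1)[OF T]])
    show "integrable lborel (\<lambda>x. C powr (p - 1) * (T' (u x / 2 ^ j) * norm (g x) powr p))" using lim(1) unfolding gg by simp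
    fix x
    have "(T' (u x / 2 ^ j) * norm (g x)) powr p = T' (u x / 2 ^ j) powr (p - 1) * (T' (u x / 2 ^ j) * norm (g x) powr p)"
      using b[of "u x / 2 ^ j"] by (simp add: powr_mult powr_pred_mult mult.assoc[symmetric])
    also have "\<dots> \<le> C powr (p - 1) * (T' (u x / 2 ^ j) * norm (g x) powr p)"
      using b[of "u x / 2 ^ j"] p1 by (intro mult_right_mono powr_mono2) auto
    finally show "(T' (u x / 2 ^ j) * norm (g x)) powr p \<le> C powr (p - 1) * (T' (u x / 2 ^ j) * norm (g x) powr p)" .
  qed
  also have "\<dots> = C powr (p - 1) * (LINT x|lborel. T' (u x / 2 ^ j) * norm (g x) powr p)" by simp
  also have "\<dots> \<le> C powr (p - 1) * (2 ^ j * (LINT x|lborel. \<bar>u x\<bar> powr (pc - 1) * indicator (level j) x))"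
  proof (rule mult_left_mono)
    have uS: "0 \<le> u x * ?S (u x)" for x
    proof -
      have "u x * ?S (u x) = (2 ^ j * 2 ^ j) * (u x / 2 ^ j * T (u x / 2 ^ j))" by simp
      also have "\<dots> \<ge> 0" by (intro mult_nonneg_nonneg Ts) auto
      finally show ?thesis .
    qed
    have "0 \<le> (LINT x|lborel. a x * \<bar>u x\<bar> powr (p - 2) * u x * ?S (u x))"
      using uS a_pos by (intro integral_nonneg_AE AE_I2) (simp add: mult.assoc mult_nonneg_nonneg less_imp_le)
    hence "(LINT x|lborel. T' (u x / 2 ^ j) * norm (g x) powr p) \<le> (LINT x|lborel. \<bar>u x\<bar> powr (pc - 2) * u x * ?S (u x))"
      using lim(4) unfolding gg by linarith
    also have "\<dots> \<le> (LINT x|lborel. 2 ^ j * (\<bar>u x\<bar> powr (pc - 1) * indicator (level j) x))"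
    proof (rule integral_mono[OF lim(3)])
      fix x
      show "\<bar>u x\<bar> powr (pc - 2) * u x * ?S (u x) \<le> 2 ^ j * (\<bar>u x\<bar> powr (pc - 1) * indicator (level j) x)"
      proof (cases "x \<in> level j")
        case True
        have "\<bar>u x\<bar> powr (pc - 2) * u x * ?S (u x) \<le> \<bar>\<bar>u x\<bar> powr (pc - 2) * u x\<bar> * \<bar>?S (u x)\<bar>"
          by (metis abs_ge_self abs_mult)
        also have "\<dots> \<le> \<bar>u x\<bar> powr (pc - 1) * 2 ^ j"
          unfolding abs_powr_sub_one by (intro mult_left_mono S1) auto
        finally show ?thesis using True by (simp add: mult.commute)
      next
        case False
        hence "\<bar>u x / 2 ^ j\<bar> \<le> 1" by (simp add: level_def abs_divide not_less)
        thus ?thesis using T0 by simp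
      qed
    qed (use il in simp)
    finally show "(LINT x|lborel. T' (u x / 2 ^ j) * norm (g x) powr p) \<le> 2 ^ j * (LINT x|lborel. \<bar>u x\<bar> powr (pc - 1) * indicator (level j) x)"
      by simp
  qed simp
  finally show "(LINT x|lborel. (T' (u x / 2 ^ j) * norm (g x)) powr p)
    \<le> C powr (p - 1) * (2 ^ j * (LINT x|lborel. \<bar>u x\<bar> powr (pc - 1) * indicator (level j) x))" .
qed

text \<open>In terms of the weights the layer sum is a geometric series, so it is bounded by the supremum of the
weights.\<close>

lemma level_integral_le:
  assumes B: "\<And>i. i \<ge> j \<Longrightarrow> level_weight i \<le> B"
  shows "2 ^ j * (LINT x|lborel. \<bar>u x\<bar> powr (pc - 1) * indicator (level j) x) \<le> 2 powr pc * B"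
proof -
  have pc1: "pc - 1 \<ge> 0" using pc_gt p1 by simp
  have B0: "B \<ge> 0" using B[of j] level_weight_nonneg[of j] by simp
  obtain T T' C where T: "slice_fn T T' C" using smooth_slice_exists unfolding slice_fn_def by blast
  have int: "integrable lborel (\<lambda>x. \<bar>u x\<bar> powr (pc - 1) * indicator (level j) x)" by (rule slice_energy_le(2)[OF T])
  have pt: "2 powr (real (i + j + 1) * (pc - 1)) * measure lborel (level (i + j)) = 2 powr (pc - 1) * 2 powr - real j * (1 / 2) ^ i * level_weight (i + j)" for i
  proof -
    have gen: "2 powr (real (i + j + 1) * (q - 1)) = 2 powr (q - 1) * 2 powr - real j * 2 powr - real i * 2 powr (real (i + j) * q)" for q :: real
      by (simp add: powr_add[symmetric] algebra_simps)
    have "(1 / 2 :: real) ^ i = 2 powr - real i" by (simp add: powr_minus powr_realpow power_one_over inverse_eq_divide)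
    thus ?thesis unfolding gen level_weight_def by (simp only: mult.assoc)
  qed
  have "ennreal (LINT x|lborel. \<bar>u x\<bar> powr (pc - 1) * indicator (level j) x) = (\<integral>\<^sup>+x. ennreal (\<bar>u x\<bar> powr (pc - 1)) * indicator (level j) x \<partial>lborel)"
    by (subst nn_integral_eq_integral[OF int, symmetric]) (auto intro!: nn_integral_cong simp: indicator_def)
  also have "\<dots> \<le> (\<Sum>i. ennreal (2 powr (real (i + j + 1) * (pc - 1))) * emeasure lborel (level (i + j)))"
    unfolding level_def by (rule layer_sum[OF pc1]) measurable
  also have "\<dots> = (\<Sum>i. ennreal (2 powr (pc - 1) * 2 powr - real j * (1 / 2) ^ i * level_weight (i + j)))"
    by (intro suminf_cong) (simp only: emeasure_level pt[symmetric] ennreal_mult[OF powr_ge_zero measure_nonneg])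
  also have "\<dots> \<le> (\<Sum>i. ennreal (2 powr (pc - 1) * 2 powr - real j * B * (1 / 2) ^ i))"
  proof (intro suminf_le ennreal_leI)
    fix i
    have "2 powr (pc - 1) * 2 powr - real j * (1 / 2) ^ i * level_weight (i + j) \<le> 2 powr (pc - 1) * 2 powr - real j * (1 / 2) ^ i * B"
      by (intro mult_left_mono B) auto
    thus "2 powr (pc - 1) * 2 powr - real j * (1 / 2) ^ i * level_weight (i + j) \<le> 2 powr (pc - 1) * 2 powr - real j * B * (1 / 2) ^ i"
      by (simp only: mult_ac)
  qed auto
  also have "\<dots> = ennreal (2 powr (pc - 1) * 2 powr - real j * B * 2)"
  proof -
    have s: "(\<lambda>i. (1 / 2 :: real) ^ i) sums 2" using geometric_sums[of "1/2::real"] by simp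
    have "(\<lambda>i. 2 powr (pc - 1) * 2 powr - real j * B * (1 / 2) ^ i) sums (2 powr (pc - 1) * 2 powr - real j * B * 2)"
      by (rule sums_mult[OF s])
    thus ?thesis using B0 by (intro suminf_ennreal_eq) auto
  qed
  finally have "(LINT x|lborel. \<bar>u x\<bar> powr (pc - 1) * indicator (level j) x) \<le> 2 powr (pc - 1) * 2 powr - real j * B * 2"
    using B0 by (subst (asm) ennreal_le_iff) auto
  hence "2 ^ j * (LINT x|lborel. \<bar>u x\<bar> powr (pc - 1) * indicator (level j) x) \<le> 2 ^ j * (2 powr (pc - 1) * 2 powr - real j * B * 2)"
    by (intro mult_left_mono) auto
  also have "\<dots> = (2 ^ j * 2 powr - real j) * (2 powr (pc - 1) * 2) * B" by (simp only: mult_ac)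
  also have "(2::real) ^ j * 2 powr - real j = 1" by (simp add: powr_minus powr_realpow)
  also have "2 powr (pc - 1) * 2 = 2 powr pc" by (rule powr_pred_mult) simp
  finally show ?thesis by simp
qed

text \<open>From the level \<open>J\<close> on, \<open>D * level_weight j powr \<theta>\<close> is below any prescribed \<open>\<delta>\<close>, and each step then
multiplies the bound on the remaining tail by \<open>\<delta>\<close>. The choice \<open>\<delta> = 2 powr (- (q - pc + 1))\<close> leaves a
convergent geometric series for the exponent \<open>q\<close>.\<close>

lemma high_integrability:
  assumes q: "q \<ge> pc"
  shows "pow_integral q u < \<infinity>"
proof (rule summable_levels_imp_pow_integral)
  show "q \<ge> p" using q pc_gt by simp
  obtain T T' C where T: "slice_fn T T' C" using smooth_slice_exists unfolding slice_fn_def by blast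
  define D where "D = step_const * C powr (p - 1) * 2 powr pc"
  have C: "C > 0" using T by (simp add: slice_fn_def)
  have D: "D > 0" using step_const_pos C by (simp add: D_def)
  have st: "level_weight (Suc j) \<le> D * level_weight j powr \<theta> * B" if B: "\<And>i. i \<ge> j \<Longrightarrow> level_weight i \<le> B" for j B
  proof -
    have "level_weight (Suc j) \<le> step_const * level_weight j powr \<theta> * (LINT x|lborel. (T' (u x / 2 ^ j) * norm (g x)) powr p)" by (rule level_step[OF T])
    also have "\<dots> \<le> step_const * level_weight j powr \<theta> * (C powr (p - 1) * (2 powr pc * B))"
    proof (rule mult_left_mono)
      have "(LINT x|lborel. (T' (u x / 2 ^ j) * norm (g x)) powr p)
          \<le> C powr (p - 1) * (2 ^ j * (LINT x|lborel. \<bar>u x\<bar> powr (pc - 1) * indicator (level j) x))" by (rule slice_energy_le(1)[OF T])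
      also have "\<dots> \<le> C powr (p - 1) * (2 powr pc * B)" by (intro mult_left_mono level_integral_le B) auto
      finally show "(LINT x|lborel. (T' (u x / 2 ^ j) * norm (g x)) powr p) \<le> C powr (p - 1) * (2 powr pc * B)" .
    qed (use step_const_pos in auto)
    finally show ?thesis by (simp only: D_def mult_ac)
  qed
  define \<sigma> where "\<sigma> = q - pc + 1"
  define \<delta> where "\<delta> = 2 powr - \<sigma>"
  have \<delta>: "\<delta> > 0" by (simp add: \<delta>_def)
  have e0: "level_weight \<longlonglongrightarrow> 0" by (rule summable_LIMSEQ_zero[OF summable_level_weight])
  have "(\<lambda>j. D * level_weight j powr \<theta>) \<longlonglongrightarrow> D * 0 powr \<theta>"
    using \<theta> level_weight_nonneg by (intro tendsto_intros tendsto_powr2 e0) auto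
  hence "(\<lambda>j. D * level_weight j powr \<theta>) \<longlonglongrightarrow> 0" by simp
  from order_tendstoD(2)[OF this \<delta>] obtain J where J: "\<And>j. j \<ge> J \<Longrightarrow> D * level_weight j powr \<theta> \<le> \<delta>"
    by (auto simp: eventually_sequentially intro: less_imp_le)
  obtain B0 where B0: "\<And>i. level_weight i \<le> B0"
    using Bseq_eq_bounded[of level_weight] convergent_imp_Bseq[of level_weight] e0 by (metis BseqE abs_ge_self convergentI order_trans real_norm_def)
  have B0': "B0 \<ge> 0" using B0[of 0] level_weight_nonneg[of 0] by linarith
  have decay: "level_weight i \<le> \<delta> ^ k * B0" if "i \<ge> J + k" for i k
    using that
  proof (induction k arbitrary: i)
    case (Suc k)
    then obtain i' where i': "i = Suc i'" "i' \<ge> J + k" by (cases i) auto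
    have "level_weight i \<le> D * level_weight i' powr \<theta> * (\<delta> ^ k * B0)" unfolding i'(1) by (rule st, rule Suc.IH) (use i' in simp)
    also have "\<dots> \<le> \<delta> * (\<delta> ^ k * B0)" using J[of i'] i' \<delta> B0' by (intro mult_right_mono) auto
    finally show ?case by simp
  qed (use B0 in simp)
  have \<delta>k: "\<delta> ^ k = 2 powr (- \<sigma> * real k)" for k by (simp add: \<delta>_def powr_realpow[symmetric] powr_powr)
  have "summable (\<lambda>k. 2 powr (real (k + J) * q) * measure lborel (level (k + J)))"
  proof (rule summable_comparison_test')
    show "summable (\<lambda>k. (2 powr (real J * (q - pc)) * B0) * (1 / 2) ^ k)" by (intro summable_mult summable_geometric) simp
    fix k :: nat
    have gen: "2 powr (real i * q) = 2 powr (real i * (q - r)) * 2 powr (real i * r)" for i and r :: real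
      by (simp add: powr_add[symmetric] algebra_simps)
    have "2 powr (real (k + J) * q) * measure lborel (level (k + J)) = 2 powr (real (k + J) * (q - pc)) * level_weight (k + J)"
      unfolding gen[of "k + J" pc] level_weight_def by (simp only: mult.assoc)
    also have "\<dots> \<le> 2 powr (real (k + J) * (q - pc)) * (\<delta> ^ k * B0)" by (intro mult_left_mono decay) auto
    also have "\<dots> = (2 powr (real J * (q - pc)) * B0) * (2 powr (real (k + J) * (q - pc) - real J * (q - pc) - \<sigma> * real k))"
      unfolding \<delta>k by (simp add: powr_add powr_diff powr_minus divide_simps)
    also have "real (k + J) * (q - pc) - real J * (q - pc) - \<sigma> * real k = - real k"
      unfolding \<sigma>_def of_nat_add by (simp only: ring_distribs) simp
    also have "2 powr (- real k) = (1 / 2 :: real) ^ k" by (simp add: powr_minus powr_realpow power_one_over inverse_eq_divide)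
    finally show "norm (2 powr (real (k + J) * q) * measure lborel (level (k + J))) \<le> (2 powr (real J * (q - pc)) * B0) * (1 / 2) ^ k"
      by simp
  qed
  thus "summable (\<lambda>i. 2 powr (real i * q) * measure lborel (level i))"
    by (rule summable_iff_shift[THEN iffD1])
qed

end

section \<open>Dilation of a solution as a test function\<close>

text \<open>The slope is written as \<open>L / R\<close> because all cutoffs arise from one by scaling, so that the same \<open>L\<close>
serves every radius.\<close>

definition cutoff_fn :: "real \<Rightarrow> real \<Rightarrow> (real ^ 'n \<Rightarrow> real) \<Rightarrow> bool" where
  "cutoff_fn R L \<eta> \<longleftrightarrow> test_function \<eta> \<and> (\<forall>x. 0 \<le> \<eta> x \<and> \<eta> x \<le> 1) \<and> (\<forall>x. norm x \<le> R \<longrightarrow> \<eta> x = 1) \<and>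
    (\<forall>x. norm x \<ge> 2 * R \<longrightarrow> \<eta> x = 0) \<and> (\<forall>x. norm (grad \<eta> x) \<le> L / R) \<and>
    (\<forall>x y. \<bar>\<eta> x - \<eta> y\<bar> \<le> L / R * norm (x - y)) \<and> (\<forall>x y. norm x \<le> norm y \<longrightarrow> \<eta> y \<le> \<eta> x)"

lemma cutoff_fn_exists:
  "\<exists>L>0. \<forall>R>0. \<exists>\<eta> :: real ^ 'n \<Rightarrow> real. cutoff_fn R L \<eta>"
proof -
  obtain \<psi> :: "real^'n \<Rightarrow> real" and L where L: "L > 0" and t\<psi>: "test_function \<psi>"
    and one: "\<And>x. norm x \<le> 1 \<Longrightarrow> \<psi> x = 1" and zero: "\<And>x. norm x \<ge> 2 \<Longrightarrow> \<psi> x = 0"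
    and r: "\<And>x. 0 \<le> \<psi> x \<and> \<psi> x \<le> 1" and gL: "\<And>x. norm (grad \<psi> x) \<le> L"
    and lip: "\<And>x y. \<bar>\<psi> x - \<psi> y\<bar> \<le> L * norm (x - y)" and mono: "\<And>x y. norm x \<le> norm y \<Longrightarrow> \<psi> y \<le> \<psi> x"
    using cutoff_exists[where 'n='n] by blast
  have s\<psi>: "smooth \<psi>" using t\<psi> by (rule test_function_smooth)
  have "cutoff_fn R L (\<lambda>x. \<psi> (inverse R *\<^sub>R x + 0))" if R: "R > 0" for R
    unfolding cutoff_fn_def
  proof (intro conjI allI impI)
    show "test_function (\<lambda>x. \<psi> (inverse R *\<^sub>R x + 0))"
      by (rule test_functionI[OF smooth_affine[OF s\<psi>], of "2 * R"], rule zero) (use R in \<open>simp add: field_simps\<close>)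
    fix x y :: "real^'n"
    show "0 \<le> \<psi> (inverse R *\<^sub>R x + 0)" "\<psi> (inverse R *\<^sub>R x + 0) \<le> 1" using r by auto
    show "norm (grad (\<lambda>x. \<psi> (inverse R *\<^sub>R x + 0)) x) \<le> L / R"
      unfolding grad_affine[OF s\<psi>] using gL R by (simp add: divide_inverse mult.commute mult_left_mono)
    have "\<bar>\<psi> (inverse R *\<^sub>R x + 0) - \<psi> (inverse R *\<^sub>R y + 0)\<bar> \<le> L * norm (inverse R *\<^sub>R (x - y))"
      using lip[of "inverse R *\<^sub>R x" "inverse R *\<^sub>R y"] by (simp add: scaleR_diff_right)
    thus "\<bar>\<psi> (inverse R *\<^sub>R x + 0) - \<psi> (inverse R *\<^sub>R y + 0)\<bar> \<le> L / R * norm (x - y)"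
      using R by (simp add: divide_inverse)
    show "\<psi> (inverse R *\<^sub>R x + 0) = 1" if "norm x \<le> R" using that R by (intro one) (simp add: field_simps)
    show "\<psi> (inverse R *\<^sub>R x + 0) = 0" if "2 * R \<le> norm x" using that R by (intro zero) (simp add: field_simps)
    show "\<psi> (inverse R *\<^sub>R y + 0) \<le> \<psi> (inverse R *\<^sub>R x + 0)" if "norm x \<le> norm y"
      using that R by (intro mono) (simp add: field_simps)
  qed
  thus ?thesis using L by blast
qed

lemma cutoff_grad_inside:
  assumes "cutoff_fn R L \<eta>" "norm x < R"
  shows "grad \<eta> x = 0"
proof (rule grad_unique)
  have "((\<lambda>x. 1) has_derivative (\<lambda>v. 0 \<bullet> v)) (at x)" by simp
  thus "(\<eta> has_derivative (\<lambda>v. 0 \<bullet> v)) (at x)"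
    by (rule has_derivative_transform_within_open[where s = "ball 0 R"]) (use assms in \<open>auto simp: cutoff_fn_def\<close>)
qed

lemma cutoff_grad_outside:
  assumes "cutoff_fn R L \<eta>" "norm x > 2 * R"
  shows "grad \<eta> x = 0"
  by (rule grad_zero_outside[of "2 * R"]) (use assms in \<open>auto simp: cutoff_fn_def\<close>)

text \<open>The substitution moves the dilation to the cutoff. The cutoff only increases when its argument shrinks,
which gives the lower bound; it changes by at most \<open>4 * L * (\<mu> - 1)\<close>, and only outside the ball of radius
\<open>R\<close>, which gives the upper bound.\<close>

lemma cutoff_dilated_integral:
  fixes F :: "real ^ 'n \<Rightarrow> real"
  assumes \<eta>: "cutoff_fn R L \<eta>" and R: "R > 0" and L: "L > 0" and F: "integrable lborel F" and F0: "\<And>x. F x \<ge> 0" and \<mu>: "1 \<le> \<mu>" "\<mu> \<le> 2"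
  shows "integrable lborel (\<lambda>x. \<eta> x * F (\<mu> *\<^sub>R x))"
    and "(LINT x|lborel. \<eta> x * F x) / \<mu> ^ CARD('n) \<le> (LINT x|lborel. \<eta> x * F (\<mu> *\<^sub>R x))"
    and "(LINT x|lborel. \<eta> x * F (\<mu> *\<^sub>R x)) \<le> ((LINT x|lborel. \<eta> x * F x) + 4 * L * (\<mu> - 1) * (LINT x|lborel. indicator (- ball 0 R) x * F x)) / \<mu> ^ CARD('n)"
proof -
  have [measurable]: "F \<in> borel_measurable borel" using F by auto
  have t: "test_function \<eta>" and r: "\<And>x. 0 \<le> \<eta> x \<and> \<eta> x \<le> 1" and one: "\<And>x. norm x \<le> R \<Longrightarrow> \<eta> x = 1"
    and zero: "\<And>x. norm x \<ge> 2 * R \<Longrightarrow> \<eta> x = 0" and lip: "\<And>x y. \<bar>\<eta> x - \<eta> y\<bar> \<le> L / R * norm (x - y)"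
    and mono: "\<And>x y. norm x \<le> norm y \<Longrightarrow> \<eta> y \<le> \<eta> x"
    using \<eta> by (auto simp: cutoff_fn_def)
  have [measurable]: "\<eta> \<in> borel_measurable borel" using t by (intro smooth_measurable test_function_smooth)
  have dom: "integrable lborel (\<lambda>x. c x * G x)" if "integrable lborel G" "\<And>x. 0 \<le> c x \<and> c x \<le> 1" "c \<in> borel_measurable borel"
    for c and G :: "real^'n \<Rightarrow> real"
  proof (rule Bochner_Integration.integrable_bound[OF that(1)])
    show "AE x in lborel. norm (c x * G x) \<le> norm (G x)"
      using that(2) by (intro AE_I2) (simp add: abs_mult mult_left_le_one_le)
    have [measurable]: "G \<in> borel_measurable borel" "c \<in> borel_measurable borel" using that by auto
    show "(\<lambda>x. c x * G x) \<in> borel_measurable lborel" by measurable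
  qed
  have Fm: "integrable lborel (\<lambda>x. F (\<mu> *\<^sub>R x))" using integrable_affine[OF F, of \<mu> 0] \<mu> by simp
  show "integrable lborel (\<lambda>x. \<eta> x * F (\<mu> *\<^sub>R x))" by (rule dom[OF Fm r]) measurable
  have eq: "(LINT x|lborel. \<eta> x * F (\<mu> *\<^sub>R x)) = (LINT x|lborel. \<eta> (inverse \<mu> *\<^sub>R x) * F x) / \<mu> ^ CARD('n)"
    using integral_affine[of "\<lambda>x. \<eta> (inverse \<mu> *\<^sub>R x) * F x" \<mu> 0] \<mu> by simp
  have i1: "integrable lborel (\<lambda>x. \<eta> (inverse \<mu> *\<^sub>R x) * F x)" by (rule dom[OF F]) (use r in auto)
  have i2: "integrable lborel (\<lambda>x. \<eta> x * F x)" by (rule dom[OF F r]) measurable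
  have i3: "integrable lborel (\<lambda>x. indicator (- ball 0 R) x * F x)" by (rule dom[OF F]) (auto simp: indicator_def)
  have nle: "norm (inverse \<mu> *\<^sub>R x) \<le> norm x" for x :: "real^'n"
    using \<mu> by (simp add: mult_left_le_one_le inverse_le_1_iff)
  show "(LINT x|lborel. \<eta> x * F x) / \<mu> ^ CARD('n) \<le> (LINT x|lborel. \<eta> x * F (\<mu> *\<^sub>R x))"
    unfolding eq using \<mu> by (intro divide_right_mono integral_mono i1 i2 mult_right_mono mono nle F0) auto
  \<comment> \<open>Inside radius \<open>R\<close> both cutoffs are 1, beyond \<open>4 * R\<close> both are 0; in between the slope bound applies.\<close>
  have up: "\<eta> (inverse \<mu> *\<^sub>R x) \<le> \<eta> x + 4 * L * (\<mu> - 1) * indicator (- ball 0 R) x" for x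
  proof (cases "norm x < R \<or> norm x > 4 * R")
    case True
    thus ?thesis
    proof
      assume "norm x < R"
      hence "\<eta> x = 1" "\<eta> (inverse \<mu> *\<^sub>R x) = 1" using nle[of x] by (auto intro!: one)
      thus ?thesis using L \<mu> by (simp add: indicator_def)
    next
      assume x: "norm x > 4 * R"
      have "2 * R * \<mu> \<le> 2 * R * 2" using \<mu> R by (intro mult_left_mono) auto
      hence "norm (inverse \<mu> *\<^sub>R x) \<ge> 2 * R" using x \<mu> by (simp add: field_simps)
      hence "\<eta> (inverse \<mu> *\<^sub>R x) = 0" by (rule zero)
      thus ?thesis using r[of x] L \<mu> by (simp add: indicator_def)
    qed
  next
    case False
    have "\<eta> (inverse \<mu> *\<^sub>R x) - \<eta> x \<le> L / R * norm (inverse \<mu> *\<^sub>R x - x)" using lip abs_le_D1 by blast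
    also have "inverse \<mu> *\<^sub>R x - x = (inverse \<mu> - 1) *\<^sub>R x" by (simp add: algebra_simps)
    also have "norm ((inverse \<mu> - 1) *\<^sub>R x) = (1 - inverse \<mu>) * norm x" using \<mu> by (simp add: inverse_le_1_iff)
    also have "L / R * ((1 - inverse \<mu>) * norm x) \<le> L / R * ((\<mu> - 1) * (4 * R))"
    proof (intro mult_left_mono mult_mono)
      have "(\<mu> - 1) * 1 \<ge> (\<mu> - 1) * inverse \<mu>" using \<mu> by (intro mult_left_mono) (auto simp: inverse_le_1_iff)
      thus "1 - inverse \<mu> \<le> \<mu> - 1" using \<mu> by (simp add: left_diff_distrib)
    qed (use False \<mu> L R in auto)
    also have "\<dots> = 4 * L * (\<mu> - 1)" using R by simp
    finally show ?thesis using False by (simp add: indicator_def)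
  qed
  have "(LINT x|lborel. \<eta> (inverse \<mu> *\<^sub>R x) * F x) \<le> (LINT x|lborel. \<eta> x * F x + 4 * L * (\<mu> - 1) * (indicator (- ball 0 R) x * F x))"
  proof (rule integral_mono[OF i1])
    show "integrable lborel (\<lambda>x. \<eta> x * F x + 4 * L * (\<mu> - 1) * (indicator (- ball 0 R) x * F x))" using i2 i3 by simp
    fix x
    show "\<eta> (inverse \<mu> *\<^sub>R x) * F x \<le> \<eta> x * F x + 4 * L * (\<mu> - 1) * (indicator (- ball 0 R) x * F x)"
      using mult_right_mono[OF up F0, of x x] by (simp add: ring_distribs mult.assoc)
  qed
  also have "\<dots> = (LINT x|lborel. \<eta> x * F x) + 4 * L * (\<mu> - 1) * (LINT x|lborel. indicator (- ball 0 R) x * F x)"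
    using i2 i3 by simp
  finally show "(LINT x|lborel. \<eta> x * F (\<mu> *\<^sub>R x)) \<le> ((LINT x|lborel. \<eta> x * F x) + 4 * L * (\<mu> - 1) * (LINT x|lborel. indicator (- ball 0 R) x * F x)) / \<mu> ^ CARD('n)"
    unfolding eq using \<mu> by (intro divide_right_mono) auto
qed

lemma powr_norm_inner_self: "norm x powr (q - 2) * (x \<bullet> x) = norm x powr q" for x :: "'a::real_inner"
proof -
  have "norm x powr (q - 2) * (x \<bullet> x) = (norm x powr (q - 2) * norm x) * norm x"
    by (simp add: power2_norm_eq_inner[symmetric] power2_eq_square)
  also have "norm x powr (q - 2) * norm x = norm x powr (q - 1)" using powr_pred_mult[of "norm x" "q - 1"] by simp
  finally show ?thesis by (simp add: powr_pred_mult)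
qed

text \<open>The gradient inequality for the convex function \<open>norm x powr q / q\<close>.\<close>

lemma norm_powr_convex:
  fixes x y :: "'a::real_inner"
  assumes q: "q > 1"
  shows "norm x powr (q - 2) * (x \<bullet> (y - x)) \<le> (norm y powr q - norm x powr q) / q"
proof -
  have "norm x powr (q - 2) * (x \<bullet> y) = (norm x powr (q - 2) *\<^sub>R x) \<bullet> y" by simp
  also have "\<dots> \<le> norm (norm x powr (q - 2) *\<^sub>R x) * norm y" by (rule norm_cauchy_schwarz)
  also have "\<dots> = norm x powr (q - 1) * norm y" by (simp only: norm_powr_scaleR)
  also have "\<dots> \<le> (q - 1) / q * norm x powr q + norm y powr q / q" by (rule Young_powr[OF q]) auto
  finally have "norm x powr (q - 2) * (x \<bullet> (y - x)) \<le> (q - 1) / q * norm x powr q + norm y powr q / q - norm x powr q"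
    by (simp add: inner_diff_right right_diff_distrib powr_norm_inner_self)
  also have "\<dots> = (norm y powr q - norm x powr q) / q" using q by (simp add: field_simps)
  finally show ?thesis .
qed

lemma abs_powr_convex:
  fixes x y :: real
  assumes q: "q > 1"
  shows "\<bar>x\<bar> powr (q - 2) * x * (y - x) \<le> (\<bar>y\<bar> powr q - \<bar>x\<bar> powr q) / q"
  using norm_powr_convex[OF q, of x y] by (simp add: mult.assoc)

text \<open>The weight trades the two terms against each other: the second one becomes as small as desired for large
\<open>\<kappa>\<close>, at the price of a large factor in front of the first.\<close>

lemma weighted_Young:
  fixes a b :: real
  assumes p: "p > 1" and a: "a \<ge> 0" and b: "b \<ge> 0" and \<kappa>: "\<kappa> > 0"
  shows "a powr (p - 1) * b \<le> \<kappa> powr p * a powr p + \<kappa> powr (- (p - 1) * p) * b powr p"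
proof -
  have "a powr (p - 1) * b = (\<kappa> * a) powr (p - 1) * (\<kappa> powr (- (p - 1)) * b)"
  proof -
    have "\<kappa> powr (p - 1) * \<kappa> powr (- (p - 1)) = 1" using \<kappa> by (subst powr_add[symmetric]) simp
    hence "(\<kappa> powr (p - 1) * \<kappa> powr (- (p - 1))) * (a powr (p - 1) * b) = a powr (p - 1) * b" by simp
    thus ?thesis using \<kappa> a by (simp only: powr_mult less_imp_le mult_ac)
  qed
  also have "\<dots> \<le> (p - 1) / p * (\<kappa> * a) powr p + (\<kappa> powr (- (p - 1)) * b) powr p / p"
    by (rule Young_powr[OF p]) (use \<kappa> a b in auto)
  also have "\<dots> \<le> 1 * (\<kappa> * a) powr p + (\<kappa> powr (- (p - 1)) * b) powr p / 1"
    using p by (intro add_mono mult_right_mono divide_left_mono) auto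
  also have "\<dots> = \<kappa> powr p * a powr p + \<kappa> powr (- (p - 1) * p) * b powr p"
    using \<kappa> a b by (simp add: powr_mult powr_powr)
  finally show ?thesis .
qed

context critical_solution
begin

text \<open>The exponent for which \<open>(\<bar>s\<bar> powr crit_ratio) powr (p - 1)\<close> is \<open>\<bar>s\<bar> powr (pc - 1)\<close>; it puts the critical
nonlinearity into the form required by Young's inequality.\<close>

definition crit_ratio :: real where "crit_ratio = (pc - 1) / (p - 1)"

lemma crit_ratio: "crit_ratio > 0" "crit_ratio * (p - 1) = pc - 1" "crit_ratio * p \<ge> pc"
proof -
  show "crit_ratio > 0" "crit_ratio * (p - 1) = pc - 1" using p1 pc_gt by (auto simp: crit_ratio_def)
  have gen: "(q - 1) / (p - 1) * p \<ge> q" if "q > p" for q using that p1 by (simp add: field_simps)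
  show "crit_ratio * p \<ge> pc" unfolding crit_ratio_def by (rule gen[OF pc_gt])
qed

lemma pow_integral_u_crit_ratio: "pow_integral p (\<lambda>x. \<bar>u x\<bar> powr crit_ratio) < \<infinity>"
  using high_integrability[OF crit_ratio(3)] by (simp add: pow_integral_def powr_powr)

lemma powr_crit_ratio: "(\<bar>s\<bar> powr crit_ratio) powr (p - 1) = \<bar>s\<bar> powr (pc - 1)"
  by (simp only: powr_powr crit_ratio(2))

lemma integrable_critical:
  assumes [measurable]: "h \<in> borel_measurable borel" and h: "pow_integral p h < \<infinity>"
  shows "integrable lborel (\<lambda>x. \<bar>u x\<bar> powr (pc - 1) * \<bar>h x\<bar>)"
  using integrable_powr_mult[OF p1 _ _ pow_integral_u_crit_ratio h] by (simp add: powr_crit_ratio)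

lemma integrable_g: "integrable lborel (\<lambda>x. norm (g x) powr p)"
  using fg pow_integral_finite_iff[of g p] by simp

lemma integrable_u: "integrable lborel (\<lambda>x. \<bar>u x\<bar> powr p)"
  using fu pow_integral_finite_iff[of u p] by simp

lemma integrable_au: "integrable lborel (\<lambda>x. a x * \<bar>u x\<bar> powr p)"
proof (rule Bochner_Integration.integrable_bound)
  show "integrable lborel (\<lambda>x. aM * \<bar>u x\<bar> powr p)" using integrable_u by simp
  show "AE x in lborel. norm (a x * \<bar>u x\<bar> powr p) \<le> norm (aM * \<bar>u x\<bar> powr p)"
    using a_upper a_pos aM by (intro AE_I2) (auto simp: abs_mult intro!: mult_right_mono simp: less_imp_le)
qed measurable

lemma f_ng: "pow_integral p (\<lambda>x. norm (g x)) < \<infinity>" using fg by (simp add: pow_integral_def)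

text \<open>The solution itself is an admissible test function because \<open>\<bar>u\<bar> powr (pc - 1)\<close> lies in the dual of \<open>L^p\<close>.\<close>

lemma energy_identity:
  "(LINT x|lborel. norm (g x) powr p) + (LINT x|lborel. a x * \<bar>u x\<bar> powr p) = (LINT x|lborel. \<bar>u x\<bar> powr pc)"
proof -
  have I1: "integrable lborel (\<lambda>x. norm (g x) powr (p - 1) * majorant x)"
    using integrable_powr_mult[OF p1 _ majorant_meas f_ng majorant_finite] majorant_nonneg by simp
  have I2: "integrable lborel (\<lambda>x. \<bar>u x\<bar> powr (p - 1) * majorant x)"
    using integrable_powr_mult[OF p1 _ majorant_meas fu majorant_finite] majorant_nonneg by simp
  have I3: "integrable lborel (\<lambda>x. \<bar>u x\<bar> powr (pc - 1) * majorant x)"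
    using integrable_critical[OF majorant_meas majorant_finite] majorant_nonneg by simp
  have uu: "\<bar>u x\<bar> powr (q - 2) * u x * u x = \<bar>u x\<bar> powr q" for q x
    using powr_norm_inner_self[of "u x" q] by (simp add: mult.assoc)
  have uu': "a x * \<bar>u x\<bar> powr (p - 2) * u x * u x = a x * \<bar>u x\<bar> powr p" for x
    using uu[of x p] by (simp add: mult.assoc)
  show ?thesis
    using weak_eq_limit(4)[OF approx_test meas(1) meas(2) majorant_meas majorant_meas approx_tendsto grad_approx_tendsto approx_le grad_approx_le I1 I2 I3]
    by (simp add: powr_norm_inner_self uu uu')
qed

text \<open>The critical nonlinearity of the equation.\<close>

definition nonlin :: "real \<Rightarrow> real" where "nonlin s = \<bar>s\<bar> powr (pc - 2) * s"

lemma nonlin_meas [measurable]: "nonlin \<in> borel_measurable borel"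
  unfolding nonlin_def by measurable

lemma abs_nonlin: "\<bar>nonlin s\<bar> = \<bar>s\<bar> powr (pc - 1)"
  unfolding nonlin_def using norm_powr_scaleR[of s pc] by simp

text \<open>The equation tested with \<open>\<eta> (u(\<mu> x) - u x)\<close>. The majorant for the approximating test functions combines
the majorant of \<open>u\<close> with its dilation.\<close>

lemma dilated_test:
  assumes t\<eta>: "test_function \<eta>" and \<mu>: "\<mu> \<ge> 1"
  defines "\<Phi> \<equiv> \<lambda>x. \<eta> x * (u (\<mu> *\<^sub>R x) - u x)"
    and "\<Gamma> \<equiv> \<lambda>x. \<eta> x *\<^sub>R (\<mu> *\<^sub>R g (\<mu> *\<^sub>R x) - g x) + (u (\<mu> *\<^sub>R x) - u x) *\<^sub>R grad \<eta> x"
  shows "integrable lborel (\<lambda>x. norm (g x) powr (p - 2) * (g x \<bullet> \<Gamma> x))"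
    and "integrable lborel (\<lambda>x. a x * \<bar>u x\<bar> powr (p - 2) * u x * \<Phi> x)"
    and "integrable lborel (\<lambda>x. nonlin (u x) * \<Phi> x)"
    and "(LINT x|lborel. norm (g x) powr (p - 2) * (g x \<bullet> \<Gamma> x)) + (LINT x|lborel. a x * \<bar>u x\<bar> powr (p - 2) * u x * \<Phi> x)
      = (LINT x|lborel. nonlin (u x) * \<Phi> x)"
proof -
  have pge: "p \<ge> 1" using p1 by simp
  have s\<eta>: "smooth \<eta>" using t\<eta> by (rule test_function_smooth)
  have s_approx: "smooth (approx n)" for n using approx_test by (rule test_function_smooth)
  note [measurable] = smooth_measurable[OF s\<eta>] smooth_grad_measurable[OF s\<eta>]
  obtain R where R: "R > 0" "\<And>x. norm x > R \<Longrightarrow> \<eta> x = 0" using test_function_support[OF t\<eta>] by blast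
  obtain K1 where K1: "K1 > 0" "\<And>x. norm (\<eta> x) \<le> K1"
    using bounded_continuous_support[OF smooth_continuous[OF s\<eta>] R(2)] by blast
  obtain K2 where K2: "K2 > 0" "\<And>x. norm (grad \<eta> x) \<le> K2"
    using bounded_continuous_support[OF smooth_grad_continuous[OF s\<eta>] grad_zero_outside[of R \<eta>, OF R(2)]] by blast
  define K where "K = max K1 K2"
  have K: "K > 0" "\<And>x. \<bar>\<eta> x\<bar> \<le> K" "\<And>x. norm (grad \<eta> x) \<le> K"
    using K1 K2 unfolding K_def by (auto intro: order_trans simp: le_max_iff_disj)
  define Hs where "Hs x = \<mu> * majorant (\<mu> *\<^sub>R x) + majorant x" for x
  have [measurable]: "Hs \<in> borel_measurable borel" unfolding Hs_def by measurable
  have Hs0: "Hs x \<ge> 0" for x using majorant_nonneg \<mu> by (simp add: Hs_def)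
  have Hs1: "majorant (\<mu> *\<^sub>R x) + majorant x \<le> Hs x" for x using majorant_nonneg[of "\<mu> *\<^sub>R x"] \<mu> by (simp add: Hs_def mult_le_cancel_right1)
  have fHs: "pow_integral p Hs < \<infinity>"
  proof -
    have "pow_integral p (\<lambda>x. majorant (\<mu> *\<^sub>R x)) = ennreal (1 / \<bar>\<mu>\<bar> ^ DIM(real^'n)) * pow_integral p majorant"
      using nn_integral_affine[of "\<lambda>x. ennreal (norm (majorant x) powr p)" \<mu> 0] \<mu> by (simp add: pow_integral_def)
    hence 1: "pow_integral p (\<lambda>x. majorant (\<mu> *\<^sub>R x)) < \<infinity>" using majorant_finite by (simp add: ennreal_mult_less_top)
    have "pow_integral p (\<lambda>x. \<mu> *\<^sub>R majorant (\<mu> *\<^sub>R x)) = ennreal (\<bar>\<mu>\<bar> powr p) * pow_integral p (\<lambda>x. majorant (\<mu> *\<^sub>R x))" by (rule pow_integral_cmult) measurable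
    hence 2: "pow_integral p (\<lambda>x. \<mu> * majorant (\<mu> *\<^sub>R x)) < \<infinity>" using 1 by (simp add: ennreal_mult_less_top)
    have "pow_integral p Hs \<le> ennreal (2 powr p) * (pow_integral p (\<lambda>x. \<mu> * majorant (\<mu> *\<^sub>R x)) + pow_integral p majorant)"
      unfolding Hs_def using pge by (intro pow_integral_add_le) auto
    also have "\<dots> < \<infinity>" using 2 majorant_finite by (simp add: ennreal_mult_less_top)
    finally show ?thesis .
  qed
  define \<phi>' where "\<phi>' n x = \<eta> x * (approx n (\<mu> *\<^sub>R x + 0) - approx n x)" for n x
  have sd: "smooth (\<lambda>x. approx n (\<mu> *\<^sub>R x + 0) - approx n x)" for n by (intro smooth_diff smooth_affine s_approx)
  have t: "test_function (\<phi>' n)" for n unfolding \<phi>'_def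
    by (rule test_functionI[OF smooth_mult[OF s\<eta> sd], of R]) (simp add: R)
  have gr: "grad (\<phi>' n) x = \<eta> x *\<^sub>R (\<mu> *\<^sub>R grad (approx n) (\<mu> *\<^sub>R x + 0) - grad (approx n) x) + (approx n (\<mu> *\<^sub>R x + 0) - approx n x) *\<^sub>R grad \<eta> x" for n x
    unfolding \<phi>'_def grad_mult[OF s\<eta> sd] grad_diff[OF smooth_affine[OF s_approx] s_approx] grad_affine[OF s_approx] ..
  have \<mu>0: "\<mu> \<noteq> 0" using \<mu> by simp
  note approx_tendsto' = AE_affine[OF approx_tendsto \<mu>0, of 0] and grad_approx_tendsto' = AE_affine[OF grad_approx_tendsto \<mu>0, of 0] and approx_le' = AE_affine[OF approx_le \<mu>0, of 0] and grad_approx_le' = AE_affine[OF grad_approx_le \<mu>0, of 0]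
  have [measurable]: "\<Phi> \<in> borel_measurable borel" "\<Gamma> \<in> borel_measurable borel" unfolding \<Phi>_def \<Gamma>_def by measurable
  have L1: "AE x in lborel. (\<lambda>n. \<phi>' n x) \<longlonglongrightarrow> \<Phi> x"
    using approx_tendsto approx_tendsto' unfolding \<phi>'_def \<Phi>_def by eventually_elim (auto intro!: tendsto_intros)
  have L2: "AE x in lborel. (\<lambda>n. grad (\<phi>' n) x) \<longlonglongrightarrow> \<Gamma> x"
    using approx_tendsto approx_tendsto' grad_approx_tendsto grad_approx_tendsto' unfolding gr \<Gamma>_def by eventually_elim (auto intro!: tendsto_intros)
  have B1: "AE x in lborel. \<forall>n. \<bar>\<phi>' n x\<bar> \<le> K * Hs x"
    using approx_le approx_le'
  proof eventually_elim
    fix x assume *: "\<forall>n. \<bar>approx n x\<bar> \<le> majorant x" "\<forall>n. \<bar>approx n (\<mu> *\<^sub>R x + 0)\<bar> \<le> majorant (\<mu> *\<^sub>R x + 0)"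
    show "\<forall>n. \<bar>\<phi>' n x\<bar> \<le> K * Hs x"
    proof
      fix n
      have "\<bar>approx n (\<mu> *\<^sub>R x + 0) - approx n x\<bar> \<le> majorant (\<mu> *\<^sub>R x + 0) + majorant x"
        using *(1)[rule_format, of n] *(2)[rule_format, of n] by linarith
      also have "\<dots> \<le> Hs x" using Hs1[of x] by simp
      finally show "\<bar>\<phi>' n x\<bar> \<le> K * Hs x"
        unfolding \<phi>'_def abs_mult using K by (intro mult_mono) auto
    qed
  qed
  have B2: "AE x in lborel. \<forall>n. norm (grad (\<phi>' n) x) \<le> 2 * K * Hs x"
    using approx_le approx_le' grad_approx_le grad_approx_le'
  proof eventually_elim
    fix x assume *: "\<forall>n. \<bar>approx n x\<bar> \<le> majorant x" "\<forall>n. \<bar>approx n (\<mu> *\<^sub>R x + 0)\<bar> \<le> majorant (\<mu> *\<^sub>R x + 0)"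
      "\<forall>n. norm (grad (approx n) x) \<le> majorant x" "\<forall>n. norm (grad (approx n) (\<mu> *\<^sub>R x + 0)) \<le> majorant (\<mu> *\<^sub>R x + 0)"
    show "\<forall>n. norm (grad (\<phi>' n) x) \<le> 2 * K * Hs x"
    proof
      fix n
      have 1: "\<bar>approx n (\<mu> *\<^sub>R x + 0) - approx n x\<bar> \<le> Hs x"
        using *(1)[rule_format, of n] *(2)[rule_format, of n] Hs1[of x] unfolding add_0_right by linarith
      have "norm (\<mu> *\<^sub>R grad (approx n) (\<mu> *\<^sub>R x + 0) - grad (approx n) x) \<le> norm (\<mu> *\<^sub>R grad (approx n) (\<mu> *\<^sub>R x + 0)) + norm (grad (approx n) x)"
        by (rule norm_triangle_ineq4)
      also have "\<dots> \<le> \<mu> * majorant (\<mu> *\<^sub>R x + 0) + majorant x"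
        using * \<mu> by (intro add_mono) (auto intro!: mult_left_mono)
      finally have 2: "norm (\<mu> *\<^sub>R grad (approx n) (\<mu> *\<^sub>R x + 0) - grad (approx n) x) \<le> Hs x" by (simp add: Hs_def)
      have "norm (grad (\<phi>' n) x) \<le> norm (\<eta> x *\<^sub>R (\<mu> *\<^sub>R grad (approx n) (\<mu> *\<^sub>R x + 0) - grad (approx n) x)) + norm ((approx n (\<mu> *\<^sub>R x + 0) - approx n x) *\<^sub>R grad \<eta> x)"
        unfolding gr by (rule norm_triangle_ineq)
      also have "\<dots> \<le> K * Hs x + Hs x * K"
        unfolding norm_scaleR using K 1 2 Hs0[of x] by (intro add_mono mult_mono) auto
      finally show "norm (grad (\<phi>' n) x) \<le> 2 * K * Hs x" by simp
    qed
  qed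
  have mm: "Hs \<in> borel_measurable borel" by measurable
  have I1: "integrable lborel (\<lambda>x. norm (g x) powr (p - 1) * (2 * K * Hs x))"
    using integrable_mult_right[OF integrable_powr_mult[OF p1 _ mm f_ng fHs], of "2 * K"] Hs0 by (simp add: mult_ac)
  have I2: "integrable lborel (\<lambda>x. \<bar>u x\<bar> powr (p - 1) * (K * Hs x))"
    using integrable_mult_right[OF integrable_powr_mult[OF p1 _ mm fu fHs], of K] Hs0 by (simp add: mult_ac)
  have I3: "integrable lborel (\<lambda>x. \<bar>u x\<bar> powr (pc - 1) * (K * Hs x))"
    using integrable_mult_right[OF integrable_critical[OF mm fHs], of K] Hs0 by (simp add: mult_ac)
  have m1: "(\<lambda>x. 2 * K * Hs x) \<in> borel_measurable borel" and m2: "(\<lambda>x. K * Hs x) \<in> borel_measurable borel"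
    and m3: "\<Phi> \<in> borel_measurable borel" and m4: "\<Gamma> \<in> borel_measurable borel" by measurable
  note W = weak_eq_limit[OF t m3 m4 m1 m2 L1 L2 B1 B2 I1 I2 I3]
  show "integrable lborel (\<lambda>x. norm (g x) powr (p - 2) * (g x \<bullet> \<Gamma> x))" by (rule W(1))
  show "integrable lborel (\<lambda>x. a x * \<bar>u x\<bar> powr (p - 2) * u x * \<Phi> x)" by (rule W(2))
  show "integrable lborel (\<lambda>x. nonlin (u x) * \<Phi> x)" unfolding nonlin_def by (rule W(3))
  show "(LINT x|lborel. norm (g x) powr (p - 2) * (g x \<bullet> \<Gamma> x)) + (LINT x|lborel. a x * \<bar>u x\<bar> powr (p - 2) * u x * \<Phi> x)
      = (LINT x|lborel. nonlin (u x) * \<Phi> x)" unfolding nonlin_def by (rule W(4))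
qed

text \<open>On the support of the cutoff the point \<open>x\<close> moves by at most \<open>2 * R * (\<mu> - 1)\<close>, so after division by
\<open>R * (\<mu> - 1)\<close> the bound does not depend on \<open>R\<close> or \<open>\<mu>\<close>.\<close>

lemma dilation_displacement:
  assumes \<mu>: "\<mu> > 1" and R: "R > 0"
  defines "\<Delta> \<equiv> \<lambda>x. u (\<mu> *\<^sub>R x) - u x"
  shows "integrable lborel (\<lambda>x. (\<bar>\<Delta> x\<bar> / (R * (\<mu> - 1))) powr p * indicator (cball 0 (2 * R)) x)"
    and "(LINT x|lborel. (\<bar>\<Delta> x\<bar> / (R * (\<mu> - 1))) powr p * indicator (cball 0 (2 * R)) x) \<le> 2 powr p * (LINT x|lborel. norm (g x) powr p)"
proof -
  have pge: "p \<ge> 1" using p1 by simp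
  define B where "B = (\<mu> - 1) * (2 * R)"
  have B: "B > 0" using \<mu> R by (simp add: B_def)
  define s where "s = R * (\<mu> - 1)"
  have s: "s > 0" "B = 2 * s" using \<mu> R by (auto simp: s_def B_def)
  have [measurable]: "\<Delta> \<in> borel_measurable borel" unfolding \<Delta>_def by measurable
  have "(\<integral>\<^sup>+x. ennreal (\<bar>u (\<mu> *\<^sub>R x + 0) - u x\<bar> powr p) * indicator (cball 0 (2 * R)) x \<partial>lborel) \<le> ennreal (B powr p) * pow_integral p g"
  proof (rule displacement[OF pge test_function_smooth[OF approx_test] _ _ majorant_meas approx_tendsto grad_approx_tendsto grad_approx_le majorant_finite])
    fix x :: "real^'n" assume "x \<in> cball 0 (2 * R)"
    thus "norm ((\<mu> - 1) *\<^sub>R x + 0) \<le> B" using \<mu> unfolding B_def by (simp add: mult_left_mono)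
  qed (use \<mu> B in auto)
  also have "pow_integral p g = ennreal (LINT x|lborel. norm (g x) powr p)"
    unfolding pow_integral_def by (rule nn_integral_eq_integral[OF integrable_g]) simp
  finally have d: "(\<integral>\<^sup>+x. ennreal (\<bar>\<Delta> x\<bar> powr p) * indicator (cball 0 (2 * R)) x \<partial>lborel) \<le> ennreal (B powr p) * ennreal (LINT x|lborel. norm (g x) powr p)"
    by (simp add: \<Delta>_def)
  have sc: "(\<bar>\<Delta> x\<bar> / s) powr p = s powr - p * \<bar>\<Delta> x\<bar> powr p" for x
    using s by (simp add: powr_divide powr_minus_divide)
  have "(\<integral>\<^sup>+x. ennreal ((\<bar>\<Delta> x\<bar> / s) powr p * indicator (cball 0 (2 * R)) x) \<partial>lborel)
      = (\<integral>\<^sup>+x. ennreal (s powr - p) * (ennreal (\<bar>\<Delta> x\<bar> powr p) * indicator (cball 0 (2 * R)) x) \<partial>lborel)"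
    by (intro nn_integral_cong) (auto simp: indicator_def sc ennreal_mult[symmetric])
  also have "\<dots> = ennreal (s powr - p) * (\<integral>\<^sup>+x. ennreal (\<bar>\<Delta> x\<bar> powr p) * indicator (cball 0 (2 * R)) x \<partial>lborel)"
    by (rule nn_integral_cmult) measurable
  also have "\<dots> \<le> ennreal (s powr - p) * (ennreal (B powr p) * ennreal (LINT x|lborel. norm (g x) powr p))"
    by (intro mult_left_mono d) simp
  also have "\<dots> = ennreal (s powr - p * (B powr p * (LINT x|lborel. norm (g x) powr p)))"
    by (simp add: ennreal_mult)
  also have "s powr - p * (B powr p * (LINT x|lborel. norm (g x) powr p)) = 2 powr p * (LINT x|lborel. norm (g x) powr p)"
    using s by (simp add: powr_mult powr_minus)
  finally have le: "(\<integral>\<^sup>+x. ennreal ((\<bar>\<Delta> x\<bar> / s) powr p * indicator (cball 0 (2 * R)) x) \<partial>lborel) \<le> ennreal (2 powr p * (LINT x|lborel. norm (g x) powr p))" .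
  have int: "integrable lborel (\<lambda>x. (\<bar>\<Delta> x\<bar> / s) powr p * indicator (cball 0 (2 * R)) x)"
  proof (rule integrableI_bounded)
    show "(\<integral>\<^sup>+x. ennreal (norm ((\<bar>\<Delta> x\<bar> / s) powr p * indicator (cball 0 (2 * R)) x)) \<partial>lborel) < \<infinity>"
      using le_less_trans[OF le] by simp
  qed measurable
  thus "integrable lborel (\<lambda>x. (\<bar>\<Delta> x\<bar> / (R * (\<mu> - 1))) powr p * indicator (cball 0 (2 * R)) x)" unfolding s_def .
  have "ennreal (LINT x|lborel. (\<bar>\<Delta> x\<bar> / s) powr p * indicator (cball 0 (2 * R)) x) \<le> ennreal (2 powr p * (LINT x|lborel. norm (g x) powr p))"
    using le by (subst nn_integral_eq_integral[OF int, symmetric]) auto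
  thus "(LINT x|lborel. (\<bar>\<Delta> x\<bar> / (R * (\<mu> - 1))) powr p * indicator (cball 0 (2 * R)) x) \<le> 2 powr p * (LINT x|lborel. norm (g x) powr p)"
    unfolding s_def by (subst (asm) ennreal_le_iff) auto
qed

end

section \<open>The dilation inequality\<close>

lemma powr_negative_small:
  fixes K \<epsilon> s :: real
  assumes "K \<ge> 0" "\<epsilon> > 0" "s > 0"
  shows "\<exists>\<kappa>>0. K * \<kappa> powr (- s) \<le> \<epsilon>"
proof (intro exI[of _ "((K + 1) / \<epsilon>) powr (1 / s)"] conjI)
  show "((K + 1) / \<epsilon>) powr (1 / s) > 0" using assms by auto
  have eq: "(((K + 1) / \<epsilon>) powr (1 / s)) powr (- s) = \<epsilon> / (K + 1)"
    using assms by (simp add: powr_powr powr_minus_divide)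
  show "K * (((K + 1) / \<epsilon>) powr (1 / s)) powr (- s) \<le> \<epsilon>" unfolding eq using assms by (simp add: field_simps)
qed

text \<open>The difference quotients at the origin are eventually at least \<open>- (c + \<epsilon>)\<close>.\<close>

lemma right_derivative_lower_bound:
  fixes \<Phi> :: "real \<Rightarrow> real"
  assumes "\<Phi> 0 = 0" and D: "(\<Phi> has_real_derivative d) (at 0)"
    and ev: "\<And>\<epsilon>. \<epsilon> > 0 \<Longrightarrow> eventually (\<lambda>t. 0 \<le> \<Phi> t + t * (c + \<epsilon>)) (at_right 0)"
  shows "0 \<le> d + c"
proof -
  have "((\<lambda>t. \<Phi> t / t) \<longlongrightarrow> d) (at 0)" using D assms(1) by (simp add: has_field_derivative_iff)
  hence lim: "((\<lambda>t. \<Phi> t / t) \<longlongrightarrow> d) (at_right 0)" by (rule tendsto_mono[OF at_le, rotated]) simp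
  have "- c \<le> d"
  proof (rule field_le_epsilon)
    fix \<epsilon> :: real assume "\<epsilon> > 0"
    have "- (c + \<epsilon>) \<le> d"
    proof (rule tendsto_lowerbound[OF lim])
      show "\<forall>\<^sub>F t in at_right 0. - (c + \<epsilon>) \<le> \<Phi> t / t"
        using ev[OF \<open>\<epsilon> > 0\<close>] eventually_at_right_less[of 0]
        by eventually_elim (simp add: field_simps)
    qed simp
    thus "- c \<le> d + \<epsilon>" by simp
  qed
  thus ?thesis by simp
qed

lemma DERIV_one_plus_powr: "((\<lambda>t. (1 + t) powr c) has_real_derivative c) (at 0)"
proof -
  have "((\<lambda>t. (1 + t) powr c) has_real_derivative c * (1 + 0) powr (c - 1) * 1) (at 0)"
    by (rule DERIV_chain2[OF has_real_derivative_powr]) (auto intro!: derivative_eq_intros)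
  thus ?thesis by simp
qed

lemma cutoff_limits:
  fixes F :: "real ^ 'n \<Rightarrow> real"
  assumes \<eta>: "\<And>n::nat. cutoff_fn (real n + 1) L (\<eta> n)" and F: "integrable lborel F"
  shows "(\<lambda>n. LINT x|lborel. \<eta> n x * F x) \<longlonglongrightarrow> (LINT x|lborel. F x)"
    and "(\<lambda>n. LINT x|lborel. indicator (- ball 0 (real n + 1)) x * F x) \<longlonglongrightarrow> 0"
proof -
  have [measurable]: "F \<in> borel_measurable borel" using F by auto
  have [measurable]: "\<eta> n \<in> borel_measurable borel" for n
    using \<eta>[of n] by (auto simp: cutoff_fn_def intro!: smooth_measurable test_function_smooth)
  have r: "0 \<le> \<eta> n x \<and> \<eta> n x \<le> 1" for n x using \<eta>[of n] by (simp add: cutoff_fn_def)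
  show "(\<lambda>n. LINT x|lborel. \<eta> n x * F x) \<longlonglongrightarrow> (LINT x|lborel. F x)"
  proof (rule integral_dominated_convergence[where w = "\<lambda>x. norm (F x)"])
    show "AE x in lborel. (\<lambda>n. \<eta> n x * F x) \<longlonglongrightarrow> F x"
    proof (rule AE_I2, rule tendsto_eventually)
      fix x :: "real^'n"
      obtain M where M: "real M \<ge> norm x" using real_arch_simple by blast
      show "\<forall>\<^sub>F n in sequentially. \<eta> n x * F x = F x"
        using eventually_ge_at_top[of M]
      proof eventually_elim
        fix n assume "n \<ge> M"
        hence "norm x \<le> real n + 1" using M by linarith
        thus "\<eta> n x * F x = F x" using \<eta>[of n] by (simp add: cutoff_fn_def)
      qed
    qed
    show "AE x in lborel. norm (\<eta> n x * F x) \<le> norm (F x)" for n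
      using r by (intro AE_I2) (simp add: abs_mult mult_left_le_one_le)
    show "(\<lambda>x. \<eta> n x * F x) \<in> borel_measurable lborel" for n by measurable
  qed (use F in auto)
  have "(\<lambda>n. LINT x|lborel. indicator (- ball 0 (real n + 1)) x * F x) \<longlonglongrightarrow> (LINT x|lborel. 0 * F x)"
  proof (rule integral_dominated_convergence[where w = "\<lambda>x. norm (F x)"])
    show "AE x in lborel. (\<lambda>n. indicator (- ball 0 (real n + 1)) x * F x) \<longlonglongrightarrow> 0 * F x"
    proof (rule AE_I2, rule tendsto_eventually)
      fix x :: "real^'n"
      obtain M where M: "real M \<ge> norm x" using real_arch_simple by blast
      show "\<forall>\<^sub>F n in sequentially. indicator (- ball 0 (real n + 1)) x * F x = 0 * F x"
        using eventually_ge_at_top[of M]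
      proof eventually_elim
        fix n assume "n \<ge> M"
        hence "norm x < real n + 1" using M by linarith
        thus "indicator (- ball 0 (real n + 1)) x * F x = 0 * F x" by (simp add: indicator_def)
      qed
    qed
    show "AE x in lborel. norm (indicator (- ball 0 (real n + 1)) x * F x) \<le> norm (F x)" for n
      by (intro AE_I2) (simp add: indicator_def)
  qed (use F in auto)
  thus "(\<lambda>n. LINT x|lborel. indicator (- ball 0 (real n + 1)) x * F x) \<longlonglongrightarrow> 0" by simp
qed

context critical_solution
begin

abbreviation "p' \<equiv> p / (p - 1)"

text \<open>The dual integrability of the critical nonlinearity, the point where higher integrability enters.\<close>

lemma pow_integral_nonlin: "pow_integral p' (\<lambda>x. nonlin (u x)) < \<infinity>"
proof -
  have "(pc - 1) * p' = crit_ratio * p" by (simp add: crit_ratio_def)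
  hence "pow_integral p' (\<lambda>x. nonlin (u x)) = pow_integral (crit_ratio * p) u" by (simp add: pow_integral_def abs_nonlin powr_powr)
  thus ?thesis using high_integrability[OF crit_ratio(3)] by simp
qed

lemma p'_pos: "p' > 0" using p1 by simp

lemma integrable_nonlin_difference:
  assumes "\<mu> \<ge> 1"
  shows "integrable lborel (\<lambda>x. \<bar>nonlin (u (\<mu> *\<^sub>R x)) - nonlin (u x)\<bar> powr p')"
proof -
  have "pow_integral p' (\<lambda>x. nonlin (u (\<mu> *\<^sub>R x))) = ennreal (1 / \<bar>\<mu>\<bar> ^ DIM(real^'n)) * pow_integral p' (\<lambda>x. nonlin (u x))"
    using nn_integral_affine[of "\<lambda>x. ennreal (norm (nonlin (u x)) powr p')" \<mu> 0] assms by (simp add: pow_integral_def)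
  hence 1: "pow_integral p' (\<lambda>x. nonlin (u (\<mu> *\<^sub>R x))) < \<infinity>" using pow_integral_nonlin by (simp add: ennreal_mult_less_top)
  have "pow_integral p' (\<lambda>x. nonlin (u (\<mu> *\<^sub>R x)) + (- nonlin (u x))) \<le> ennreal (2 powr p') * (pow_integral p' (\<lambda>x. nonlin (u (\<mu> *\<^sub>R x))) + pow_integral p' (\<lambda>x. - nonlin (u x)))"
    using p'_pos by (intro pow_integral_add_le) (auto simp del: zero_less_divide_iff)
  also have "\<dots> < \<infinity>" using 1 pow_integral_nonlin by (simp add: pow_integral_def ennreal_mult_less_top)
  finally show ?thesis using pow_integral_finite_iff[of "\<lambda>x. nonlin (u (\<mu> *\<^sub>R x)) - nonlin (u x)" p'] by simp
qed

lemma nonlin_dilation_continuity: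
  assumes "\<epsilon> > 0"
  shows "\<exists>\<delta>>0. \<forall>\<mu>. 1 \<le> \<mu> \<and> \<mu> \<le> 1 + \<delta> \<longrightarrow> (LINT x|lborel. \<bar>nonlin (u (\<mu> *\<^sub>R x)) - nonlin (u x)\<bar> powr p') \<le> \<epsilon>"
proof -
  have m: "(\<lambda>x. nonlin (u x)) \<in> borel_measurable borel" by measurable
  obtain \<delta> where \<delta>: "\<delta> > 0" "\<And>c h. \<bar>c - 1\<bar> \<le> \<delta> \<and> norm h \<le> \<delta> \<Longrightarrow> pow_integral p' (\<lambda>x. nonlin (u (c *\<^sub>R x + h)) - nonlin (u x)) \<le> ennreal \<epsilon>"
    using pow_integral_affine_continuity[OF p'_pos m pow_integral_nonlin assms] by blast
  show ?thesis
  proof (intro exI[of _ \<delta>] conjI allI impI \<delta>(1))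
    fix \<mu> :: real assume \<mu>: "1 \<le> \<mu> \<and> \<mu> \<le> 1 + \<delta>"
    have "ennreal (LINT x|lborel. \<bar>nonlin (u (\<mu> *\<^sub>R x)) - nonlin (u x)\<bar> powr p') = pow_integral p' (\<lambda>x. nonlin (u (\<mu> *\<^sub>R x)) - nonlin (u x))"
      unfolding pow_integral_def using \<mu> by (subst nn_integral_eq_integral[OF integrable_nonlin_difference, symmetric]) auto
    also have "\<dots> \<le> ennreal \<epsilon>" using \<delta>(2)[of \<mu> 0] \<mu> \<delta>(1) by simp
    finally show "(LINT x|lborel. \<bar>nonlin (u (\<mu> *\<^sub>R x)) - nonlin (u x)\<bar> powr p') \<le> \<epsilon>"
      using assms by (subst (asm) ennreal_le_iff) auto
  qed
qed

lemma pc1: "pc > 1" using pc_gt p1 by linarith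

text \<open>The tested equation after convexity. The two error terms carry the factor \<open>\<mu> - 1\<close>: the first comes from
the gradient of the cutoff and lives outside the ball of radius \<open>R\<close>, the second from evaluating the
nonlinearity at \<open>u\<close> instead of \<open>u(\<mu> x)\<close> and vanishes as \<open>\<mu>\<close> tends to 1. The free weights \<open>\<kappa>\<close> and \<open>\<kappa>'\<close>
belong to Young's inequality.\<close>

lemma dilation_inequality:
  assumes \<eta>: "cutoff_fn R L \<eta>" and R: "R > 0" and L: "L > 0" and \<mu>: "1 < \<mu>" "\<mu> \<le> 2" and \<kappa>: "\<kappa> > 0" and \<kappa>': "\<kappa>' > 0"
  shows "0 \<le> (\<mu> powr p * (LINT x|lborel. \<eta> x * norm (g (\<mu> *\<^sub>R x)) powr p) - (LINT x|lborel. \<eta> x * norm (g x) powr p)) / p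
    + ((LINT x|lborel. \<eta> x * (a (\<mu> *\<^sub>R x) * \<bar>u (\<mu> *\<^sub>R x)\<bar> powr p)) - (LINT x|lborel. \<eta> x * (a x * \<bar>u x\<bar> powr p))) / p
    - ((LINT x|lborel. \<eta> x * \<bar>u (\<mu> *\<^sub>R x)\<bar> powr pc) - (LINT x|lborel. \<eta> x * \<bar>u x\<bar> powr pc)) / pc
    + (\<mu> - 1) * L * (\<kappa> powr p * (LINT x|lborel. indicator (- ball 0 R) x * norm (g x) powr p)
        + \<kappa> powr (- (p - 1) * p) * (2 powr p * (LINT x|lborel. norm (g x) powr p)))
    + (\<mu> - 1) * R * (\<kappa>' powr p * (LINT x|lborel. \<bar>nonlin (u (\<mu> *\<^sub>R x)) - nonlin (u x)\<bar> powr p')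
        + \<kappa>' powr (- (p - 1) * p) * (2 powr p * (LINT x|lborel. norm (g x) powr p)))"
proof -
  have t: "test_function \<eta>" and r: "\<And>x. 0 \<le> \<eta> x \<and> \<eta> x \<le> 1" and zero: "\<And>x. norm x \<ge> 2 * R \<Longrightarrow> \<eta> x = 0"
    and gL: "\<And>x. norm (grad \<eta> x) \<le> L / R"
    using \<eta> by (auto simp: cutoff_fn_def)
  have m1: "\<mu> \<ge> 1" using \<mu> by simp
  define A where "A = (LINT x|lborel. norm (g x) powr p)"
  define \<Delta> where "\<Delta> x = u (\<mu> *\<^sub>R x) - u x" for x
  define W where "W x = (\<bar>\<Delta> x\<bar> / (R * (\<mu> - 1))) powr p * indicator (cball 0 (2 * R)) x" for x
  define D where "D x = \<bar>nonlin (u (\<mu> *\<^sub>R x)) - nonlin (u x)\<bar>" for x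
  define \<Gamma> where "\<Gamma> x = \<eta> x *\<^sub>R (\<mu> *\<^sub>R g (\<mu> *\<^sub>R x) - g x) + \<Delta> x *\<^sub>R grad \<eta> x" for x
  define \<kappa>2 where "\<kappa>2 = \<kappa> powr (- (p - 1) * p)"
  define \<kappa>3 where "\<kappa>3 = \<kappa>' powr (- (p - 1) * p)"
  have iW: "integrable lborel (\<lambda>x. W x)" and W: "(LINT x|lborel. W x) \<le> 2 powr p * A"
    unfolding W_def \<Delta>_def A_def by (rule dilation_displacement[OF \<mu>(1) R])+
  have iD: "integrable lborel (\<lambda>x. D x powr p')" using integrable_nonlin_difference[OF m1] by (simp add: D_def)
  note test = dilated_test[OF t m1, folded \<Delta>_def, folded \<Gamma>_def]
  have cd: "integrable lborel (\<lambda>x. \<eta> x * F (\<mu> *\<^sub>R x))" "integrable lborel (\<lambda>x. \<eta> x * F x)"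
    if "integrable lborel F" "\<And>x. F x \<ge> 0" for F
    using cutoff_dilated_integral(1)[OF \<eta> R L that m1 \<mu>(2)] cutoff_dilated_integral(1)[OF \<eta> R L that, of 1] by auto
  have i1: "integrable lborel (\<lambda>x. \<eta> x * norm (g (\<mu> *\<^sub>R x)) powr p)" "integrable lborel (\<lambda>x. \<eta> x * norm (g x) powr p)"
    using cd[OF integrable_g] by auto
  have i2: "integrable lborel (\<lambda>x. \<eta> x * (a (\<mu> *\<^sub>R x) * \<bar>u (\<mu> *\<^sub>R x)\<bar> powr p))" "integrable lborel (\<lambda>x. \<eta> x * (a x * \<bar>u x\<bar> powr p))"
    using cd[OF integrable_au] a_pos by (simp_all add: less_imp_le)
  have i3: "integrable lborel (\<lambda>x. \<eta> x * \<bar>u (\<mu> *\<^sub>R x)\<bar> powr pc)" "integrable lborel (\<lambda>x. \<eta> x * \<bar>u x\<bar> powr pc)"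
    using cd[OF integrable_u_pc] by auto
  have i4: "integrable lborel (\<lambda>x. indicator (- ball 0 R) x * norm (g x) powr p)"
    by (rule Bochner_Integration.integrable_bound[OF integrable_g]) (auto simp: indicator_def)
  have pt: "norm (g x) powr (p - 2) * (g x \<bullet> \<Gamma> x) + a x * \<bar>u x\<bar> powr (p - 2) * u x * (\<eta> x * \<Delta> x) - nonlin (u x) * (\<eta> x * \<Delta> x)
     \<le> (\<mu> powr p * (\<eta> x * norm (g (\<mu> *\<^sub>R x)) powr p) - \<eta> x * norm (g x) powr p) / p
       + (\<eta> x * (a (\<mu> *\<^sub>R x) * \<bar>u (\<mu> *\<^sub>R x)\<bar> powr p) - \<eta> x * (a x * \<bar>u x\<bar> powr p)) / p
       - (\<eta> x * \<bar>u (\<mu> *\<^sub>R x)\<bar> powr pc - \<eta> x * \<bar>u x\<bar> powr pc) / pc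
       + (\<mu> - 1) * L * (\<kappa> powr p * (indicator (- ball 0 R) x * norm (g x) powr p) + \<kappa>2 * W x)
       + (\<mu> - 1) * R * (\<kappa>' powr p * D x powr p' + \<kappa>3 * W x)" for x
  proof -
    have e0: "\<eta> x \<ge> 0" "\<eta> x \<le> 1" using r by auto
    have W0: "W x \<ge> 0" by (simp add: W_def)
    have "norm (g x) powr (p - 2) * (g x \<bullet> \<Gamma> x)
        = \<eta> x * (norm (g x) powr (p - 2) * (g x \<bullet> (\<mu> *\<^sub>R g (\<mu> *\<^sub>R x) - g x))) + norm (g x) powr (p - 2) * (g x \<bullet> (\<Delta> x *\<^sub>R grad \<eta> x))"
      unfolding \<Gamma>_def inner_add_right by (simp add: ring_distribs mult_ac)
    also have "\<dots> \<le> \<eta> x * ((norm (\<mu> *\<^sub>R g (\<mu> *\<^sub>R x)) powr p - norm (g x) powr p) / p) + norm (g x) powr (p - 1) * (\<bar>\<Delta> x\<bar> * norm (grad \<eta> x))"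
    proof (rule add_mono)
      show "\<eta> x * (norm (g x) powr (p - 2) * (g x \<bullet> (\<mu> *\<^sub>R g (\<mu> *\<^sub>R x) - g x))) \<le> \<eta> x * ((norm (\<mu> *\<^sub>R g (\<mu> *\<^sub>R x)) powr p - norm (g x) powr p) / p)"
        by (intro mult_left_mono norm_powr_convex p1 e0)
      have "norm (g x) powr (p - 2) * (g x \<bullet> (\<Delta> x *\<^sub>R grad \<eta> x)) = (norm (g x) powr (p - 2) *\<^sub>R g x) \<bullet> (\<Delta> x *\<^sub>R grad \<eta> x)" by simp
      also have "\<dots> \<le> norm (norm (g x) powr (p - 2) *\<^sub>R g x) * norm (\<Delta> x *\<^sub>R grad \<eta> x)" by (rule norm_cauchy_schwarz)
      finally show "norm (g x) powr (p - 2) * (g x \<bullet> (\<Delta> x *\<^sub>R grad \<eta> x)) \<le> norm (g x) powr (p - 1) * (\<bar>\<Delta> x\<bar> * norm (grad \<eta> x))"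
        unfolding norm_powr_scaleR by simp
    qed
    also have "\<eta> x * ((norm (\<mu> *\<^sub>R g (\<mu> *\<^sub>R x)) powr p - norm (g x) powr p) / p)
        = (\<mu> powr p * (\<eta> x * norm (g (\<mu> *\<^sub>R x)) powr p) - \<eta> x * norm (g x) powr p) / p"
      using m1 by (simp add: powr_mult right_diff_distrib mult_ac)
    also have "norm (g x) powr (p - 1) * (\<bar>\<Delta> x\<bar> * norm (grad \<eta> x))
        \<le> (\<mu> - 1) * L * (\<kappa> powr p * (indicator (- ball 0 R) x * norm (g x) powr p) + \<kappa>2 * W x)"
    proof (cases "norm x < R \<or> norm x > 2 * R")
      case True
      hence "grad \<eta> x = 0" using cutoff_grad_inside[OF \<eta>] cutoff_grad_outside[OF \<eta>] by blast
      moreover have "0 \<le> \<kappa> powr p * (indicator (- ball 0 R) x * norm (g x) powr p) + \<kappa>2 * W x"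
        using W0 by (simp add: \<kappa>2_def)
      ultimately show ?thesis using \<mu> L by simp
    next
      case False
      define b where "b = \<bar>\<Delta> x\<bar> / (R * (\<mu> - 1))"
      have b: "b \<ge> 0" "\<bar>\<Delta> x\<bar> = R * (\<mu> - 1) * b" "W x = b powr p" using R \<mu> False by (auto simp: b_def W_def)
      have "norm (g x) powr (p - 1) * (\<bar>\<Delta> x\<bar> * norm (grad \<eta> x)) \<le> norm (g x) powr (p - 1) * (\<bar>\<Delta> x\<bar> * (L / R))"
        by (intro mult_left_mono gL) auto
      also have "\<dots> = (\<mu> - 1) * L * (norm (g x) powr (p - 1) * b)" using R unfolding b(2) by simp
      also have "\<dots> \<le> (\<mu> - 1) * L * (\<kappa> powr p * norm (g x) powr p + \<kappa>2 * b powr p)"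
        unfolding \<kappa>2_def using \<mu> L by (intro mult_left_mono weighted_Young p1 b \<kappa>) auto
      finally show ?thesis using False by (simp add: b(3))
    qed
    finally have X1: "norm (g x) powr (p - 2) * (g x \<bullet> \<Gamma> x) \<le> (\<mu> powr p * (\<eta> x * norm (g (\<mu> *\<^sub>R x)) powr p) - \<eta> x * norm (g x) powr p) / p
      + (\<mu> - 1) * L * (\<kappa> powr p * (indicator (- ball 0 R) x * norm (g x) powr p) + \<kappa>2 * W x)" by simp
    have "a x * \<bar>u x\<bar> powr (p - 2) * u x * (\<eta> x * \<Delta> x) = \<eta> x * (a x * (\<bar>u x\<bar> powr (p - 2) * u x * (u (\<mu> *\<^sub>R x) - u x)))"
      by (simp add: \<Delta>_def mult_ac)
    also have "\<dots> \<le> \<eta> x * (a x * ((\<bar>u (\<mu> *\<^sub>R x)\<bar> powr p - \<bar>u x\<bar> powr p) / p))"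
      using a_pos[of x] by (intro mult_left_mono abs_powr_convex p1 e0) auto
    also have "\<dots> = (\<eta> x * (a (\<mu> *\<^sub>R x) * \<bar>u (\<mu> *\<^sub>R x)\<bar> powr p) - \<eta> x * (a x * \<bar>u x\<bar> powr p)) / p"
      using a_dilation[of \<mu> x] m1 by (simp add: right_diff_distrib)
    finally have X2: "a x * \<bar>u x\<bar> powr (p - 2) * u x * (\<eta> x * \<Delta> x)
      \<le> (\<eta> x * (a (\<mu> *\<^sub>R x) * \<bar>u (\<mu> *\<^sub>R x)\<bar> powr p) - \<eta> x * (a x * \<bar>u x\<bar> powr p)) / p" .
    \<comment> \<open>Convexity has to be used at \<open>u(\<mu> x)\<close> here, since this term needs a lower bound; the exchange of
      the base point produces the error term.\<close>
    have X3: "- (nonlin (u x) * (\<eta> x * \<Delta> x)) \<le> - (\<eta> x * \<bar>u (\<mu> *\<^sub>R x)\<bar> powr pc - \<eta> x * \<bar>u x\<bar> powr pc) / pc + \<eta> x * (D x * \<bar>\<Delta> x\<bar>)"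
    proof -
      have "- (nonlin (u x) * \<Delta> x) = nonlin (u (\<mu> *\<^sub>R x)) * (u x - u (\<mu> *\<^sub>R x)) + (nonlin (u (\<mu> *\<^sub>R x)) - nonlin (u x)) * \<Delta> x"
        by (simp add: \<Delta>_def algebra_simps)
      also have "\<dots> \<le> (\<bar>u x\<bar> powr pc - \<bar>u (\<mu> *\<^sub>R x)\<bar> powr pc) / pc + D x * \<bar>\<Delta> x\<bar>"
      proof (rule add_mono)
        show "nonlin (u (\<mu> *\<^sub>R x)) * (u x - u (\<mu> *\<^sub>R x)) \<le> (\<bar>u x\<bar> powr pc - \<bar>u (\<mu> *\<^sub>R x)\<bar> powr pc) / pc"
          unfolding nonlin_def by (rule abs_powr_convex[OF pc1])
        show "(nonlin (u (\<mu> *\<^sub>R x)) - nonlin (u x)) * \<Delta> x \<le> D x * \<bar>\<Delta> x\<bar>" unfolding D_def by (metis abs_ge_self abs_mult)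
      qed
      finally have "\<eta> x * - (nonlin (u x) * \<Delta> x) \<le> \<eta> x * ((\<bar>u x\<bar> powr pc - \<bar>u (\<mu> *\<^sub>R x)\<bar> powr pc) / pc + D x * \<bar>\<Delta> x\<bar>)"
        by (rule mult_left_mono) (rule e0)
      also have "\<dots> = \<eta> x * ((\<bar>u x\<bar> powr pc - \<bar>u (\<mu> *\<^sub>R x)\<bar> powr pc) / pc) + \<eta> x * (D x * \<bar>\<Delta> x\<bar>)" by (rule distrib_left)
      also have "\<eta> x * ((\<bar>u x\<bar> powr pc - \<bar>u (\<mu> *\<^sub>R x)\<bar> powr pc) / pc) = - (\<eta> x * \<bar>u (\<mu> *\<^sub>R x)\<bar> powr pc - \<eta> x * \<bar>u x\<bar> powr pc) / pc"
        by (simp only: right_diff_distrib times_divide_eq_right minus_diff_eq)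
      finally show ?thesis by (simp only: mult_minus_right mult.left_commute)
    qed
    have X4: "\<eta> x * (D x * \<bar>\<Delta> x\<bar>) \<le> (\<mu> - 1) * R * (\<kappa>' powr p * D x powr p' + \<kappa>3 * W x)"
    proof (cases "norm x \<ge> 2 * R")
      case True
      have "0 \<le> \<kappa>' powr p * D x powr p' + \<kappa>3 * W x" using W0 by (simp add: \<kappa>3_def)
      thus ?thesis using True zero \<mu> R by simp
    next
      case False
      define b where "b = \<bar>\<Delta> x\<bar> / (R * (\<mu> - 1))"
      have b: "b \<ge> 0" "\<bar>\<Delta> x\<bar> = R * (\<mu> - 1) * b" "W x = b powr p" using R \<mu> False by (auto simp: b_def W_def)
      define c where "c = D x powr (1 / (p - 1))"
      have c: "c \<ge> 0" "c powr (p - 1) = D x" "c powr p = D x powr p'" using p1 by (auto simp: c_def powr_powr D_def)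
      have "\<eta> x * (D x * \<bar>\<Delta> x\<bar>) \<le> 1 * (D x * \<bar>\<Delta> x\<bar>)" using e0 by (intro mult_right_mono) (auto simp: D_def)
      also have "\<dots> = (\<mu> - 1) * R * (c powr (p - 1) * b)" unfolding b(2) c(2) by simp
      also have "\<dots> \<le> (\<mu> - 1) * R * (\<kappa>' powr p * c powr p + \<kappa>3 * b powr p)"
        unfolding \<kappa>3_def using \<mu> R by (intro mult_left_mono weighted_Young p1 b c \<kappa>') auto
      finally show ?thesis by (simp only: b(3) c(3))
    qed
    show ?thesis using X1 X2 X3 X4 by linarith
  qed
  have "0 = (LINT x|lborel. norm (g x) powr (p - 2) * (g x \<bullet> \<Gamma> x) + a x * \<bar>u x\<bar> powr (p - 2) * u x * (\<eta> x * \<Delta> x) - nonlin (u x) * (\<eta> x * \<Delta> x))"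
    using test by simp
  also have "\<dots> \<le> (LINT x|lborel. (\<mu> powr p * (\<eta> x * norm (g (\<mu> *\<^sub>R x)) powr p) - \<eta> x * norm (g x) powr p) / p
       + (\<eta> x * (a (\<mu> *\<^sub>R x) * \<bar>u (\<mu> *\<^sub>R x)\<bar> powr p) - \<eta> x * (a x * \<bar>u x\<bar> powr p)) / p
       - (\<eta> x * \<bar>u (\<mu> *\<^sub>R x)\<bar> powr pc - \<eta> x * \<bar>u x\<bar> powr pc) / pc
       + (\<mu> - 1) * L * (\<kappa> powr p * (indicator (- ball 0 R) x * norm (g x) powr p) + \<kappa>2 * W x)
       + (\<mu> - 1) * R * (\<kappa>' powr p * D x powr p' + \<kappa>3 * W x))"
    by (rule integral_mono[OF _ _ pt])
       (intro Bochner_Integration.integrable_add Bochner_Integration.integrable_diff integrable_divide_zero integrable_mult_right impI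
          test(1-3) i1 i2 i3 i4 iW iD)+
  also have "\<dots> = (\<mu> powr p * (LINT x|lborel. \<eta> x * norm (g (\<mu> *\<^sub>R x)) powr p) - (LINT x|lborel. \<eta> x * norm (g x) powr p)) / p
    + ((LINT x|lborel. \<eta> x * (a (\<mu> *\<^sub>R x) * \<bar>u (\<mu> *\<^sub>R x)\<bar> powr p)) - (LINT x|lborel. \<eta> x * (a x * \<bar>u x\<bar> powr p))) / p
    - ((LINT x|lborel. \<eta> x * \<bar>u (\<mu> *\<^sub>R x)\<bar> powr pc) - (LINT x|lborel. \<eta> x * \<bar>u x\<bar> powr pc)) / pc
    + (\<mu> - 1) * L * (\<kappa> powr p * (LINT x|lborel. indicator (- ball 0 R) x * norm (g x) powr p) + \<kappa>2 * (LINT x|lborel. W x))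
    + (\<mu> - 1) * R * (\<kappa>' powr p * (LINT x|lborel. D x powr p') + \<kappa>3 * (LINT x|lborel. W x))"
    using i1 i2 i3 i4 iW iD by (simp del: times_divide_eq_right add: Bochner_Integration.integral_add Bochner_Integration.integral_diff)
  also have "\<dots> \<le> (\<mu> powr p * (LINT x|lborel. \<eta> x * norm (g (\<mu> *\<^sub>R x)) powr p) - (LINT x|lborel. \<eta> x * norm (g x) powr p)) / p
    + ((LINT x|lborel. \<eta> x * (a (\<mu> *\<^sub>R x) * \<bar>u (\<mu> *\<^sub>R x)\<bar> powr p)) - (LINT x|lborel. \<eta> x * (a x * \<bar>u x\<bar> powr p))) / p
    - ((LINT x|lborel. \<eta> x * \<bar>u (\<mu> *\<^sub>R x)\<bar> powr pc) - (LINT x|lborel. \<eta> x * \<bar>u x\<bar> powr pc)) / pc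
    + (\<mu> - 1) * L * (\<kappa> powr p * (LINT x|lborel. indicator (- ball 0 R) x * norm (g x) powr p) + \<kappa>2 * (2 powr p * A))
    + (\<mu> - 1) * R * (\<kappa>' powr p * (LINT x|lborel. D x powr p') + \<kappa>3 * (2 powr p * A))"
    using W \<mu> L R by (intro add_mono order_refl mult_left_mono) (auto simp: \<kappa>2_def \<kappa>3_def)
  finally show ?thesis unfolding A_def D_def \<kappa>2_def \<kappa>3_def .
qed

end

section \<open>The Pohozaev inequality\<close>

context critical_solution
begin

text \<open>Divide the dilation inequality by \<open>\<mu> - 1\<close> and let \<open>\<mu>\<close> decrease to 1. For given \<open>\<epsilon>\<close> the weight \<open>\<kappa>'\<close> is
chosen first, to make the displacement part of the nonlinear error small, and then \<open>\<mu>\<close>, to make the rest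
of it small.\<close>

lemma cutoff_pohozaev:
  assumes \<eta>: "cutoff_fn R L \<eta>" and R: "R > 0" and L: "L > 0" and \<kappa>: "\<kappa> > 0"
  shows "0 \<le> ((p - N) * (LINT x|lborel. \<eta> x * norm (g x) powr p) + 4 * L * (LINT x|lborel. indicator (- ball 0 R) x * norm (g x) powr p)) / p
    + (4 * L * (LINT x|lborel. indicator (- ball 0 R) x * (a x * \<bar>u x\<bar> powr p)) - N * (LINT x|lborel. \<eta> x * (a x * \<bar>u x\<bar> powr p))) / p
    + N * (LINT x|lborel. \<eta> x * \<bar>u x\<bar> powr pc) / pc
    + L * (\<kappa> powr p * (LINT x|lborel. indicator (- ball 0 R) x * norm (g x) powr p)
        + \<kappa> powr (- (p - 1) * p) * (2 powr p * (LINT x|lborel. norm (g x) powr p)))"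
proof -
  define A0 where "A0 = (LINT x|lborel. norm (g x) powr p)"
  define A1 where "A1 = (LINT x|lborel. \<eta> x * norm (g x) powr p)"
  define B1 where "B1 = (LINT x|lborel. \<eta> x * (a x * \<bar>u x\<bar> powr p))"
  define C1 where "C1 = (LINT x|lborel. \<eta> x * \<bar>u x\<bar> powr pc)"
  define \<alpha> where "\<alpha> = (LINT x|lborel. indicator (- ball 0 R) x * norm (g x) powr p)"
  define \<beta> where "\<beta> = (LINT x|lborel. indicator (- ball 0 R) x * (a x * \<bar>u x\<bar> powr p))"
  define c where "c = L * (\<kappa> powr p * \<alpha> + \<kappa> powr (- (p - 1) * p) * (2 powr p * A0))"
  define \<Phi> where "\<Phi> t = ((1 + t) powr (p - N) * (A1 + 4 * L * t * \<alpha>) - A1) / p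
      + ((1 + t) powr (- N) * (B1 + 4 * L * t * \<beta>) - B1) / p - ((1 + t) powr (- N) * C1 - C1) / pc" for t
  define d where "d = ((p - N) * A1 + 4 * L * \<alpha>) / p + (4 * L * \<beta> - N * B1) / p + N * C1 / pc"
  have A0: "A0 \<ge> 0" by (simp add: A0_def)
  have pp: "p > 0" and pcp: "pc > 0" using p1 pc1 by auto
  have mN: "1 / \<mu> ^ CARD('n) = \<mu> powr (- N)" if "\<mu> > 0" for \<mu> :: real
    using that by (simp add: N powr_minus_divide powr_realpow)
  have "0 \<le> d + c"
  proof (rule right_derivative_lower_bound[where \<Phi> = \<Phi>])
    show "\<Phi> 0 = 0" by (simp add: \<Phi>_def)
    have lin: "((\<lambda>t. X + 4 * L * t * Y) has_real_derivative 4 * L * Y) (at 0)" for X Y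
      by (auto intro!: derivative_eq_intros)
    have "((\<lambda>t. (1 + t) powr q * (X + 4 * L * t * Y)) has_real_derivative q * X + 4 * L * Y) (at 0)" for q X Y
      using DERIV_mult[OF DERIV_one_plus_powr[of q] lin[of X Y]] by (simp add: mult.commute)
    note D = this
    have D3: "((\<lambda>t. (1 + t) powr (- N) * C1) has_real_derivative (- N) * C1) (at 0)"
      using D[of "- N" C1 0] by simp
    have "(\<Phi> has_real_derivative (((p - N) * A1 + 4 * L * \<alpha>) - 0) / p + (((- N) * B1 + 4 * L * \<beta>) - 0) / p - ((- N) * C1 - 0) / pc) (at 0)"
      unfolding \<Phi>_def
      by (intro DERIV_add DERIV_diff DERIV_cdivide D D3 DERIV_const)
    thus "(\<Phi> has_real_derivative d) (at 0)" by (simp add: d_def diff_divide_distrib add_divide_distrib)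
    fix \<epsilon> :: real assume \<epsilon>: "\<epsilon> > 0"
    obtain \<kappa>' where \<kappa>': "\<kappa>' > 0" "R * (2 powr p * A0) * \<kappa>' powr (- ((p - 1) * p)) \<le> \<epsilon> / 2"
      using powr_negative_small[of "R * (2 powr p * A0)" "\<epsilon> / 2" "(p - 1) * p"] \<epsilon> R A0 p1 by auto
    define \<epsilon>2 where "\<epsilon>2 = \<epsilon> / (2 * R * \<kappa>' powr p)"
    have \<epsilon>2: "\<epsilon>2 > 0" "R * (\<kappa>' powr p * \<epsilon>2) = \<epsilon> / 2" using \<epsilon> R \<kappa>' by (auto simp: \<epsilon>2_def field_simps)
    obtain \<delta> where \<delta>: "\<delta> > 0" "\<And>\<mu>. 1 \<le> \<mu> \<and> \<mu> \<le> 1 + \<delta> \<Longrightarrow> (LINT x|lborel. \<bar>nonlin (u (\<mu> *\<^sub>R x)) - nonlin (u x)\<bar> powr p') \<le> \<epsilon>2"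
      using nonlin_dilation_continuity[OF \<epsilon>2(1)] by blast
    have main: "0 \<le> \<Phi> t + t * (c + \<epsilon>)" if t: "0 < t" "t < min 1 \<delta>" for t
    proof -
      define \<mu> where "\<mu> = 1 + t"
      have \<mu>: "1 < \<mu>" "\<mu> \<le> 2" "1 \<le> \<mu>" "\<mu> > 0" using t by (auto simp: \<mu>_def)
      define E where "E = (LINT x|lborel. \<bar>nonlin (u (\<mu> *\<^sub>R x)) - nonlin (u x)\<bar> powr p')"
      have E: "E \<le> \<epsilon>2" unfolding E_def by (rule \<delta>(2)) (use t in \<open>auto simp: \<mu>_def\<close>)
      define S1 where "S1 = (LINT x|lborel. \<eta> x * norm (g (\<mu> *\<^sub>R x)) powr p)"
      define S2 where "S2 = (LINT x|lborel. \<eta> x * (a (\<mu> *\<^sub>R x) * \<bar>u (\<mu> *\<^sub>R x)\<bar> powr p))"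
      define S3 where "S3 = (LINT x|lborel. \<eta> x * \<bar>u (\<mu> *\<^sub>R x)\<bar> powr pc)"
      have ineq: "0 \<le> (\<mu> powr p * S1 - A1) / p + (S2 - B1) / p - (S3 - C1) / pc
        + (\<mu> - 1) * L * (\<kappa> powr p * \<alpha> + \<kappa> powr (- (p - 1) * p) * (2 powr p * A0))
        + (\<mu> - 1) * R * (\<kappa>' powr p * E + \<kappa>' powr (- (p - 1) * p) * (2 powr p * A0))"
        using dilation_inequality[OF \<eta> R L \<mu>(1,2) \<kappa> \<kappa>'(1)]
        unfolding A0_def A1_def B1_def C1_def S1_def S2_def S3_def \<alpha>_def E_def .
      have "S1 \<le> (A1 + 4 * L * (\<mu> - 1) * \<alpha>) / \<mu> ^ CARD('n)"
        unfolding S1_def A1_def \<alpha>_def by (rule cutoff_dilated_integral(3)[OF \<eta> R L integrable_g _ \<mu>(3,2)]) simp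
      also have "\<dots> = \<mu> powr (- N) * (A1 + 4 * L * t * \<alpha>)" using mN[OF \<mu>(4)] by (simp add: \<mu>_def divide_inverse mult.commute)
      finally have "\<mu> powr p * S1 \<le> \<mu> powr p * (\<mu> powr (- N) * (A1 + 4 * L * t * \<alpha>))" by (rule mult_left_mono) simp
      also have "\<dots> = (\<mu> powr p * \<mu> powr (- N)) * (A1 + 4 * L * t * \<alpha>)" by (simp only: mult.assoc)
      also have "\<mu> powr p * \<mu> powr (- N) = \<mu> powr (p - N)" by (simp add: powr_add[symmetric])
      finally have s1: "(\<mu> powr p * S1 - A1) / p \<le> (\<mu> powr (p - N) * (A1 + 4 * L * t * \<alpha>) - A1) / p"
        using pp by (intro divide_right_mono) auto
      have "S2 \<le> (B1 + 4 * L * (\<mu> - 1) * \<beta>) / \<mu> ^ CARD('n)"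
        unfolding S2_def B1_def \<beta>_def
        by (rule cutoff_dilated_integral(3)[OF \<eta> R L integrable_au _ \<mu>(3,2)]) (simp add: a_pos less_imp_le)
      also have "\<dots> = \<mu> powr (- N) * (B1 + 4 * L * t * \<beta>)" using mN[OF \<mu>(4)] by (simp add: \<mu>_def divide_inverse mult.commute)
      finally have s2: "(S2 - B1) / p \<le> (\<mu> powr (- N) * (B1 + 4 * L * t * \<beta>) - B1) / p"
        using pp by (intro divide_right_mono) auto
      have "\<mu> powr (- N) * C1 = C1 / \<mu> ^ CARD('n)" using mN[OF \<mu>(4)] by (simp add: divide_inverse mult.commute)
      also have "\<dots> \<le> S3"
        unfolding S3_def C1_def by (rule cutoff_dilated_integral(2)[OF \<eta> R L integrable_u_pc _ \<mu>(3,2)]) simp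
      finally have s3: "(\<mu> powr (- N) * C1 - C1) / pc \<le> (S3 - C1) / pc"
        using pcp by (intro divide_right_mono) auto
      have "R * (\<kappa>' powr p * E + \<kappa>' powr (- (p - 1) * p) * (2 powr p * A0)) = R * (\<kappa>' powr p * E) + R * (2 powr p * A0) * \<kappa>' powr (- ((p - 1) * p))"
        unfolding mult_minus_left by (simp only: distrib_left mult_ac)
      also have "\<dots> \<le> R * (\<kappa>' powr p * \<epsilon>2) + \<epsilon> / 2"
        using R E \<kappa>'(2) by (intro add_mono mult_left_mono) auto
      also have "\<dots> = \<epsilon>" using \<epsilon>2(2) by simp
      finally have "t * (R * (\<kappa>' powr p * E + \<kappa>' powr (- (p - 1) * p) * (2 powr p * A0))) \<le> t * \<epsilon>"
        using t by (intro mult_left_mono) auto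
      hence s4: "(\<mu> - 1) * R * (\<kappa>' powr p * E + \<kappa>' powr (- (p - 1) * p) * (2 powr p * A0)) \<le> t * \<epsilon>"
        by (simp only: \<mu>_def mult.assoc add_diff_cancel_left')
      have s5: "(\<mu> - 1) * L * (\<kappa> powr p * \<alpha> + \<kappa> powr (- (p - 1) * p) * (2 powr p * A0)) = t * c"
        by (simp only: c_def \<mu>_def mult.assoc add_diff_cancel_left')
      have "\<Phi> t = (\<mu> powr (p - N) * (A1 + 4 * L * t * \<alpha>) - A1) / p
        + (\<mu> powr (- N) * (B1 + 4 * L * t * \<beta>) - B1) / p - (\<mu> powr (- N) * C1 - C1) / pc" by (simp only: \<Phi>_def \<mu>_def)
      hence "0 \<le> \<Phi> t + t * c + t * \<epsilon>" using ineq s1 s2 s3 s4 unfolding s5 by linarith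
      thus ?thesis by (simp add: distrib_left)
    qed
    have "min 1 \<delta> > 0" using \<delta>(1) by simp
    thus "\<forall>\<^sub>F t in at_right 0. 0 \<le> \<Phi> t + t * (c + \<epsilon>)"
      unfolding eventually_at_right_field using main by blast
  qed
  thus ?thesis unfolding d_def c_def A0_def A1_def B1_def C1_def \<alpha>_def \<beta>_def .
qed

text \<open>First \<open>R\<close> tends to infinity, so that the tails outside the ball vanish, then \<open>\<kappa>\<close> tends to infinity.\<close>

lemma pohozaev_inequality:
  "0 \<le> (p - N) / p * (LINT x|lborel. norm (g x) powr p) - N / p * (LINT x|lborel. a x * \<bar>u x\<bar> powr p)
     + N / pc * (LINT x|lborel. \<bar>u x\<bar> powr pc)"
proof -
  define A0 where "A0 = (LINT x|lborel. norm (g x) powr p)"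
  define B0 where "B0 = (LINT x|lborel. a x * \<bar>u x\<bar> powr p)"
  define C0 where "C0 = (LINT x|lborel. \<bar>u x\<bar> powr pc)"
  have A0: "A0 \<ge> 0" by (simp add: A0_def)
  obtain L where L: "L > 0" "\<forall>R>0. \<exists>\<eta> :: real ^ 'n \<Rightarrow> real. cutoff_fn R L \<eta>" using cutoff_fn_exists[where 'n='n] by blast
  have "\<forall>n. \<exists>\<eta> :: real ^ 'n \<Rightarrow> real. cutoff_fn (real n + 1) L \<eta>" using L(2) by simp
  from choice[OF this] obtain \<eta> :: "nat \<Rightarrow> real ^ 'n \<Rightarrow> real" where \<eta>': "\<forall>n. cutoff_fn (real n + 1) L (\<eta> n)" ..
  hence \<eta>: "\<And>n. cutoff_fn (real n + 1) L (\<eta> n)" by blast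
  have "0 \<le> ((p - N) * A0 + 4 * L * 0) / p + (4 * L * 0 - N * B0) / p + N * C0 / pc + L * (\<kappa> powr p * 0 + \<kappa> powr (- (p - 1) * p) * (2 powr p * A0))"
    if \<kappa>: "\<kappa> > 0" for \<kappa>
  proof (rule tendsto_lowerbound)
    show "(\<lambda>n. ((p - N) * (LINT x|lborel. \<eta> n x * norm (g x) powr p) + 4 * L * (LINT x|lborel. indicator (- ball 0 (real n + 1)) x * norm (g x) powr p)) / p
    + (4 * L * (LINT x|lborel. indicator (- ball 0 (real n + 1)) x * (a x * \<bar>u x\<bar> powr p)) - N * (LINT x|lborel. \<eta> n x * (a x * \<bar>u x\<bar> powr p))) / p
    + N * (LINT x|lborel. \<eta> n x * \<bar>u x\<bar> powr pc) / pc
    + L * (\<kappa> powr p * (LINT x|lborel. indicator (- ball 0 (real n + 1)) x * norm (g x) powr p)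
        + \<kappa> powr (- (p - 1) * p) * (2 powr p * A0)))
      \<longlonglongrightarrow> ((p - N) * A0 + 4 * L * 0) / p + (4 * L * 0 - N * B0) / p + N * C0 / pc + L * (\<kappa> powr p * 0 + \<kappa> powr (- (p - 1) * p) * (2 powr p * A0))"
      using p1 pc1 unfolding A0_def B0_def C0_def
      by (intro tendsto_intros cutoff_limits[OF \<eta>] integrable_g integrable_au integrable_u_pc) auto
    show "\<forall>\<^sub>F n in sequentially. 0 \<le> ((p - N) * (LINT x|lborel. \<eta> n x * norm (g x) powr p) + 4 * L * (LINT x|lborel. indicator (- ball 0 (real n + 1)) x * norm (g x) powr p)) / p
    + (4 * L * (LINT x|lborel. indicator (- ball 0 (real n + 1)) x * (a x * \<bar>u x\<bar> powr p)) - N * (LINT x|lborel. \<eta> n x * (a x * \<bar>u x\<bar> powr p))) / p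
    + N * (LINT x|lborel. \<eta> n x * \<bar>u x\<bar> powr pc) / pc
    + L * (\<kappa> powr p * (LINT x|lborel. indicator (- ball 0 (real n + 1)) x * norm (g x) powr p)
        + \<kappa> powr (- (p - 1) * p) * (2 powr p * A0))"
      unfolding A0_def by (intro always_eventually allI cutoff_pohozaev[OF \<eta> _ L(1) \<kappa>]) simp
  qed simp
  hence k: "0 \<le> (p - N) * A0 / p - N * B0 / p + N * C0 / pc + L * (2 powr p * A0) * \<kappa> powr (- ((p - 1) * p))" if "\<kappa> > 0" for \<kappa>
    using that unfolding mult_minus_left
    by (simp only: mult_zero_left mult_zero_right add_0_right add_0_left diff_0 minus_divide_left[symmetric] add_uminus_conv_diff mult_ac)
  have "0 \<le> (p - N) * A0 / p - N * B0 / p + N * C0 / pc"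
  proof (rule field_le_epsilon)
    fix \<epsilon> :: real assume "\<epsilon> > 0"
    then obtain \<kappa> where "\<kappa> > 0" "L * (2 powr p * A0) * \<kappa> powr (- ((p - 1) * p)) \<le> \<epsilon>"
      using powr_negative_small[of "L * (2 powr p * A0)" \<epsilon> "(p - 1) * p"] L(1) A0 p1 by auto
    thus "0 \<le> (p - N) * A0 / p - N * B0 / p + N * C0 / pc + \<epsilon>" using k[of \<kappa>] by linarith
  qed
  thus ?thesis by (simp only: A0_def B0_def C0_def times_divide_eq_left)
qed

text \<open>The Pohozaev inequality and the energy identity leave a nonpositive integral of \<open>a \<bar>u\<bar> powr p\<close>.\<close>

theorem solution_vanishes: "AE x in lborel. u x = 0"
proof -
  define A0 where "A0 = (LINT x|lborel. norm (g x) powr p)"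
  define B0 where "B0 = (LINT x|lborel. a x * \<bar>u x\<bar> powr p)"
  have Npc: "N / pc = (N - p) / p" using p1 pN by (simp add: field_simps)
  have "0 \<le> (p - N) / p * A0 - N / p * B0 + (N - p) / p * (A0 + B0)"
    using pohozaev_inequality energy_identity unfolding A0_def B0_def Npc by simp
  also have "\<dots> = - B0" using p1 by (simp add: field_simps)
  finally have "B0 \<le> 0" by simp
  moreover have nn: "AE x in lborel. 0 \<le> a x * \<bar>u x\<bar> powr p" using a_pos by (intro AE_I2) (simp add: less_imp_le)
  hence "B0 \<ge> 0" unfolding B0_def by (rule integral_nonneg_AE)
  ultimately have "B0 = 0" by simp
  hence "AE x in lborel. a x * \<bar>u x\<bar> powr p = 0"
    using integral_nonneg_eq_0_iff_AE[OF integrable_au nn] by (simp add: B0_def)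
  thus ?thesis
  proof eventually_elim
    fix x assume "a x * \<bar>u x\<bar> powr p = 0"
    thus "u x = 0" using a_pos[of x] by auto
  qed
qed

end

section \<open>From Lebesgue measurable to Borel functions\<close>

text \<open>Locally the function agrees with a differentiable function of the ambient space.\<close>

lemma C1_on_submanifold_continuous:
  fixes f :: "'a::euclidean_space \<Rightarrow> real"
  assumes "C1_on_submanifold M f"
  shows "continuous_on M f"
  unfolding continuous_on_eq_continuous_within
proof
  fix x assume x: "x \<in> M"
  from bspec[OF assms[unfolded C1_on_submanifold_def] x]
  obtain U F where UF: "open U \<and> x \<in> U \<and> Ck_on 1 U F \<and> (\<forall>y\<in>M \<inter> U. f y = F y)" by (elim exE)
  hence U: "open U" "x \<in> U" "\<And>y. y \<in> M \<inter> U \<Longrightarrow> f y = F y" by auto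
  have "F differentiable (at x)" using UF by simp
  hence "isCont F x" by (rule differentiable_imp_continuous_within)
  hence c: "continuous (at x within M) F" by (rule continuous_at_imp_continuous_at_within)
  have "\<forall>\<^sub>F y in at x within M. F y = f y"
    unfolding eventually_at_topological using U by (intro exI[of _ U]) auto
  hence "((\<lambda>y. f y) \<longlongrightarrow> F x) (at x within M)"
    using c unfolding continuous_within by (rule Lim_transform_eventually[rotated])
  thus "continuous (at x within M) f" using U(3)[of x] U(2) x by (simp add: continuous_within)
qed

lemma borel_representative:
  fixes f :: "'a::euclidean_space \<Rightarrow> real"
  assumes "f \<in> borel_measurable lebesgue"
  obtains f' where "f' \<in> borel_measurable borel" "AE x in lebesgue. f x = f' x"
proof -
  obtain f' where f': "f' \<in> borel_measurable lborel" "AE x in lborel. f x = f' x"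
    using completion_ex_borel_measurable_real[OF assms] by blast
  thus ?thesis using that[of f'] AE_completion by auto
qed

text \<open>Representatives are chosen componentwise.\<close>

lemma borel_representative_vec:
  fixes g :: "'a::euclidean_space \<Rightarrow> real ^ 'n"
  assumes "g \<in> borel_measurable lebesgue"
  obtains g' where "g' \<in> borel_measurable borel" "AE x in lebesgue. g x = g' x"
proof -
  have "\<forall>i. \<exists>h. h \<in> borel_measurable borel \<and> (AE x in lebesgue. g x $ i = h x)"
  proof
    fix i
    have "(\<lambda>x. g x \<bullet> axis i 1) \<in> borel_measurable lebesgue" using assms by measurable
    hence "(\<lambda>x. g x $ i) \<in> borel_measurable lebesgue" by (simp add: cart_eq_inner_axis)
    thus "\<exists>h. h \<in> borel_measurable borel \<and> (AE x in lebesgue. g x $ i = h x)"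
      by (rule borel_representative) blast
  qed
  from choice[OF this] obtain h where h: "\<forall>i. h i \<in> borel_measurable borel \<and> (AE x in lebesgue. g x $ i = h i x)" ..
  define g' where "g' x = (\<chi> i. h i x)" for x
  have "(\<lambda>x. g' x \<bullet> b) \<in> borel_measurable borel" if b: "b \<in> Basis" for b
  proof -
    obtain i where "b = axis i (1::real)" using b unfolding Basis_vec_def by auto
    thus ?thesis using h by (simp add: cart_eq_inner_axis[symmetric] g'_def)
  qed
  hence 1: "g' \<in> borel_measurable borel" by (rule borel_measurable_euclidean_space[THEN iffD2, rule_format])
  have "AE x in lebesgue. \<forall>i. g x $ i = h i x" using h by (subst AE_all_countable) auto
  hence 2: "AE x in lebesgue. g x = g' x" by (rule eventually_mono) (simp add: vec_eq_iff g'_def)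
  show ?thesis by (rule that[OF 1 2])
qed

text \<open>A pointwise limit of the integrable restrictions to growing balls.\<close>

lemma L1_loc_measurable:
  fixes f :: "real ^ 'n \<Rightarrow> 'b::euclidean_space"
  assumes "f \<in> L1_loc"
  shows "f \<in> borel_measurable lebesgue"
proof (rule borel_measurable_LIMSEQ_metric[where f = "\<lambda>n x. indicator (cball 0 (real n)) x *\<^sub>R f x"])
  show "(\<lambda>x. indicator (cball 0 (real n)) x *\<^sub>R f x) \<in> borel_measurable lebesgue" for n
    using assms unfolding L1_loc_def set_integrable_def by (auto intro!: borel_measurable_integrable)
  fix x :: "real^'n"
  obtain M where M: "real M \<ge> norm x" using real_arch_simple by blast
  have "\<forall>\<^sub>F n in sequentially. indicator (cball 0 (real n)) x *\<^sub>R f x = f x"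
    using eventually_ge_at_top[of M] by eventually_elim (use M in auto)
  thus "(\<lambda>n. indicator (cball 0 (real n)) x *\<^sub>R f x) \<longlonglongrightarrow> f x" by (rule tendsto_eventually)
qed

lemma locally_integrable_representative:
  fixes f :: "real ^ 'n \<Rightarrow> real"
  assumes int: "\<And>R. integrable lebesgue (\<lambda>x. indicator (cball 0 R) x * f x)" and [measurable]: "f' \<in> borel_measurable borel"
    and eq: "AE x in lebesgue. f x = f' x"
  shows "locally_integrable f'"
  unfolding locally_integrable_def
proof (intro conjI allI)
  fix R
  have m: "(\<lambda>x. indicator (cball 0 R) x * f' x) \<in> borel_measurable lborel" by measurable
  have "integrable lebesgue (\<lambda>x. indicator (cball 0 R) x * f' x)"
    by (rule integrable_cong_AE_imp[OF int[of R] measurable_completion[OF m]])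
       (use eq in eventually_elim, simp)
  thus "integrable lborel (\<lambda>x. indicator (cball 0 R) x * f' x)" by (simp add: integrable_completion[OF m])
qed auto

lemma integral_lebesgue_eq_lborel:
  fixes f f' :: "real ^ 'n \<Rightarrow> real"
  assumes f: "f \<in> borel_measurable lebesgue" and f': "f' \<in> borel_measurable borel" and eq: "AE x in lebesgue. f x = f' x"
  shows "(LINT x|lebesgue. f x) = (LINT x|lborel. f' x)"
proof -
  have m: "f' \<in> borel_measurable lborel" using f' by simp
  have "(LINT x|lebesgue. f x) = (LINT x|lebesgue. f' x)"
    by (rule integral_cong_AE[OF f measurable_completion[OF m] eq])
  thus ?thesis by (simp add: integral_completion[OF m])
qed

lemma weak_gradient_representative:
  fixes u :: "real ^ 'n \<Rightarrow> real"
  assumes w: "has_weak_gradient u g" and [measurable]: "u' \<in> borel_measurable borel" "g' \<in> borel_measurable borel"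
    and u: "AE x in lebesgue. u x = u' x" and g: "AE x in lebesgue. g x = g' x"
  shows "weak_gradient u' g'"
proof -
  have L: "u \<in> L1_loc" "g \<in> L1_loc" using w by (auto simp: has_weak_gradient_def)
  have [measurable]: "u \<in> borel_measurable lebesgue" "g \<in> borel_measurable lebesgue" using L by (auto intro: L1_loc_measurable)
  have comp: "(\<lambda>x. h x $ i) \<in> borel_measurable M" if h: "h \<in> borel_measurable M" for h :: "real^'n \<Rightarrow> real^'n" and i M
  proof -
    have "(\<lambda>x. h x \<bullet> axis i 1) \<in> borel_measurable M" using h by measurable
    thus ?thesis by (simp add: cart_eq_inner_axis)
  qed
  have gi: "AE x in lebesgue. g x $ i = g' x $ i" for i using g by eventually_elim simp
  have lu: "locally_integrable u'"
  proof (rule locally_integrable_representative[OF _ _ u])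
    show "integrable lebesgue (\<lambda>x. indicator (cball 0 R) x * u x)" for R
      using L(1) unfolding L1_loc_def set_integrable_def by auto
  qed measurable
  have lg: "locally_integrable (\<lambda>x. g' x $ i)" for i
  proof (rule locally_integrable_representative[OF _ _ gi])
    show "integrable lebesgue (\<lambda>x. indicator (cball 0 R) x * g x $ i)" for R
    proof -
      have "integrable lebesgue (\<lambda>x. indicator (cball 0 R) x *\<^sub>R g x)"
        using L(2) unfolding L1_loc_def set_integrable_def by auto
      hence "integrable lebesgue (\<lambda>x. (indicator (cball 0 R) x *\<^sub>R g x) \<bullet> axis i 1)" by (rule integrable_inner_left)
      thus ?thesis by (simp add: cart_eq_inner_axis)
    qed
    show "(\<lambda>x. g' x $ i) \<in> borel_measurable borel" by (rule comp) measurable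
  qed
  show ?thesis
    unfolding weak_gradient_def
  proof (intro conjI allI impI lu lg)
    fix \<phi> :: "real^'n \<Rightarrow> real" and i assume t: "test_function \<phi>"
    have sm: "smooth \<phi>" using t by (rule test_function_smooth)
    have mb: "\<phi> \<in> borel_measurable borel" "(\<lambda>x. grad \<phi> x $ i) \<in> borel_measurable borel"
      using smooth_measurable[OF sm] smooth_measurable[OF smooth_grad_component[OF sm]] by auto
    have ml: "\<phi> \<in> borel_measurable lebesgue" "(\<lambda>x. grad \<phi> x $ i) \<in> borel_measurable lebesgue"
      using mb by (auto intro!: measurable_completion)
    have "(LINT x|lebesgue. u x * grad \<phi> x $ i) = (LINT x|lborel. u' x * grad \<phi> x $ i)"
      by (rule integral_lebesgue_eq_lborel) (use mb ml u in \<open>auto elim!: eventually_mono\<close>)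
    moreover have "(LINT x|lebesgue. g x $ i * \<phi> x) = (LINT x|lborel. g' x $ i * \<phi> x)"
    proof (rule integral_lebesgue_eq_lborel)
      show "(\<lambda>x. g x $ i * \<phi> x) \<in> borel_measurable lebesgue" by (intro borel_measurable_times comp ml) measurable
      show "(\<lambda>x. g' x $ i * \<phi> x) \<in> borel_measurable borel" by (intro borel_measurable_times comp mb) measurable
    qed (use gi[of i] in \<open>auto elim!: eventually_mono\<close>)
    moreover have "(LINT x|lebesgue. u x * grad \<phi> x $ i) = - (LINT x|lebesgue. g x $ i * \<phi> x)"
      using w t by (simp add: has_weak_gradient_def)
    ultimately show "(LINT x|lborel. u' x * grad \<phi> x $ i) = - (LINT x|lborel. g' x $ i * \<phi> x)" by simp
  qed
qed

lemma pow_integral_representative: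
  fixes f f' :: "real ^ 'n \<Rightarrow> 'b::euclidean_space"
  assumes f: "f \<in> Lp p" and f': "f' \<in> borel_measurable borel" and eq: "AE x in lebesgue. f x = f' x"
  shows "pow_integral p f' < \<infinity>"
proof -
  have "pow_integral p f' = (\<integral>\<^sup>+x. ennreal (norm (f' x) powr p) \<partial>lebesgue)" by (simp add: pow_integral_def nn_integral_completion)
  also have "\<dots> = (\<integral>\<^sup>+x. ennreal (norm (f x) powr p) \<partial>lebesgue)"
    by (rule nn_integral_cong_AE) (use eq in eventually_elim, simp)
  also have "\<dots> < \<infinity>" using f by (simp add: Lp_def integrable_iff_bounded)
  finally show ?thesis .
qed

text \<open>Borel representatives of \<open>u\<close> and of both weak gradients turn the statement into \<open>solution_vanishes\<close>. The
weight is replaced by its homogeneous extension from the sphere, redefined at the origin so that bounds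
and dilation invariance hold at every point.\<close>

theorem theorem1p2:
  fixes p :: real
    and a :: "real ^ 'n \<Rightarrow> real"
    and \<Theta> :: "real ^ 'n \<Rightarrow> real"
    and u :: "real ^ 'n \<Rightarrow> real"
  assumes "1 < p" and "p < real CARD('n)"
    and "a \<in> Linf"
    and "\<And>x. x \<noteq> 0 \<Longrightarrow> a x = \<Theta> (x /\<^sub>R norm x)"
    and "C1_on_submanifold (sphere 0 1) \<Theta>"
    and "(INF \<omega>\<in>sphere 0 1. \<Theta> \<omega>) > 0"
    and "u \<in> W1p p"
    and "weak_solution p a u"
  shows "AE x in lebesgue. u x = 0"
proof -
  let ?S = "sphere (0::real^'n) 1"
  have cont: "continuous_on ?S \<Theta>" by (rule C1_on_submanifold_continuous[OF assms(5)])
  hence "compact (\<Theta> ` ?S)" by (rule compact_continuous_image) simp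
  hence bd: "bounded (\<Theta> ` ?S)" by (rule compact_imp_bounded)
  define am where "am = (INF \<omega>\<in>?S. \<Theta> \<omega>)"
  have am: "am > 0" "\<And>\<omega>. \<omega> \<in> ?S \<Longrightarrow> am \<le> \<Theta> \<omega>"
    using assms(6) bounded_imp_bdd_below[OF bd] by (auto simp: am_def intro: cINF_lower)
  obtain K where K: "\<And>\<omega>. \<omega> \<in> ?S \<Longrightarrow> \<bar>\<Theta> \<omega>\<bar> \<le> K" using bd unfolding bounded_iff by (metis imageI real_norm_def)
  define aM where "aM = max am K"
  define a' where "a' x = (if x = 0 then am else \<Theta> (x /\<^sub>R norm x))" for x :: "real^'n"
  have unit: "x /\<^sub>R norm x \<in> ?S" if "x \<noteq> 0" for x :: "real^'n" using that by simp
  have a'_meas [measurable]: "a' \<in> borel_measurable borel"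
  proof -
    have "continuous_on (- {0}) (\<lambda>x. \<Theta> (x /\<^sub>R norm x))"
    proof (rule continuous_on_compose2[OF cont])
      show "(\<lambda>x. x /\<^sub>R norm x) ` (- {0}) \<subseteq> ?S" using unit by blast
    qed (auto intro!: continuous_intros)
    hence "(\<lambda>x. if x \<in> - {0} then \<Theta> (x /\<^sub>R norm x) else am) \<in> borel_measurable borel"
      by (intro borel_measurable_continuous_on_if continuous_on_const) auto
    moreover have "a' = (\<lambda>x. if x \<in> - {0} then \<Theta> (x /\<^sub>R norm x) else am)" by (auto simp: a'_def)
    ultimately show ?thesis by (simp only:)
  qed
  have a'_lower: "am \<le> a' x" for x using am unit[of x] by (simp add: a'_def)
  have a'_upper: "a' x \<le> aM" for x
    using K[of "x /\<^sub>R norm x"] unit[of x] by (auto simp: a'_def aM_def le_max_iff_disj)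
  have a'_dil: "a' (\<mu> *\<^sub>R x) = a' x" if "\<mu> > 0" for \<mu> x
  proof -
    have "inverse (\<mu> * norm x) * \<mu> = inverse (norm x)" using that by (simp add: field_simps)
    hence "(\<mu> *\<^sub>R x) /\<^sub>R norm (\<mu> *\<^sub>R x) = x /\<^sub>R norm x" using that by (simp only: norm_scaleR abs_of_pos scaleR_scaleR)
    thus ?thesis using that by (simp only: a'_def scaleR_eq_0_iff) auto
  qed
  have "AE x in lborel. x \<noteq> (0::real^'n)" using AE_lborel_singleton by blast
  hence "AE x in lebesgue. x \<noteq> (0::real^'n)" by (rule AE_completion)
  hence a_eq: "AE x in lebesgue. a x = a' x" by eventually_elim (simp add: a'_def assms(4))

  obtain g0 where w0: "has_weak_gradient u g0" and weq: "\<And>\<phi>. test_function \<phi> \<Longrightarrow>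
          (LINT x|lebesgue. norm (g0 x) powr (p - 2) * (g0 x \<bullet> grad \<phi> x) + a x * \<bar>u x\<bar> powr (p - 2) * u x * \<phi> x)
          = (LINT x|lebesgue. \<bar>u x\<bar> powr (critical_exponent CARD('n) p - 2) * u x * \<phi> x)"
    using assms(8) unfolding weak_solution_def by blast
  obtain g1 where w1: "has_weak_gradient u g1" "g1 \<in> Lp p" and uLp: "u \<in> Lp p"
    using assms(7) unfolding W1p_def by blast
  have um [measurable]: "u \<in> borel_measurable lebesgue" using uLp by (simp add: Lp_def)
  have g0m [measurable]: "g0 \<in> borel_measurable lebesgue" using w0 by (auto simp: has_weak_gradient_def intro: L1_loc_measurable)
  have g1m: "g1 \<in> borel_measurable lebesgue" using w1 by (simp add: Lp_def)
  have am_meas [measurable]: "a \<in> borel_measurable lebesgue" using assms(3) by (simp add: Linf_def)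
  obtain u' where u'm [measurable]: "u' \<in> borel_measurable borel" and u': "AE x in lebesgue. u x = u' x"
    by (rule borel_representative[OF um])
  obtain g0' where g0'm [measurable]: "g0' \<in> borel_measurable borel" and g0': "AE x in lebesgue. g0 x = g0' x"
    by (rule borel_representative_vec[OF g0m])
  obtain g1' where g1'm: "g1' \<in> borel_measurable borel" and g1': "AE x in lebesgue. g1 x = g1' x"
    by (rule borel_representative_vec[OF g1m])
  have W0: "weak_gradient u' g0'" by (rule weak_gradient_representative[OF w0 u'm g0'm u' g0'])
  have W1: "weak_gradient u' g1'" by (rule weak_gradient_representative[OF w1(1) u'm g1'm u' g1'])
  have fu: "pow_integral p u' < \<infinity>" by (rule pow_integral_representative[OF uLp u'm u'])
  have "pow_integral p g1' < \<infinity>" by (rule pow_integral_representative[OF w1(2) g1'm g1'])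
  moreover have "pow_integral p g0' = pow_integral p g1'"
    unfolding pow_integral_def by (rule nn_integral_cong_AE) (use weak_gradient_unique[OF W0 W1] in eventually_elim, simp)
  ultimately have fg: "pow_integral p g0' < \<infinity>" by simp
  interpret critical_solution p "real CARD('n)" u' g0' a' am aM
  proof
    fix \<phi> :: "real^'n \<Rightarrow> real" assume t: "test_function \<phi>"
    have sm: "smooth \<phi>" using t by (rule test_function_smooth)
    note mb [measurable] = smooth_measurable[OF sm] smooth_grad_measurable[OF sm]
    have ml [measurable]: "\<phi> \<in> borel_measurable lebesgue" "grad \<phi> \<in> borel_measurable lebesgue"
      using mb by (auto intro!: measurable_completion)
    have "(LINT x|lebesgue. norm (g0 x) powr (p - 2) * (g0 x \<bullet> grad \<phi> x) + a x * \<bar>u x\<bar> powr (p - 2) * u x * \<phi> x)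
      = (LINT x|lborel. norm (g0' x) powr (p - 2) * (g0' x \<bullet> grad \<phi> x) + a' x * \<bar>u' x\<bar> powr (p - 2) * u' x * \<phi> x)"
    proof (rule integral_lebesgue_eq_lborel)
      show "AE x in lebesgue. norm (g0 x) powr (p - 2) * (g0 x \<bullet> grad \<phi> x) + a x * \<bar>u x\<bar> powr (p - 2) * u x * \<phi> x
        = norm (g0' x) powr (p - 2) * (g0' x \<bullet> grad \<phi> x) + a' x * \<bar>u' x\<bar> powr (p - 2) * u' x * \<phi> x"
        using g0' u' a_eq by eventually_elim simp
    qed measurable
    moreover have "(LINT x|lebesgue. \<bar>u x\<bar> powr (critical_exponent CARD('n) p - 2) * u x * \<phi> x)
      = (LINT x|lborel. \<bar>u' x\<bar> powr (critical_exponent CARD('n) p - 2) * u' x * \<phi> x)"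
    proof (rule integral_lebesgue_eq_lborel)
      show "AE x in lebesgue. \<bar>u x\<bar> powr (critical_exponent CARD('n) p - 2) * u x * \<phi> x
        = \<bar>u' x\<bar> powr (critical_exponent CARD('n) p - 2) * u' x * \<phi> x"
        using u' by eventually_elim simp
    qed measurable
    ultimately show "(LINT x|lborel. norm (g0' x) powr (p - 2) * (g0' x \<bullet> grad \<phi> x) + a' x * \<bar>u' x\<bar> powr (p - 2) * u' x * \<phi> x)
      = (LINT x|lborel. \<bar>u' x\<bar> powr (real CARD('n) * p / (real CARD('n) - p) - 2) * u' x * \<phi> x)"
      using weq[OF t] by (simp add: critical_exponent_def)
  qed (use assms(1,2) W0 fu fg am a'_lower a'_upper a'_dil in auto)
  have "AE x in lebesgue. u' x = 0" by (rule AE_completion[OF solution_vanishes])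
  thus ?thesis using u' by eventually_elim simp
qed

end
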